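(* Let $U,V\subset\mathbb R^3$ be domains, $(s,t)\subset\mathbb R$ an open interval, $\underline a=\sum_{i=1}^3a_ie_i\in C^1(U,V)$ a diffeomorphism with real-valued components, and $a:(s,t)\times U\to(s,t)\times V$, $a(x)=x_0+\underline a(\underline x)$. Let $\Omega\subset(s,t)\times U$ be a domain such that $\overline{a(\Omega)}\subset(s,t)\times V$, $\partial\Omega$ and $\partial(a(\Omega))$ are 3-dimensional compact smooth surfaces, and $\overline{a(\Omega)}\subset\mathbb H\setminus\mathbb R$. Then for all $f,g\in C^1(\overline\Omega,\mathbb H)$, $$\int_{\partial\Omega}g\,J_a\nu_{a(x)}\,f=4\int_\Omega g\,\frac{\underline a(\underline x)}{\|\underline a(\underline x)\|^2}\,f\,M_a\,dx-2\int_\Omega\frac1{\|\underline a(\underline x)\|^2}\big[\mathcal H_{a,r}(g)(x)\,\underline a(\underline x)\,f(x)+g(x)\,\underline a(\underline x)\,\mathcal H_a(f)(x)\big]M_a\,dx.$$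
   Context: $\mathbb H$ is the skew-field of quaternions with imaginary units $e_1,e_2,e_3$; $x=x_0+\underline x$, $\underline x=\sum_{k=1}^3x_ke_k$, $\|\cdot\|$ the Euclidean norm; $\mathbb R\times\mathbb R^3=\mathbb H$. "Diffeomorphism" means a $C^1$ bijection with $C^1$ inverse; $(a^{-1})_j$ is the $j$-th real component of $(\underline a)^{-1}$. With $u_i:=\sum_{j=1}^3a_j\big(\frac{\partial(a^{-1})_i}{\partial y_j}\circ a\big)$, $$\mathcal H_a(f)=\underline a\frac{\partial f}{\partial x_0}-\sum_{i=1}^3u_i\frac{\partial f}{\partial x_i},\qquad \mathcal H_{a,r}(f)=\frac{\partial f}{\partial x_0}\underline a-\sum_{i=1}^3u_i\frac{\partial f}{\partial x_i}.$$ For $x\in\mathbb H\setminus\mathbb R$, $\nu_x=2\,d\hat x_0+2\frac{\underline x}{\|\underline x\|^2}\sum_{k=1}^3x_k\,d\hat x_k$, where $d\hat x_k$ is the 3-form with $dx_k\wedge d\hat x_k=dx_0\wedge dx_1\wedge dx_2\wedge dx_3$; on a boundary surface with outward unit normal $(n_0,\dots,n_3)$ and surface measure $dS$ it restricts to $n_k\,dS$. $M_a=|\det Da|$, with $Da$ the Jacobian matrix of $a$, and $J_a\nu_{a(x)}$ is $\nu$ transported to $\partial\Omega$ by the change of variables $a$: for continuous $\varphi,\psi$ on $\partial\Omega$, $\int_{\partial\Omega}\varphi\,J_a\nu_{a(x)}\,\psi=\int_{\partial a(\Omega)}(\varphi\circ a^{-1})\,\nu\,(\psi\circ a^{-1})$.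 $C^1(\overline\Omega,\mathbb H)$ denotes functions continuously differentiable up to the boundary. *)

theory Defs
  imports "HOL-Analysis.Analysis"
begin

section \<open>Quaternions\<close>

text \<open>
  The quaternions are \<open>\<real> \<times> \<real>\<^sup>3\<close>: the pair \<open>(x\<^sub>0, v)\<close> stands for \<open>x\<^sub>0 + v\<^sub>1 e\<^sub>1 + v\<^sub>2 e\<^sub>2 + v\<^sub>3 e\<^sub>3\<close>.
  The norm and the Lebesgue measure of the product type are those of \<open>\<real>\<^sup>4\<close>.
\<close>

type_synonym quat = "real \<times> (real^3)"

definition qmult :: "quat \<Rightarrow> quat \<Rightarrow> quat" (infixl "*\<^sub>H" 70) where
  "p *\<^sub>H q = (fst p * fst q - snd p \<bullet> snd q,
               fst p *\<^sub>R snd q + fst q *\<^sub>R snd p + cross3 (snd p) (snd q))"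

text \<open>A vector of \<open>\<real>\<^sup>3\<close> as a purely imaginary quaternion.\<close>

definition imq :: "real^3 \<Rightarrow> quat" where
  "imq v = (0, v)"

text \<open>The index \<open>None\<close> is the real direction, \<open>Some i\<close> is the direction \<open>e\<^sub>i\<close>.\<close>

definition qunit :: "3 option \<Rightarrow> quat" where
  "qunit k = (case k of None \<Rightarrow> (1, 0) | Some i \<Rightarrow> (0, axis i 1))"

definition qpartial :: "3 option \<Rightarrow> (quat \<Rightarrow> quat) \<Rightarrow> quat \<Rightarrow> quat" where
  "qpartial k f x = frechet_derivative f (at x) (qunit k)"

definition jacobian_matrix :: "(quat \<Rightarrow> quat) \<Rightarrow> quat \<Rightarrow> real^(3 option)^(3 option)" where
  "jacobian_matrix F x = (\<chi> i j. qpartial j F x \<bullet> qunit i)"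


section \<open>Differentiability classes\<close>

definition region :: "'a::topological_space set \<Rightarrow> bool" where
  "region S \<longleftrightarrow> open S \<and> connected S \<and> S \<noteq> {}"

text \<open>\<open>C\<^sup>k\<close> regularity, meant for open \<open>S\<close>.\<close>

primrec Ck_on :: "nat \<Rightarrow> ('a::euclidean_space \<Rightarrow> 'b::real_normed_vector) \<Rightarrow> 'a set \<Rightarrow> bool" where
  "Ck_on 0 f S \<longleftrightarrow> continuous_on S f"
| "Ck_on (Suc k) f S \<longleftrightarrow> f differentiable_on S \<and>
     (\<forall>b\<in>Basis. Ck_on k (\<lambda>x. frechet_derivative f (at x) b) S)"

definition C1_diffeo :: "(real^3) set \<Rightarrow> (real^3) set \<Rightarrow> (real^3 \<Rightarrow> real^3) \<Rightarrow> bool" where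
  "C1_diffeo U V \<alpha> \<longleftrightarrow> bij_betw \<alpha> U V \<and> Ck_on 1 \<alpha> U \<and> Ck_on 1 (inv_into U \<alpha>) V"

text \<open>
  \<open>C\<^sup>1\<close> up to the boundary of an open set \<open>\<Omega>\<close>: the function is continuous on the closure and its
  first partial derivatives, taken in \<open>\<Omega>\<close>, have continuous extensions to the closure.
\<close>

definition C1_closure :: "quat set \<Rightarrow> (quat \<Rightarrow> quat) \<Rightarrow> bool" where
  "C1_closure \<Omega> f \<longleftrightarrow> continuous_on (closure \<Omega>) f \<and> f differentiable_on \<Omega> \<and>
     (\<forall>k. \<exists>h. continuous_on (closure \<Omega>) h \<and> (\<forall>x\<in>\<Omega>. h x = qpartial k f x))"


section \<open>Smooth hypersurfaces of \<open>\<real>\<^sup>4\<close>, surface measure, outward normal\<close>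

definition local_parametrization :: "quat set \<Rightarrow> (real^3) set \<Rightarrow> (real^3 \<Rightarrow> quat) \<Rightarrow> bool" where
  "local_parametrization S W \<phi> \<longleftrightarrow>
     open W \<and> (\<forall>k. Ck_on k \<phi> W) \<and> (\<forall>y\<in>W. inj (frechet_derivative \<phi> (at y))) \<and>
     (\<exists>\<psi>. homeomorphism W (\<phi> ` W) \<phi> \<psi>) \<and> openin (top_of_set S) (\<phi> ` W)"

definition smooth_surface :: "quat set \<Rightarrow> bool" where
  "smooth_surface S \<longleftrightarrow> (\<forall>p\<in>S. \<exists>W \<phi>. local_parametrization S W \<phi> \<and> p \<in> \<phi> ` W)"

text \<open>The area element: the square root of the Gram determinant of the tangent vectors.\<close>

definition area_element :: "(real^3 \<Rightarrow> quat) \<Rightarrow> real^3 \<Rightarrow> real" where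
  "area_element \<phi> y = sqrt (det (\<chi> i j.
     frechet_derivative \<phi> (at y) (axis i 1) \<bullet> frechet_derivative \<phi> (at y) (axis j 1) :: real^3^3))"

text \<open>
  The surface measure is the Borel measure on \<open>S\<close> which in every local parametrization has the
  area element as its density; on a smooth surface it exists and is unique.
\<close>

definition surface_measure :: "quat set \<Rightarrow> quat measure" where
  "surface_measure S = (THE \<sigma>. sets \<sigma> = sets (restrict_space borel S) \<and>
     (\<forall>W \<phi> A. local_parametrization S W \<phi> \<and> A \<in> sets borel \<and> A \<subseteq> \<phi> ` W \<longrightarrow>
        emeasure \<sigma> A = (\<integral>\<^sup>+y\<in>{y\<in>W. \<phi> y \<in> A}. ennreal (area_element \<phi> y) \<partial>lborel)))"

definition is_outward_normal :: "quat set \<Rightarrow> quat \<Rightarrow> quat \<Rightarrow> bool" where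
  "is_outward_normal G p n \<longleftrightarrow> norm n = 1 \<and>
     (\<forall>W \<phi> y v. local_parametrization (frontier G) W \<phi> \<and> y \<in> W \<and> \<phi> y = p \<longrightarrow>
        n \<bullet> frechet_derivative \<phi> (at y) v = 0) \<and>
     (\<exists>\<epsilon>>0. \<forall>r. 0 < r \<and> r < \<epsilon> \<longrightarrow> p - r *\<^sub>R n \<in> G \<and> p + r *\<^sub>R n \<notin> G)"

text \<open>
  As in geometric measure theory, the normal is set to \<open>0\<close> where it does not exist. For a
  domain bounded by a compact smooth surface it exists everywhere on the boundary, since by the
  Jordan-Brouwer theorem the domain lies locally on one side of its boundary.
\<close>

definition outward_normal :: "quat set \<Rightarrow> quat \<Rightarrow> quat" where
  "outward_normal G p =
     (if \<exists>n. is_outward_normal G p n then (THE n. is_outward_normal G p n) else 0)"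


section \<open>The form \<open>\<nu>\<close> and its transport\<close>

text \<open>
  The density of the form \<open>\<nu>\<close> with respect to the surface measure of the boundary of \<open>G\<close>: each
  3-form \<open>dx\<^sub>k\<close>-hat in \<open>\<nu>\<close> is replaced by the normal component \<open>n\<^sub>k\<close>.
\<close>

definition nu_density :: "quat set \<Rightarrow> quat \<Rightarrow> quat" where
  "nu_density G y = (let n = outward_normal G y in
     (2 * fst n, 0) +
     (2 * (\<Sum>k\<in>UNIV. snd y $ k * snd n $ k) / (norm (snd y))\<^sup>2) *\<^sub>R imq (snd y))"

definition nu_integral :: "quat set \<Rightarrow> (quat \<Rightarrow> quat) \<Rightarrow> (quat \<Rightarrow> quat) \<Rightarrow> quat" where
  "nu_integral G \<phi> \<psi> =
     (LINT y|surface_measure (frontier G). \<phi> y *\<^sub>H nu_density G y *\<^sub>H \<psi> y)"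

text \<open>The map \<open>x \<mapsto> x\<^sub>0 + \<alpha> (x\<^sub>1, x\<^sub>2, x\<^sub>3)\<close>; here and below \<open>\<alpha>\<close> is the underlined \<open>a\<close>.\<close>

definition amap :: "(real^3 \<Rightarrow> real^3) \<Rightarrow> quat \<Rightarrow> quat" where
  "amap \<alpha> x = (fst x, \<alpha> (snd x))"

text \<open>
  The integral of \<open>\<phi> J\<^sub>a\<nu>\<^bsub>a(x)\<^esub> \<psi>\<close> over the boundary of \<open>\<Omega>\<close>, where \<open>a\<close> is considered on \<open>D \<supseteq> \<Omega>\<close>.
\<close>

definition transported_nu_integral ::
    "quat set \<Rightarrow> (real^3 \<Rightarrow> real^3) \<Rightarrow> quat set \<Rightarrow> (quat \<Rightarrow> quat) \<Rightarrow> (quat \<Rightarrow> quat) \<Rightarrow> quat" where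
  "transported_nu_integral D \<alpha> \<Omega> \<phi> \<psi> =
     nu_integral (amap \<alpha> ` \<Omega>) (\<phi> \<circ> inv_into D (amap \<alpha>)) (\<psi> \<circ> inv_into D (amap \<alpha>))"

definition M_jac :: "(real^3 \<Rightarrow> real^3) \<Rightarrow> quat \<Rightarrow> real" where
  "M_jac \<alpha> x = \<bar>det (jacobian_matrix (amap \<alpha>) x)\<bar>"


section \<open>The operators \<open>\<H>\<^sub>a\<close> and \<open>\<H>\<^bsub>a,r\<^esub>\<close>\<close>

definition u_coeff :: "(real^3) set \<Rightarrow> (real^3 \<Rightarrow> real^3) \<Rightarrow> 3 \<Rightarrow> real^3 \<Rightarrow> real" where
  "u_coeff U \<alpha> i v = (\<Sum>j\<in>UNIV. \<alpha> v $ j *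
     frechet_derivative (\<lambda>y. inv_into U \<alpha> y $ i) (at (\<alpha> v)) (axis j 1))"

definition H_left :: "(real^3) set \<Rightarrow> (real^3 \<Rightarrow> real^3) \<Rightarrow> (quat \<Rightarrow> quat) \<Rightarrow> quat \<Rightarrow> quat" where
  "H_left U \<alpha> f x = imq (\<alpha> (snd x)) *\<^sub>H qpartial None f x
     - (\<Sum>i\<in>UNIV. u_coeff U \<alpha> i (snd x) *\<^sub>R qpartial (Some i) f x)"

definition H_right :: "(real^3) set \<Rightarrow> (real^3 \<Rightarrow> real^3) \<Rightarrow> (quat \<Rightarrow> quat) \<Rightarrow> quat \<Rightarrow> quat" where
  "H_right U \<alpha> f x = qpartial None f x *\<^sub>H imq (\<alpha> (snd x))
     - (\<Sum>i\<in>UNIV. u_coeff U \<alpha> i (snd x) *\<^sub>R qpartial (Some i) f x)"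

end

theory Submission
  imports Defs "HOL-Library.Option_ord"
begin

text \<open>
  The change of variables \<open>a\<close> reduces the formula to the domain \<open>G = a(\<Omega>)\<close>, where it is the
  divergence theorem for the fields \<open>\<phi> \<nu>\<^sub>k \<psi>\<close>: the terms \<open>\<partial>\<^sub>k \<nu>\<^sub>k\<close> add up to
  \<open>4 y / \<bar>y\<bar>\<^sup>2\<close> for imaginary \<open>y\<close>, and \<open>y\<^sup>2 = - \<bar>y\<bar>\<^sup>2\<close> turns the remaining terms into \<open>\<H>\<close>.

  The divergence theorem is local by a partition of unity and linear in the direction \<open>v\<close> of
  differentiation, so \<open>v\<close> may be taken transversal to the surface. If \<open>\<phi>\<close> parametrizes the surface, then
  \<open>(t, y) \<mapsto> \<phi> y + t v\<close> is a local diffeomorphism whose Jacobian \<open>\<bar>n \<bullet> v\<bar> * area_element \<phi> y\<close> does not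
  depend on \<open>t\<close>, and Fubini's theorem reduces the claim to the fundamental theorem of calculus in \<open>t\<close>.
  No separation theorem is needed: where the domain lies on both sides of its boundary, the two
  contributions cancel, in agreement with the convention that the normal is \<open>0\<close> there.
\<close>

section \<open>Quaternions and the change of variables formula\<close>

text \<open>The factor -2 of the bracket comes from the shape of \<nu>. For imaginary y, left
  multiplication by -2 y / |y|^2 turns y d_0 - sum y_k d_k into 2 d_0 + 2 (y / |y|^2) sum y_k d_k,
  and this is the sum of the \<nu>_k d_k. Three obstacles shape the rest. A chart has only a
  continuous inverse on the surface, so even the differentiability of chart changes has to come from
  the transversal flow. The surface measure is a definite description and says nothing until
  existence and uniqueness of such a measure are established. Finally, derivatives are available
  only inside the domain, so the fundamental theorem of calculus is used with mere continuity at the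
  boundary end of each segment, and integrability rests on bounded derivatives over a bounded
  domain. Boundedness is itself derived, from the compact boundary and the absence of real points in
  a(\<Omega>).\<close>

lemma UNIV_option_3: "(UNIV::3 option set) = {None, Some 1, Some 2, Some 3}"
  by (simp add: UNIV_option_conv UNIV_3)

lemma sum_option_3: "sum f (UNIV::3 option set) = f None + (\<Sum>i\<in>UNIV. f (Some i))"
  by (simp add: UNIV_option_3 sum_3 algebra_simps)

lemma bilinear_qmult: "bilinear (*\<^sub>H)"
  unfolding bilinear_def
  by (auto intro!: linearI simp: qmult_def algebra_simps inner_add_left inner_add_right
      cross_add_left cross_add_right cross_mult_left cross_mult_right)

interpretation qmult: bounded_bilinear "(*\<^sub>H)"
  using bilinear_conv_bounded_bilinear bilinear_qmult by blast

lemma qmult_assoc: "p *\<^sub>H q *\<^sub>H r = p *\<^sub>H (q *\<^sub>H r)"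
  by (cases p; cases q; cases r) (auto simp: qmult_def cross3_simps forall_3)

lemma imq_mult_self: "imq v *\<^sub>H imq v = (- (norm v)\<^sup>2, 0)"
  by (simp add: imq_def qmult_def power2_norm_eq_inner)

text \<open>Expansion along the row \<open>None\<close>. In the application this row holds the inner
  products of a normal with the tangent vectors, which is why it vanishes off the diagonal.\<close>

lemma det_block_option:
  fixes A :: "real^(3 option)^(3 option)"
  assumes "\<And>i. A$None$(Some i) = 0"
  shows "det A = A$None$None * det (\<chi> i j. A$(Some i)$(Some j))"
proof -
  have f0: "finite {Some 1, Some 2, Some (3::3)}" "None \<notin> {Some 1, Some 2, Some (3::3)}" by auto
  have f1: "finite {Some 2, Some (3::3)}" "Some 1 \<notin> {Some 2, Some (3::3)}" by auto
  have f2: "finite {Some (3::3)}" "Some 2 \<notin> {Some (3::3)}" by auto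
  show ?thesis
    unfolding det_def UNIV_option_3
    unfolding sum_over_permutations_insert[OF f0]
    unfolding sum_over_permutations_insert[OF f1]
    unfolding sum_over_permutations_insert[OF f2]
    unfolding permutes_sing
    unfolding det_def[symmetric] det_3
    using assms
    by (simp add: sign_swap_id permutation_swap_id sign_compose sign_id swap_id_eq
        permutation_compose Transposition.transpose_def algebra_simps)
qed

section \<open>The measure of the image under an injective differentiable map\<close>

text \<open>\<open>has_measure_differentiable_image\<close> ties finite measure of the image to
  integrability of the Jacobian as an equivalence. Read backwards it settles the finite case; read
  forwards it shows that an infinite integral forces an infinite image measure, so the identity
  holds in the extended reals.\<close>

lemma emeasure_image_eq_nn_integral:
  fixes g :: "real^'n::{finite,wellorder} \<Rightarrow> real^'n::_"
  assumes A: "A \<in> sets borel"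
    and der: "\<And>x. x \<in> A \<Longrightarrow> (g has_derivative g' x) (at x within A)"
    and inj: "inj_on g A"
    and meas: "(\<lambda>x. indicator A x * \<bar>det (matrix (g' x))\<bar>) \<in> borel_measurable borel"
  shows "emeasure lebesgue (g ` A) = (\<integral>\<^sup>+x. ennreal (indicator A x * \<bar>det (matrix (g' x))\<bar>) \<partial>lborel)"
proof -
  let ?h = "\<lambda>x. indicator A x * \<bar>det (matrix (g' x))\<bar>"
  have Al: "A \<in> sets lebesgue" using A by auto
  have iff: "g ` A \<in> lmeasurable \<and> measure lebesgue (g ` A) = m \<longleftrightarrow> (?h has_integral m) UNIV" for m
  proof -
    have "(?h has_integral m) UNIV \<longleftrightarrow> ((\<lambda>x. \<bar>det (matrix (g' x))\<bar>) has_integral m) A"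
    proof -
      have "?h = (\<lambda>x. if x \<in> A then \<bar>det (matrix (g' x))\<bar> else 0)" by (auto simp: fun_eq_iff)
      then show ?thesis by (simp add: has_integral_restrict_UNIV)
    qed
    then show ?thesis using has_measure_differentiable_image[OF Al der inj] by simp
  qed
  have gl: "g ` A \<in> sets lebesgue"
    by (rule differentiable_image_in_sets_lebesgue[OF Al])
      (use der in \<open>auto simp: differentiable_on_def differentiable_def\<close>)
  show ?thesis
  proof (cases "(\<integral>\<^sup>+x. ennreal (?h x) \<partial>lborel) = \<infinity>")
    case False
    then obtain r where r: "0 \<le> r" "(\<integral>\<^sup>+x. ennreal (?h x) \<partial>lborel) = ennreal r"
      by (cases "(\<integral>\<^sup>+x. ennreal (?h x) \<partial>lborel)") auto
    then have "(?h has_integral r) UNIV"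
      using meas by (intro nn_integral_has_integral) auto
    then show ?thesis using iff[of r] r by (simp add: emeasure_eq_measure2)
  next
    case True
    have "\<not> emeasure lebesgue (g ` A) < \<infinity>"
    proof
      assume "emeasure lebesgue (g ` A) < \<infinity>"
      then have "g ` A \<in> lmeasurable" using gl by (simp add: fmeasurable_def)
      then have "(?h has_integral measure lebesgue (g ` A)) UNIV" using iff by blast
      then have "integral\<^sup>N lborel ?h = ennreal (measure lebesgue (g ` A))"
        using meas by (intro nn_integral_has_integral_lborel) auto
      then show False using True by simp
    qed
    then show ?thesis using True by (simp add: less_top[symmetric])
  qed
qed

text \<open>Determinants and the substitution rule speak about vectors, whereas \<open>quat\<close>
  is a pair; the two inverse maps translate. The index type \<open>3 option\<close> gets the
  well-order that the substitution rule asks for from \<open>Option_ord\<close>.\<close>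

definition qvec :: "quat \<Rightarrow> real^(3 option)" where "qvec x = (\<chi> k. x \<bullet> qunit k)"
definition vecq :: "real^(3 option) \<Rightarrow> quat" where "vecq v = (v$None, \<chi> i. v$(Some i))"

lemma qunit_simps: "qunit None = (1,0)" "qunit (Some i) = (0, axis i 1)"
  by (simp_all add: qunit_def)

lemma inner_qunit: "x \<bullet> qunit None = fst x" "x \<bullet> qunit (Some i) = snd x $ i"
  by (simp_all add: qunit_simps inner_prod_def inner_axis)

lemma vecq_qvec [simp]: "vecq (qvec x) = x" and qvec_vecq [simp]: "qvec (vecq v) = v"
  by (auto simp: vecq_def qvec_def inner_qunit prod_eq_iff vec_eq_iff split: option.splits)
   (metis inner_qunit fst_conv snd_conv vec_lambda_beta option.exhaust)+

lemma linear_qvec: "linear qvec" and linear_vecq: "linear vecq"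
  by (intro linearI; simp add: qvec_def vecq_def vec_eq_iff inner_add_left)+

lemma vecq_axis: "vecq (axis k 1) = qunit k"
  by (cases k) (auto simp: vecq_def qunit_simps axis_def vec_eq_iff)

lemma Basis_quat: "(Basis::quat set) = range qunit"
proof -
  have "(Basis::quat set) = insert (qunit None) (range (\<lambda>i. qunit (Some i)))"
    unfolding Basis_prod_def by (auto simp: qunit_simps Basis_vec_def)
  also have "\<dots> = range qunit"
    by (auto simp: image_def) (metis option.exhaust)
  finally show ?thesis .
qed

lemma inj_qunit: "inj qunit"
proof (rule injI)
  fix i j assume "qunit i = qunit j" then have "vecq (axis i 1) = vecq (axis j 1)" by (simp add: vecq_axis)
  then have "axis i (1::real) = axis j 1" by (metis qvec_vecq)
  then show "i = j" by (simp add: axis_eq_axis)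
qed

text \<open>Lebesgue measure is determined by its values on boxes, and \<open>vecq\<close> only
  relabels coordinates, so boxes pull back to boxes with the same sides.\<close>

lemma lborel_quat: "(lborel :: quat measure) = distr lborel borel vecq"
proof (rule lborel_eqI)
  have m[measurable]: "vecq \<in> borel_measurable borel"
    using linear_vecq by (intro borel_measurable_continuous_onI linear_continuous_on) (simp add: linear_conv_bounded_linear)
  fix l u :: quat assume le: "\<And>b. b \<in> Basis \<Longrightarrow> l \<bullet> b \<le> u \<bullet> b"
  then have le': "l \<bullet> qunit k \<le> u \<bullet> qunit k" for k by (simp add: Basis_quat)
  have eq: "vecq -` box l u = box (qvec l) (qvec u)"
  proof -
    have "vecq v \<bullet> qunit i = v $ i" for v i by (metis qvec_def qvec_vecq vec_lambda_beta)
    then show ?thesis by (auto simp: box_def Basis_quat Basis_vec_def inner_axis qvec_def)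
  qed
  have "emeasure (distr lborel borel vecq) (box l u) = emeasure lborel (box (qvec l) (qvec u))"
    by (subst emeasure_distr) (auto simp: eq)
  also have "\<dots> = (\<Prod>b\<in>Basis. (qvec u - qvec l) \<bullet> b)"
    using le' by (intro emeasure_lborel_box) (auto simp: Basis_vec_def inner_axis qvec_def)
  also have "(\<Prod>b\<in>Basis. (qvec u - qvec l) \<bullet> b) = (\<Prod>k\<in>UNIV. (qvec u - qvec l) $ k)"
  proof -
    have B: "(Basis :: (real^(3 option)) set) = range (\<lambda>k. axis k 1)" by (auto simp: Basis_vec_def)
    show ?thesis unfolding B by (subst prod.reindex) (auto simp: inj_on_def axis_eq_axis inner_axis)
  qed
  also have "\<dots> = (\<Prod>b\<in>Basis. (u - l) \<bullet> b)"
    unfolding Basis_quat by (subst prod.reindex) (auto simp: inj_qunit qvec_def inner_diff_left)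
  finally show "emeasure (distr lborel borel vecq) (box l u) = ennreal (\<Prod>b\<in>Basis. (u - l) \<bullet> b)" .
qed simp

abbreviation qdet :: "(quat \<Rightarrow> quat) \<Rightarrow> real" where
  "qdet L \<equiv> det (\<chi> i j. L (qunit j) \<bullet> qunit i :: real^(3 option)^(3 option))"

lemma emeasure_image_eq_nn_integral_quat:
  fixes g :: "quat \<Rightarrow> quat"
  assumes A: "A \<in> sets borel" and gA: "g ` A \<in> sets borel"
    and der: "\<And>x. x \<in> A \<Longrightarrow> (g has_derivative g' x) (at x within A)"
    and inj: "inj_on g A"
    and meas: "(\<lambda>x. indicator A x * \<bar>qdet (g' x)\<bar>) \<in> borel_measurable borel"
  shows "emeasure lborel (g ` A) = (\<integral>\<^sup>+x. ennreal (indicator A x * \<bar>qdet (g' x)\<bar>) \<partial>lborel)"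
proof -
  let ?J = "\<lambda>x. \<bar>qdet (g' x)\<bar>"
  have blv: "bounded_linear vecq" "bounded_linear qvec"
    using linear_vecq linear_qvec by (simp_all add: linear_conv_bounded_linear)
  have m[measurable]: "vecq \<in> borel_measurable borel" "qvec \<in> borel_measurable borel"
    using blv by (auto intro!: borel_measurable_continuous_onI linear_continuous_on)
  let ?A = "vecq -` A"
  let ?g = "qvec \<circ> g \<circ> vecq" and ?g' = "\<lambda>v. qvec \<circ> g' (vecq v) \<circ> vecq"
  have mat: "matrix (?g' v) = (\<chi> i j. g' (vecq v) (qunit j) \<bullet> qunit i)" for v
    by (simp add: matrix_def vec_eq_iff vecq_axis qvec_def)
  have A': "?A \<in> sets borel" using measurable_sets[OF m(1) A] by simp
  have img: "?g ` ?A = vecq -` (g ` A)"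
  proof (intro set_eqI iffI)
    fix v assume "v \<in> vecq -` (g ` A)"
    then obtain a where a: "a \<in> A" "vecq v = g a" by auto
    then have "v = ?g (qvec a)" by (metis comp_apply qvec_vecq vecq_qvec)
    then show "v \<in> ?g ` ?A" using a(1) by (intro image_eqI[of _ _ "qvec a"]) auto
  qed auto
  have "emeasure lborel (g ` A) = emeasure lborel (vecq -` (g ` A))"
    by (subst lborel_quat) (simp add: emeasure_distr gA)
  also have "\<dots> = emeasure lebesgue (?g ` ?A)"
    using measurable_sets[OF m(1) gA] by (simp only: img) simp
  also have "\<dots> = (\<integral>\<^sup>+v. ennreal (indicator ?A v * \<bar>det (matrix (?g' v))\<bar>) \<partial>lborel)"
  proof (rule emeasure_image_eq_nn_integral[OF A'])
    show "(?g has_derivative ?g' v) (at v within ?A)" if "v \<in> ?A" for v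
    proof -
      have 1: "(vecq has_derivative vecq) (at v within ?A)"
        using blv(1) bounded_linear_imp_has_derivative by blast
      have "(g has_derivative g' (vecq v)) (at (vecq v) within vecq ` ?A)"
        using der[of "vecq v"] that by (auto intro: has_derivative_subset)
      from diff_chain_within[OF 1 this]
      have 2: "(g \<circ> vecq has_derivative g' (vecq v) \<circ> vecq) (at v within ?A)" .
      show ?thesis unfolding comp_assoc
        by (rule diff_chain_within[OF 2]) (use blv(2) bounded_linear_imp_has_derivative in blast)
    qed
    show "inj_on ?g ?A"
    proof (rule inj_onI)
      fix v w assume "v \<in> ?A" "w \<in> ?A" "?g v = ?g w"
      then have "g (vecq v) = g (vecq w)" by (metis comp_apply vecq_qvec)
      then have "vecq v = vecq w" using inj \<open>v \<in> ?A\<close> \<open>w \<in> ?A\<close> by (auto dest: inj_onD)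
      then show "v = w" by (metis qvec_vecq)
    qed
    have "(\<lambda>v. (\<lambda>x. indicator A x * ?J x) (vecq v)) \<in> borel_measurable borel"
      using meas by measurable
    then show "(\<lambda>v. indicator ?A v * \<bar>det (matrix (?g' v))\<bar>) \<in> borel_measurable borel"
      by (simp add: mat indicator_def)
  qed
  also have "\<dots> = (\<integral>\<^sup>+x. ennreal (indicator A x * ?J x) \<partial>lborel)"
    using meas by (subst lborel_quat, subst nn_integral_distr) (auto simp: mat indicator_def)
  finally show ?thesis .
qed

text \<open>Substitution as an equality of measures, so that the versions for nonnegative and for
  Bochner integrals both follow from the rules for \<open>distr\<close> and \<open>density\<close>.
  The hypothesis \<open>em\<close> is left abstract because it is supplied on \<open>real^3\<close>
  for chart changes and on \<open>quat\<close> for flows and for \<open>amap\<close>. The value 0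
  outside \<open>A\<close> makes the map total and Borel; the density vanishes there.\<close>

lemma distr_change_of_variables:
  fixes g :: "'a::euclidean_space \<Rightarrow> 'a" and J :: "'a \<Rightarrow> real"
  assumes A: "A \<in> sets borel" and gA: "g ` A \<in> sets borel"
    and cont: "continuous_on A g" and inj: "inj_on g A"
    and J: "(\<lambda>x. indicator A x * J x) \<in> borel_measurable borel"
    and em: "\<And>B. \<lbrakk>B \<in> sets borel; B \<subseteq> A; g ` B \<in> sets borel;
      (\<lambda>x. indicator B x * J x) \<in> borel_measurable borel\<rbrakk> \<Longrightarrow>
      emeasure lborel (g ` B) = (\<integral>\<^sup>+x. ennreal (indicator B x * J x) \<partial>lborel)"
  shows "distr (density lborel (\<lambda>x. ennreal (indicator A x * J x))) borel (\<lambda>x. if x \<in> A then g x else 0)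
    = density lborel (indicator (g ` A))" (is "distr ?M borel ?g = ?N")
proof (rule measure_eqI)
  have g[measurable]: "?g \<in> borel_measurable borel"
    using A cont by (intro borel_measurable_continuous_on_if) auto
  note A[measurable] gA[measurable] J[measurable]
  fix C assume "C \<in> sets (distr ?M borel ?g)"
  then have C[measurable]: "C \<in> sets borel" by simp
  \<comment> \<open>The image of this set is the image of \<open>A\<close> intersected with
    \<open>C\<close>, hence Borel, as \<open>em\<close> demands.\<close>
  let ?B = "A \<inter> ?g -` C"
  have B[measurable]: "?B \<in> sets borel" using measurable_sets[OF g C] A by simp
  have gB: "g ` ?B = g ` A \<inter> C" by auto
  have "(\<lambda>x. indicator ?B x * (indicator A x * J x)) \<in> borel_measurable borel" by measurable
  also have "(\<lambda>x. indicator ?B x * (indicator A x * J x)) = (\<lambda>x. indicator ?B x * J x)"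
    by (auto simp: fun_eq_iff split: split_indicator)
  finally have JB: "(\<lambda>x. indicator ?B x * J x) \<in> borel_measurable borel" .
  have "emeasure (distr ?M borel ?g) C = emeasure ?M (?g -` C)"
    by (subst emeasure_distr) auto
  also have "\<dots> = (\<integral>\<^sup>+x. ennreal (indicator A x * J x) * indicator (?g -` C) x \<partial>lborel)"
    using measurable_sets[OF g C] by (subst emeasure_density) auto
  also have "\<dots> = (\<integral>\<^sup>+x. ennreal (indicator ?B x * J x) \<partial>lborel)"
    by (intro nn_integral_cong) (auto simp: indicator_def)
  also have "\<dots> = emeasure lborel (g ` A \<inter> C)"
    using em[OF B _ _ JB] gB by (simp add: gA)
  also have "\<dots> = emeasure ?N C"
  proof -
    have "emeasure ?N C = (\<integral>\<^sup>+x. indicator (g ` A) x * indicator C x \<partial>lborel)"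
      by (subst emeasure_density) auto
    also have "\<dots> = (\<integral>\<^sup>+x. indicator (g ` A \<inter> C) x \<partial>lborel)"
      by (intro nn_integral_cong) (auto simp: indicator_def)
    finally show ?thesis by simp
  qed
  finally show "emeasure (distr ?M borel ?g) C = emeasure ?N C" .
qed simp

lemma distr_change_of_variables_quat:
  fixes g :: "quat \<Rightarrow> quat"
  defines "J \<equiv> \<lambda>g' x. \<bar>qdet (g' x)\<bar>"
  assumes A: "A \<in> sets borel" and gA: "g ` A \<in> sets borel"
    and der: "\<And>x. x \<in> A \<Longrightarrow> (g has_derivative g' x) (at x)"
    and inj: "inj_on g A" and Jm: "(\<lambda>x. indicator A x * J g' x) \<in> borel_measurable borel"
  shows "distr (density lborel (\<lambda>x. ennreal (indicator A x * J g' x))) borel (\<lambda>x. if x \<in> A then g x else 0)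
    = density lborel (indicator (g ` A))"
proof (rule distr_change_of_variables[OF A gA _ inj Jm])
  show "continuous_on A g"
    using der by (intro continuous_at_imp_continuous_on ballI has_derivative_continuous)
  fix B assume B: "B \<in> sets borel" "B \<subseteq> A" "g ` B \<in> sets borel" "(\<lambda>x. indicator B x * J g' x) \<in> borel_measurable borel"
  have "(g has_derivative g' x) (at x within B)" if "x \<in> B" for x
    by (rule has_derivative_at_withinI[OF der]) (use that B(2) in blast)
  from emeasure_image_eq_nn_integral_quat[OF B(1,3) this inj_on_subset[OF inj B(2)] B(4)[unfolded J_def]]
  show "emeasure lborel (g ` B) = (\<integral>\<^sup>+x. ennreal (indicator B x * J g' x) \<partial>lborel)" unfolding J_def .
qed

lemma nn_integral_change_of_variables:
  fixes g :: "'a::euclidean_space \<Rightarrow> 'a" and J :: "'a \<Rightarrow> real"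
  assumes A: "A \<in> sets borel" and gA: "g ` A \<in> sets borel"
    and cont: "continuous_on A g"
    and J: "(\<lambda>x. indicator A x * J x) \<in> borel_measurable borel"
    and eq: "distr (density lborel (\<lambda>x. ennreal (indicator A x * J x))) borel (\<lambda>x. if x \<in> A then g x else 0)
    = density lborel (indicator (g ` A))"
    and F: "(\<lambda>y. indicator (g ` A) y * F y) \<in> borel_measurable borel"
  shows "(\<integral>\<^sup>+y. indicator (g ` A) y * F y \<partial>lborel) = (\<integral>\<^sup>+x. ennreal (indicator A x * J x) * F (g x) \<partial>lborel)"
proof -
  let ?g = "\<lambda>x. if x \<in> A then g x else 0" and ?F = "\<lambda>y. indicator (g ` A) y * F y"
  have g[measurable]: "?g \<in> borel_measurable borel"
    using A cont by (intro borel_measurable_continuous_on_if) auto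
  note A[measurable] gA[measurable] J[measurable] F[measurable]
  have "(\<integral>\<^sup>+y. ?F y \<partial>lborel) = (\<integral>\<^sup>+y. ?F y \<partial>density lborel (indicator (g ` A)))"
    by (subst nn_integral_density) (auto intro!: nn_integral_cong split: split_indicator)
  also have "\<dots> = (\<integral>\<^sup>+x. ?F (?g x) \<partial>density lborel (\<lambda>x. ennreal (indicator A x * J x)))"
    by (subst eq[symmetric], subst nn_integral_distr) auto
  also have "\<dots> = (\<integral>\<^sup>+x. ennreal (indicator A x * J x) * F (g x) \<partial>lborel)"
    by (subst nn_integral_density, measurable) (auto intro!: nn_integral_cong split: split_indicator)
  finally show ?thesis .
qed

lemma has_bochner_integral_change_of_variables:
  fixes g :: "'a::euclidean_space \<Rightarrow> 'a" and J :: "'a \<Rightarrow> real"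
    and F :: "'a \<Rightarrow> 'b::{banach, second_countable_topology}"
  assumes A: "A \<in> sets borel" and gA: "g ` A \<in> sets borel"
    and cont: "continuous_on A g"
    and J: "(\<lambda>x. indicator A x * J x) \<in> borel_measurable borel" and nn: "\<And>x. x \<in> A \<Longrightarrow> 0 \<le> J x"
    and eq: "distr (density lborel (\<lambda>x. ennreal (indicator A x * J x))) borel (\<lambda>x. if x \<in> A then g x else 0)
    = density lborel (indicator (g ` A))"
    and F: "(\<lambda>y. indicator (g ` A) y *\<^sub>R F y) \<in> borel_measurable borel"
  shows "has_bochner_integral lborel (\<lambda>x. indicator A x *\<^sub>R J x *\<^sub>R F (g x)) I \<longleftrightarrow>
    has_bochner_integral lborel (\<lambda>y. indicator (g ` A) y *\<^sub>R F y) I"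
proof -
  let ?g = "\<lambda>x. if x \<in> A then g x else 0" and ?F = "\<lambda>y. indicator (g ` A) y *\<^sub>R F y"
  have g[measurable]: "?g \<in> borel_measurable borel"
    using A cont by (intro borel_measurable_continuous_on_if) auto
  note A[measurable] gA[measurable] J[measurable] F[measurable]
  have e: "(indicator (g ` A) :: 'a \<Rightarrow> ennreal) = (\<lambda>y. ennreal (indicator (g ` A) y))"
    by (auto simp: indicator_def)
  have ii: "(\<lambda>x. indicator (g ` A) x *\<^sub>R ?F x) = ?F" by (auto simp: fun_eq_iff split: split_indicator)
  have "has_bochner_integral lborel ?F I \<longleftrightarrow> has_bochner_integral (density lborel (indicator (g ` A))) ?F I"
    unfolding has_bochner_integral_iff e
    by (subst integrable_density, simp, simp, simp, subst integral_density, simp, simp, simp)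
       (simp only: ii)
  also have "\<dots> \<longleftrightarrow> has_bochner_integral (density lborel (\<lambda>x. ennreal (indicator A x * J x))) (\<lambda>x. ?F (?g x)) I"
    unfolding has_bochner_integral_iff eq[symmetric]
    by (subst integrable_distr_eq, simp, simp, subst integral_distr) auto
  also have "\<dots> \<longleftrightarrow> has_bochner_integral lborel (\<lambda>x. (indicator A x * J x) *\<^sub>R ?F (?g x)) I"
  proof -
    have 1: "(\<lambda>x. ?F (?g x)) \<in> borel_measurable lborel"
      by (rule measurable_compose[of ?g lborel borel]) auto
    have 2: "(\<lambda>x. indicator A x * J x) \<in> borel_measurable lborel" using J by simp
    have 3: "AE x in lborel. 0 \<le> indicator A x * J x" using nn by (auto split: split_indicator)
    show ?thesis
      unfolding has_bochner_integral_iff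
      by (simp only: integrable_density[OF 1 2 3] integral_density[OF 1 2 3])
  qed
  also have "(\<lambda>x. (indicator A x * J x) *\<^sub>R ?F (?g x)) = (\<lambda>x. indicator A x *\<^sub>R J x *\<^sub>R F (g x))"
    by (auto simp: fun_eq_iff indicator_def)
  finally show ?thesis by simp
qed

section \<open>Charts of a hypersurface and transversal flows\<close>

lemma Ck_on_1D:
  assumes "open S" "Ck_on 1 \<alpha> S"
  shows "\<And>x. x \<in> S \<Longrightarrow> (\<alpha> has_derivative frechet_derivative \<alpha> (at x)) (at x)"
    and "continuous_on S (\<lambda>x. frechet_derivative \<alpha> (at x) h)"
proof -
  have d: "\<alpha> differentiable_on S" and c: "\<And>b. b \<in> Basis \<Longrightarrow> continuous_on S (\<lambda>x. frechet_derivative \<alpha> (at x) b)"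
    using assms(2) by auto
  show der: "(\<alpha> has_derivative frechet_derivative \<alpha> (at x)) (at x)" if "x \<in> S" for x
    using d assms(1) that by (metis differentiable_on_eq_differentiable_at frechet_derivative_works)
  have "(\<Sum>b\<in>Basis. (h \<bullet> b) *\<^sub>R frechet_derivative \<alpha> (at x) b) = frechet_derivative \<alpha> (at x) h" if "x \<in> S" for x
    by (subst (2) euclidean_representation[of h, symmetric])
       (simp only: linear_sum[OF has_derivative_linear[OF der[OF that]]] linear_scale[OF has_derivative_linear[OF der[OF that]]])
  moreover have "continuous_on S (\<lambda>x. \<Sum>b\<in>Basis. (h \<bullet> b) *\<^sub>R frechet_derivative \<alpha> (at x) b)"
    by (intro continuous_intros c)
  ultimately show "continuous_on S (\<lambda>x. frechet_derivative \<alpha> (at x) h)" by (rule continuous_on_eq[rotated])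
qed

abbreviation Dphi :: "(real^3 \<Rightarrow> quat) \<Rightarrow> real^3 \<Rightarrow> real^3 \<Rightarrow> quat" where
  "Dphi \<phi> y \<equiv> frechet_derivative \<phi> (at y)"

lemma chartD:
  assumes "local_parametrization S W \<phi>"
  shows "open W" "inj_on \<phi> W" "continuous_on W \<phi>" "\<phi> ` W \<subseteq> S"
    and "\<And>y. y \<in> W \<Longrightarrow> (\<phi> has_derivative Dphi \<phi> y) (at y)"
    and "\<And>y. y \<in> W \<Longrightarrow> inj (Dphi \<phi> y)"
    and "\<And>v. continuous_on W (\<lambda>y. Dphi \<phi> y v)"
    and "\<And>y. y \<in> W \<Longrightarrow> linear (Dphi \<phi> y)"
    and "continuous_on (\<phi> ` W) (inv_into W \<phi>)"
    and "\<exists>Q. open Q \<and> \<phi> ` W = S \<inter> Q"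
proof -
  show oW: "open W" using assms by (simp add: local_parametrization_def)
  have C1: "Ck_on 1 \<phi> W" using assms unfolding local_parametrization_def by blast
  show der: "(\<phi> has_derivative Dphi \<phi> y) (at y)" if "y \<in> W" for y by (rule Ck_on_1D(1)[OF oW C1 that])
  show "linear (Dphi \<phi> y)" if "y \<in> W" for y by (rule has_derivative_linear[OF der[OF that]])
  show "continuous_on W (\<lambda>y. Dphi \<phi> y v)" for v by (rule Ck_on_1D(2)[OF oW C1])
  show "inj (Dphi \<phi> y)" if "y \<in> W" for y using assms that by (simp add: local_parametrization_def)
  obtain \<psi> where h: "homeomorphism W (\<phi> ` W) \<phi> \<psi>" using assms unfolding local_parametrization_def by blast
  show i: "inj_on \<phi> W" by (metis h homeomorphism_apply1 inj_onI)
  show "continuous_on W \<phi>" using h homeomorphism_def by blast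
  show "continuous_on (\<phi> ` W) (inv_into W \<phi>)"
    by (rule continuous_on_eq[of _ \<psi>]) (use h i in \<open>auto simp: homeomorphism_def\<close>)
  show "\<exists>Q. open Q \<and> \<phi> ` W = S \<inter> Q" using assms unfolding local_parametrization_def openin_open by blast
  then show "\<phi> ` W \<subseteq> S" by blast
qed

definition unit_normal :: "(real^3 \<Rightarrow> quat) \<Rightarrow> real^3 \<Rightarrow> quat \<Rightarrow> bool" where
  "unit_normal \<phi> y n \<longleftrightarrow> norm n = 1 \<and> (\<forall>v. n \<bullet> Dphi \<phi> y v = 0)"

definition flow :: "(real^3 \<Rightarrow> quat) \<Rightarrow> quat \<Rightarrow> quat \<Rightarrow> quat" where
  "flow \<phi> v x = \<phi> (snd x) + fst x *\<^sub>R v"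

definition flowd :: "(real^3 \<Rightarrow> quat) \<Rightarrow> quat \<Rightarrow> quat \<Rightarrow> quat \<Rightarrow> quat" where
  "flowd \<phi> v x h = Dphi \<phi> (snd x) (snd h) + fst h *\<^sub>R v"

text \<open>The tangent space has dimension at most 3 in a space of dimension 4, so some nonzero
  vector is orthogonal to it.\<close>

lemma unit_normal_exists:
  assumes "linear (Dphi \<phi> y)"
  shows "\<exists>n. unit_normal \<phi> y n"
proof -
  have "dim (range (Dphi \<phi> y)) \<le> dim (UNIV::(real^3) set)"
    using assms dim_image_le by blast
  then have "dim (range (Dphi \<phi> y)) < DIM(quat)" by (simp add: dim_UNIV)
  then obtain x where x: "x \<noteq> 0" "\<And>z. z \<in> span (range (Dphi \<phi> y)) \<Longrightarrow> orthogonal x z"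
    using orthogonal_to_subspace_exists by blast
  then have "x \<bullet> Dphi \<phi> y v = 0" for v using span_base[of "Dphi \<phi> y v" "range (Dphi \<phi> y)"]
    by (auto simp: orthogonal_def)
  then show ?thesis using x(1) by (intro exI[of _ "x /\<^sub>R norm x"]) (auto simp: unit_normal_def)
qed

abbreviation gram :: "(real^3 \<Rightarrow> quat) \<Rightarrow> real^3 \<Rightarrow> real^3^3" where
  "gram \<phi> y \<equiv> (\<chi> i j. Dphi \<phi> y (axis i 1) \<bullet> Dphi \<phi> y (axis j 1))"

lemma linear_axis_sum:
  fixes T :: "real^'n::finite \<Rightarrow> 'a::real_vector"
  assumes "linear T" shows "T c = (\<Sum>i\<in>UNIV. c$i *\<^sub>R T (axis i 1))"
proof -
  have "c = (\<Sum>i\<in>UNIV. c$i *\<^sub>R axis i 1)" by (simp add: basis_expansion scalar_mult_eq_scaleR[symmetric])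
  then have "T c = T (\<Sum>i\<in>UNIV. c$i *\<^sub>R axis i 1)" by simp
  then show ?thesis by (simp only: linear_sum[OF assms] linear_scale[OF assms])
qed

text \<open>A vector \<open>c\<close> killed by the Gram matrix has a tangent image orthogonal to
  all tangent vectors, in particular to itself; by injectivity \<open>c\<close> is 0.\<close>

lemma det_gram_nonzero:
  assumes "linear (Dphi \<phi> y)" "inj (Dphi \<phi> y)"
  shows "det (gram \<phi> y) \<noteq> 0"
proof
  assume "det (gram \<phi> y) = 0"
  then have "\<not> invertible (gram \<phi> y)" by (simp add: invertible_det_nz)
  then obtain c where c: "c \<noteq> 0" "gram \<phi> y *v c = 0"
    by (metis matrix_left_invertible_ker invertible_left_inverse)
  have "Dphi \<phi> y (axis i 1) \<bullet> Dphi \<phi> y c = 0" for i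
  proof -
    have "(gram \<phi> y *v c) $ i = 0" using c by simp
    then show ?thesis
      by (subst linear_axis_sum[OF assms(1)])
         (simp add: matrix_vector_mult_def inner_sum_right mult.commute)
  qed
  then have "Dphi \<phi> y c \<bullet> Dphi \<phi> y c = 0"
    by (subst (1) linear_axis_sum[OF assms(1)]) (simp add: inner_sum_left)
  then have "Dphi \<phi> y c = 0" by simp
  then show False using assms c by (metis linear_injective_0)
qed

abbreviation flow_matrix where "flow_matrix \<phi> v x \<equiv> (\<chi> i j. flowd \<phi> v x (qunit j) \<bullet> qunit i :: real^(3 option)^(3 option))"

lemma inner_quat: "a \<bullet> b = (\<Sum>k\<in>UNIV. (a \<bullet> qunit k) * (b \<bullet> qunit k))"
  unfolding sum_option_3 inner_qunit by (simp add: inner_prod_def inner_vec_def)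

text \<open>Multiply the transpose of the flow matrix for \<open>n\<close> by the flow matrix for
  \<open>v\<close>. The entries are inner products of columns, and the row \<open>None\<close> is
  \<open>n \<bullet> v\<close> followed by zeros, so the determinant of the product is
  \<open>n \<bullet> v\<close> times the Gram determinant. Taking \<open>v = n\<close> identifies
  the Gram determinant with the square of the determinant for \<open>n\<close>, and one factor
  cancels.\<close>

lemma det_flow:
  assumes lin: "linear (Dphi \<phi> (snd x))" and n: "unit_normal \<phi> (snd x) n"
  shows "0 \<le> det (gram \<phi> (snd x))"
    and "inj (Dphi \<phi> (snd x)) \<Longrightarrow> 0 < area_element \<phi> (snd x)"
    and "inj (Dphi \<phi> (snd x)) \<Longrightarrow> \<bar>det (flow_matrix \<phi> v x)\<bar> = \<bar>n \<bullet> v\<bar> * area_element \<phi> (snd x)"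
proof -
  let ?y = "snd x"
  have l0: "Dphi \<phi> ?y 0 = 0" using linear_0[OF lin] .
  have fd: "flowd \<phi> v x (qunit None) = v" "flowd \<phi> v x (qunit (Some i)) = Dphi \<phi> ?y (axis i 1)" for v i
    by (simp_all add: flowd_def qunit_simps l0)
  have ent: "(transpose (flow_matrix \<phi> n x) ** flow_matrix \<phi> v x) $ i $ j
     = flowd \<phi> n x (qunit i) \<bullet> flowd \<phi> v x (qunit j)" for i j v
    by (subst inner_quat) (simp add: matrix_matrix_mult_def transpose_def)
  have nz: "n \<bullet> Dphi \<phi> ?y w = 0" for w using n by (simp add: unit_normal_def)
  have eq: "det (flow_matrix \<phi> n x) * det (flow_matrix \<phi> v x) = (n \<bullet> v) * det (gram \<phi> ?y)" for v
  proof -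
    have "det (flow_matrix \<phi> n x) * det (flow_matrix \<phi> v x)
       = det (transpose (flow_matrix \<phi> n x) ** flow_matrix \<phi> v x)" by (simp add: det_mul det_transpose)
    also have "\<dots> = (n \<bullet> v) * det (gram \<phi> ?y)"
      by (subst det_block_option) (simp_all only: ent fd nz)
    finally show ?thesis .
  qed
  have nn: "n \<bullet> n = 1" using n by (simp add: unit_normal_def norm_eq_1)
  have sq: "det (flow_matrix \<phi> n x) ^ 2 = det (gram \<phi> ?y)" using eq[of n] nn by (simp add: power2_eq_square)
  show g0: "0 \<le> det (gram \<phi> ?y)" by (metis sq zero_le_power2)
  have ae: "area_element \<phi> ?y = \<bar>det (flow_matrix \<phi> n x)\<bar>"
    unfolding area_element_def by (simp add: sq[symmetric])
  assume inj: "inj (Dphi \<phi> (snd x))"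
  have "det (gram \<phi> ?y) \<noteq> 0" using det_gram_nonzero[OF lin inj] .
  then have pos: "det (flow_matrix \<phi> n x) \<noteq> 0" using sq by auto
  then show "0 < area_element \<phi> ?y" by (simp add: ae)
  have "\<bar>det (flow_matrix \<phi> n x)\<bar> * \<bar>det (flow_matrix \<phi> v x)\<bar> = \<bar>n \<bullet> v\<bar> * \<bar>det (flow_matrix \<phi> n x)\<bar> * \<bar>det (flow_matrix \<phi> n x)\<bar>"
  proof -
    have "det (flow_matrix \<phi> n x) * det (flow_matrix \<phi> v x) = (n \<bullet> v) * det (flow_matrix \<phi> n x) * det (flow_matrix \<phi> n x)"
      unfolding eq[of v] sq[symmetric] power2_eq_square by (simp only: mult.assoc)
    from arg_cong[OF this, of abs] show ?thesis by (simp only: abs_mult)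
  qed
  then show "\<bar>det (flow_matrix \<phi> v x)\<bar> = \<bar>n \<bullet> v\<bar> * area_element \<phi> ?y"
    using pos by (simp add: ae)
qed

lemma flow_has_derivative:
  assumes "local_parametrization S W \<phi>" "snd x \<in> W"
  shows "(flow \<phi> v has_derivative flowd \<phi> v x) (at x)"
proof -
  have 1: "(\<phi> has_derivative Dphi \<phi> (snd x)) (at (snd x))" using chartD(5)[OF assms] .
  have "((\<lambda>x. \<phi> (snd x)) has_derivative (\<lambda>h. Dphi \<phi> (snd x) (snd h))) (at x)"
    by (rule has_derivative_compose[where f=snd, OF _ 1]) (auto intro!: derivative_eq_intros)
  then show ?thesis unfolding flow_def[abs_def] flowd_def[abs_def]
    by (auto intro!: derivative_eq_intros)
qed

lemma open_zero_slice:
  fixes U :: "quat set"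
  assumes "open U" shows "open {z. (0,z) \<in> U}"
proof -
  have "open ((\<lambda>z. (0::real,z)) -` U)" by (rule open_vimage[OF assms]) (auto intro!: continuous_intros)
  then show ?thesis by (simp add: vimage_def)
qed

text \<open>Inverse function theorem at \<open>(0, y0)\<close>: by \<open>det_flow\<close> the
  Jacobian there is \<open>\<bar>n \<bullet> v\<bar>\<close> times a positive area element. The
  inverse lives on an open set of \<open>quat\<close> and not only on the surface, which is what
  later yields derivatives of surface coordinates.\<close>

lemma flow_chart:
  assumes lp: "local_parametrization S W \<phi>" and y0: "y0 \<in> W" and n: "unit_normal \<phi> y0 n" and nv: "n \<bullet> v \<noteq> 0"
  obtains U' V' g g' where "open U'" "U' \<subseteq> UNIV \<times> W" "(0,y0) \<in> U'" "open V'"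
    "homeomorphism U' V' (flow \<phi> v) g"
    "\<And>q. q \<in> V' \<Longrightarrow> (g has_derivative g' q) (at q)"
    "\<And>q. q \<in> V' \<Longrightarrow> g' q = inv (flowd \<phi> v (g q))"
    "\<And>q. q \<in> V' \<Longrightarrow> bij (flowd \<phi> v (g q))"
proof -
  note D = chartD[OF lp]
  let ?U = "UNIV \<times> W :: quat set"
  have oU: "open ?U" using D(1) by (simp add: open_Times)
  have bl: "bounded_linear (flowd \<phi> v x)" if "x \<in> ?U" for x
    using flow_has_derivative[OF lp, of x v] that has_derivative_bounded_linear by auto
  \<comment> \<open>The inverse function theorem asks for continuity of the derivative in operator
    norm; in finite dimension this is continuity in each basis direction.\<close>
  let ?f' = "\<lambda>x. Blinfun (flowd \<phi> v x)"
  have ap: "blinfun_apply (?f' x) = flowd \<phi> v x" if "x \<in> ?U" for x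
    using bl[OF that] by (rule bounded_linear_Blinfun_apply)
  have cont: "continuous_on ?U ?f'"
  proof (rule continuous_on_blinfun_componentwise)
    fix i :: quat assume "i \<in> Basis"
    have "continuous_on ?U (\<lambda>x. flowd \<phi> v x i)"
      unfolding flowd_def
      by (intro continuous_intros continuous_on_compose2[OF D(7)[of "snd i"]]) auto
    then show "continuous_on ?U (\<lambda>x. blinfun_apply (?f' x) i)"
      by (subst continuous_on_cong[OF refl]) (use ap in auto)
  qed
  let ?x0 = "(0,y0)"
  have x0: "?x0 \<in> ?U" using y0 by simp
  have "\<bar>det (flow_matrix \<phi> v ?x0)\<bar> = \<bar>n \<bullet> v\<bar> * area_element \<phi> y0" "0 < area_element \<phi> y0"
    using det_flow(2,3)[of \<phi> ?x0 n] D(6,8) y0 n by auto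
  then have dnz: "det (flow_matrix \<phi> v ?x0) \<noteq> 0" using nv by auto
  have lin: "linear (flowd \<phi> v ?x0)" using bl[OF x0] by (simp add: bounded_linear.linear)
  let ?T = "qvec \<circ> flowd \<phi> v ?x0 \<circ> vecq"
  have linT: "linear ?T" using linear_compose[OF linear_vecq linear_compose[OF lin linear_qvec]]
    by (simp add: comp_assoc)
  have "matrix ?T = flow_matrix \<phi> v ?x0" by (simp add: matrix_def vec_eq_iff vecq_axis qvec_def)
  then have "inj ?T" using det_nz_iff_inj[OF linT] dnz by simp
  then have inj: "inj (flowd \<phi> v ?x0)"
    by (intro injI) (metis (no_types, lifting) comp_apply injD vecq_qvec qvec_vecq)
  then obtain L where L: "linear L" "L \<circ> flowd \<phi> v ?x0 = id"
    using linear_injective_left_inverse[OF lin] by blast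
  have Lb: "bounded_linear L" using L(1) by (simp add: linear_conv_bounded_linear)
  have inv: "Blinfun L o\<^sub>L ?f' ?x0 = id_blinfun"
  proof (rule blinfun_eqI)
    fix i
    show "blinfun_apply (Blinfun L o\<^sub>L ?f' ?x0) i = blinfun_apply id_blinfun i"
      using fun_cong[OF L(2), of i] by (simp add: bounded_linear_Blinfun_apply[OF Lb] ap[OF x0])
  qed
  have der: "(flow \<phi> v has_derivative blinfun_apply (?f' x)) (at x)" if "x \<in> ?U" for x
    using flow_has_derivative[OF lp, of x v] that ap[OF that] by auto
  obtain U' V' g g' where *: "open U'" "U' \<subseteq> ?U" "?x0 \<in> U'" "open V'" "flow \<phi> v ?x0 \<in> V'"
    "homeomorphism U' V' (flow \<phi> v) g"
    "\<And>y. y \<in> V' \<Longrightarrow> (g has_derivative (g' y)) (at y)"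
    "\<And>y. y \<in> V' \<Longrightarrow> g' y = inv (blinfun_apply (?f' (g y)))"
    "\<And>y. y \<in> V' \<Longrightarrow> bij (blinfun_apply (?f' (g y)))"
    using inverse_function_theorem[OF oU der cont x0 inv] by metis
  have gU: "g q \<in> ?U" if "q \<in> V'" for q using *(6,2) that by (auto simp: homeomorphism_def)
  show ?thesis
    by (rule that[OF *(1,2,3,4,6,7)]) (use *(8,9) ap gU in auto)
qed

section \<open>Change of charts\<close>

text \<open>The inverse of \<open>\<phi>2\<close> is only known to be continuous, and only on the
  surface. The flow of \<open>\<phi>2\<close> along its own normal extends it: the inverse
  \<open>g\<close> of that flow is differentiable on an open set of \<open>quat\<close>, and
  \<open>\<tau> = snd \<circ> g \<circ> \<phi>1\<close> near \<open>y1\<close>.\<close>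

lemma transition_map:
  assumes lp1: "local_parametrization S W1 \<phi>1" and lp2: "local_parametrization S W2 \<phi>2"
    and y1: "y1 \<in> W1" "\<phi>1 y1 \<in> \<phi>2 ` W2"
  defines "\<tau> \<equiv> \<lambda>y. inv_into W2 \<phi>2 (\<phi>1 y)"
  shows "\<exists>\<tau>'. (\<tau> has_derivative \<tau>') (at y1) \<and> (\<forall>v. Dphi \<phi>1 y1 v = Dphi \<phi>2 (\<tau> y1) (\<tau>' v))"
proof -
  note D1 = chartD[OF lp1] and D2 = chartD[OF lp2]
  obtain Q where Q: "open Q" "\<phi>2 ` W2 = S \<inter> Q" using D2(10) by (elim exE conjE)
  let ?O1 = "{y\<in>W1. \<phi>1 y \<in> Q}"
  have O1: "?O1 = {y\<in>W1. \<phi>1 y \<in> \<phi>2 ` W2}" 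
    unfolding Q(2) using D1(4) by blast
  have oO1: "open ?O1"
  proof -
    have "?O1 = W1 \<inter> \<phi>1 -` Q" by auto
    then show ?thesis using continuous_open_preimage[OF D1(3,1) Q(1)] by simp
  qed
  have ctau: "continuous_on ?O1 \<tau>"
    unfolding \<tau>_def O1
    by (rule continuous_on_compose2[OF D2(9)]) (auto intro: continuous_on_subset[OF D1(3)])
  have tau: "\<tau> y \<in> W2" "\<phi>2 (\<tau> y) = \<phi>1 y" if "y \<in> ?O1" for y
    using that unfolding O1 \<tau>_def by (auto simp: inv_into_into f_inv_into_f)
  have y1O: "y1 \<in> ?O1" unfolding O1 using y1 by simp
  let ?y2 = "\<tau> y1"
  have y2: "?y2 \<in> W2" using tau y1O by blast
  obtain n where n: "unit_normal \<phi>2 ?y2 n" using unit_normal_exists D2(8)[OF y2] by blast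
  have nn: "n \<bullet> n \<noteq> 0" using n by (auto simp: unit_normal_def)
  obtain U' V' g g' where *: "open U'" "U' \<subseteq> UNIV \<times> W2" "(0,?y2) \<in> U'" "open V'"
    "homeomorphism U' V' (flow \<phi>2 n) g"
    "\<And>q. q \<in> V' \<Longrightarrow> (g has_derivative g' q) (at q)"
    "\<And>q. q \<in> V' \<Longrightarrow> g' q = inv (flowd \<phi>2 n (g q))"
    "\<And>q. q \<in> V' \<Longrightarrow> bij (flowd \<phi>2 n (g q))"
    by (rule flow_chart[OF lp2 y2 n nn]; rule that; assumption)
  have oP: "open {z. (0,z) \<in> U'}" by (rule open_zero_slice[OF *(1)])
  \<comment> \<open>Continuity of \<open>\<tau>\<close> gives an open set of parameters on which
    \<open>(0, \<tau> y)\<close> stays in the domain of the local inverse, so that \<open>g\<close>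
    really returns \<open>\<tau> y\<close>.\<close>
  let ?O = "?O1 \<inter> \<tau> -` {z. (0,z) \<in> U'}"
  have oO: "open ?O" by (rule continuous_open_preimage[OF ctau oO1 oP])
  have yO: "y1 \<in> ?O" using y1O *(3) by simp
  have fl: "flow \<phi>2 n (0, z) = \<phi>2 z" for z by (simp add: flow_def)
  have eq: "g (\<phi>1 y) = (0, \<tau> y)" "\<phi>1 y \<in> V'" if "y \<in> ?O" for y
    using that *(5) tau[of y] fl[of "\<tau> y"] by (force simp: homeomorphism_def)+
  let ?tau' = "\<lambda>h. snd (g' (\<phi>1 y1) (Dphi \<phi>1 y1 h))"
  have 1: "(\<phi>1 has_derivative Dphi \<phi>1 y1) (at y1)" using D1(5) y1 by blast
  have 2: "(g has_derivative g' (\<phi>1 y1)) (at (\<phi>1 y1))" using *(6) eq[OF yO] by blast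
  have "((\<lambda>y. snd (g (\<phi>1 y))) has_derivative ?tau') (at y1)"
    by (rule has_derivative_snd, rule has_derivative_compose[OF 1 2])
  then have der: "(\<tau> has_derivative ?tau') (at y1)"
    by (rule has_derivative_transform_within_open[OF _ oO yO]) (simp add: eq)
  have 3: "(\<phi>2 has_derivative Dphi \<phi>2 ?y2) (at (\<tau> y1))" using D2(5) y2 by blast
  \<comment> \<open>Differentiating the identity \<open>\<phi>2 (\<tau> y) = \<phi>1 y\<close>
    yields the relation between the tangent maps.\<close>
  have "((\<lambda>y. \<phi>2 (\<tau> y)) has_derivative (\<lambda>h. Dphi \<phi>2 ?y2 (?tau' h))) (at y1)"
    by (rule has_derivative_compose[OF der 3])
  then have "(\<phi>1 has_derivative (\<lambda>h. Dphi \<phi>2 ?y2 (?tau' h))) (at y1)"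
    by (rule has_derivative_transform_within_open[OF _ oO yO]) (use tau in auto)
  then have "Dphi \<phi>1 y1 = (\<lambda>h. Dphi \<phi>2 ?y2 (?tau' h))" using 1 has_derivative_unique by blast
  then show ?thesis using der by metis
qed

text \<open>The Gram matrix changes by congruence with \<open>matrix T\<close>; its determinant
  picks up the square of \<open>det (matrix T)\<close>, and the root in the area element removes the
  square.\<close>

lemma area_element_transition:
  assumes lin2: "linear (Dphi \<phi>2 y2)" and linT: "linear T"
    and eq: "\<And>v. Dphi \<phi>1 y1 v = Dphi \<phi>2 y2 (T v)"
  shows "area_element \<phi>1 y1 = \<bar>det (matrix T)\<bar> * area_element \<phi>2 y2"
proof -
  have T: "Dphi \<phi>2 y2 (T (axis i 1)) = (\<Sum>k\<in>UNIV. matrix T $ k $ i *\<^sub>R Dphi \<phi>2 y2 (axis k 1))" for i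
    by (subst linear_axis_sum[OF lin2]) (simp add: matrix_def)
  have "gram \<phi>1 y1 = transpose (matrix T) ** gram \<phi>2 y2 ** matrix T"
    unfolding vec_eq_iff
    by (simp add: eq T matrix_matrix_mult_def transpose_def inner_sum_left inner_sum_right sum_distrib_left sum_distrib_right mult_ac)
  then have "det (gram \<phi>1 y1) = (det (matrix T))\<^sup>2 * det (gram \<phi>2 y2)"
    by (simp add: det_mul det_transpose power2_eq_square)
  then show ?thesis by (simp add: area_element_def real_sqrt_mult)
qed

lemma continuous_on_area_element:
  assumes "local_parametrization S W \<phi>" shows "continuous_on W (area_element \<phi>)"
proof -
  have "continuous_on W (\<lambda>y. sqrt (det (gram \<phi> y)))"
    unfolding det_3 by (auto intro!: continuous_intros chartD(7)[OF assms])
  then show ?thesis unfolding area_element_def[abs_def] .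
qed

lemma area_element_pos: "local_parametrization S W \<phi> \<Longrightarrow> y \<in> W \<Longrightarrow> 0 < area_element \<phi> y"
  using unit_normal_exists[of \<phi> y] det_flow(2)[of \<phi> "(0,y)"] chartD(6,8)[of S W \<phi> y] by auto

abbreviation area_integral :: "(real^3) set \<Rightarrow> (real^3 \<Rightarrow> quat) \<Rightarrow> quat set \<Rightarrow> ennreal" where
  "area_integral W \<phi> A \<equiv> (\<integral>\<^sup>+y\<in>{y\<in>W. \<phi> y \<in> A}. ennreal (area_element \<phi> y) \<partial>lborel)"

text \<open>Substitution by the chart change, whose Jacobian is exactly the ratio of the two area
  elements.\<close>

lemma area_integral_chart_independent:
  assumes lp1: "local_parametrization S W1 \<phi>1" and lp2: "local_parametrization S W2 \<phi>2"
    and A: "A \<in> sets borel" "A \<subseteq> \<phi>1 ` W1" "A \<subseteq> \<phi>2 ` W2"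
  shows "area_integral W1 \<phi>1 A
       = area_integral W2 \<phi>2 A"
proof -
  note D1 = chartD[OF lp1] and D2 = chartD[OF lp2]
  let ?A1 = "{y\<in>W1. \<phi>1 y \<in> A}" and ?A2 = "{y\<in>W2. \<phi>2 y \<in> A}"
  define \<tau> where "\<tau> = (\<lambda>y. inv_into W2 \<phi>2 (\<phi>1 y))"
  have pre: "{y\<in>W. \<phi> y \<in> A} \<in> sets borel" if "open W" "continuous_on W \<phi>" for W and \<phi> :: "real^3 \<Rightarrow> quat"
  proof -
    have "(\<lambda>y. if y \<in> W then \<phi> y else 0) \<in> borel_measurable borel"
      using that by (intro borel_measurable_continuous_on_if) auto
    from measurable_sets[OF this A(1)]
    have "W \<inter> ((\<lambda>y. if y \<in> W then \<phi> y else 0) -` A) \<in> sets borel" using that by auto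
    moreover have "W \<inter> ((\<lambda>y. if y \<in> W then \<phi> y else 0) -` A) = {y\<in>W. \<phi> y \<in> A}" by auto
    ultimately show ?thesis by simp
  qed
  have A1[measurable]: "?A1 \<in> sets borel" and A2[measurable]: "?A2 \<in> sets borel" using pre D1(1,3) D2(1,3) by auto
  have tau: "\<tau> y \<in> W2" "\<phi>2 (\<tau> y) = \<phi>1 y" if "y \<in> ?A1" for y
  proof -
    have "\<phi>1 y \<in> \<phi>2 ` W2" using that A(3) by blast
    then show "\<tau> y \<in> W2" "\<phi>2 (\<tau> y) = \<phi>1 y" by (simp_all add: \<tau>_def inv_into_into f_inv_into_f)
  qed
  have img: "\<tau> ` ?A1 = ?A2"
  proof (intro set_eqI iffI)
    fix z assume z: "z \<in> ?A2"
    then obtain y where y: "y \<in> W1" "\<phi>1 y = \<phi>2 z" using A(2) by (metis (mono_tags, lifting) imageE mem_Collect_eq subsetD)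
    then have "\<tau> y = z" using z D2(2) by (simp add: \<tau>_def)
    then show "z \<in> \<tau> ` ?A1" using y z by force
  qed (use tau in auto)
  have "\<forall>y. \<exists>T. y \<in> ?A1 \<longrightarrow> (\<tau> has_derivative T) (at y) \<and> (\<forall>v. Dphi \<phi>1 y v = Dphi \<phi>2 (\<tau> y) (T v))"
    using transition_map[OF lp1 lp2] A(3) unfolding \<tau>_def by blast
  from choice[OF this] obtain T where
    T0: "\<forall>y. y \<in> ?A1 \<longrightarrow> (\<tau> has_derivative T y) (at y) \<and> (\<forall>v. Dphi \<phi>1 y v = Dphi \<phi>2 (\<tau> y) (T y v))"
    by (elim exE)
  have T: "(\<tau> has_derivative T y) (at y)" "Dphi \<phi>1 y v = Dphi \<phi>2 (\<tau> y) (T y v)" if "y \<in> ?A1" for y v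
    using T0 that by blast+
  have ar: "area_element \<phi>1 y = \<bar>det (matrix (T y))\<bar> * area_element \<phi>2 (\<tau> y)" if "y \<in> ?A1" for y
    using area_element_transition[OF D2(8) has_derivative_linear[OF T(1)[OF that]]] T(2)[OF that] tau(1)[OF that] by blast
  have pos2: "0 < area_element \<phi>2 (\<tau> y)" if "y \<in> ?A1" for y using area_element_pos[OF lp2 tau(1)[OF that]] .
  have ct: "continuous_on ?A1 \<tau>"
    using T(1) by (intro continuous_at_imp_continuous_on) (auto intro: has_derivative_continuous)
  have inj: "inj_on \<tau> ?A1"
    by (rule inj_onI) (metis (mono_tags, lifting) tau(2) D1(2) inj_onD mem_Collect_eq)
  \<comment> \<open>The derivatives \<open>T y\<close> are chosen pointwise and carry no continuity.
    On \<open>?A1\<close> the modulus of their determinant equals this quotient of area elements,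
    which is continuous; this makes the Jacobian measurable.\<close>
  have cJ: "continuous_on ?A1 (\<lambda>y. area_element \<phi>1 y / area_element \<phi>2 (\<tau> y))"
  proof (intro continuous_intros continuous_on_subset[OF continuous_on_area_element[OF lp1]]
       continuous_on_compose2[OF continuous_on_area_element[OF lp2] ct])
    show "\<tau> ` ?A1 \<subseteq> W2" using tau(1) by blast
    show "\<forall>y\<in>?A1. area_element \<phi>2 (\<tau> y) \<noteq> 0" using pos2 by force
  qed auto
  have Jm: "(\<lambda>y. indicator ?A1 y * \<bar>det (matrix (T y))\<bar>) \<in> borel_measurable borel"
  proof -
    have "(\<lambda>y. if y \<in> ?A1 then area_element \<phi>1 y / area_element \<phi>2 (\<tau> y) else 0) \<in> borel_measurable borel"
      using cJ by (intro borel_measurable_continuous_on_if) auto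
    also have "(\<lambda>y. if y \<in> ?A1 then area_element \<phi>1 y / area_element \<phi>2 (\<tau> y) else 0)
       = (\<lambda>y. indicator ?A1 y * \<bar>det (matrix (T y))\<bar>)"
    proof
      fix y show "(if y \<in> ?A1 then area_element \<phi>1 y / area_element \<phi>2 (\<tau> y) else 0)
        = indicator ?A1 y * \<bar>det (matrix (T y))\<bar>"
        using ar[of y] pos2[of y] by (cases "y \<in> ?A1") auto
    qed
    finally show ?thesis .
  qed
  have gA: "\<tau> ` ?A1 \<in> sets borel" using img A2 by simp
  have dist: "distr (density lborel (\<lambda>x. ennreal (indicator ?A1 x * \<bar>det (matrix (T x))\<bar>))) borel (\<lambda>x. if x \<in> ?A1 then \<tau> x else 0)
    = density lborel (indicator (\<tau> ` ?A1))"
  proof (rule distr_change_of_variables[OF A1 gA ct inj Jm])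
    fix B assume B: "B \<in> sets borel" "B \<subseteq> ?A1" "\<tau> ` B \<in> sets borel"
      "(\<lambda>x. indicator B x * \<bar>det (matrix (T x))\<bar>) \<in> borel_measurable borel"
    have "(\<tau> has_derivative T x) (at x within B)" if "x \<in> B" for x
      by (rule has_derivative_at_withinI[OF T(1)]) (use that B(2) in blast)
    from emeasure_image_eq_nn_integral[OF B(1) this inj_on_subset[OF inj B(2)] B(4)]
    show "emeasure lborel (\<tau> ` B) = (\<integral>\<^sup>+x. ennreal (indicator B x * \<bar>det (matrix (T x))\<bar>) \<partial>lborel)"
      using B(3) by simp
  qed
  have Fm: "(\<lambda>z. indicator (\<tau> ` ?A1) z * ennreal (area_element \<phi>2 z)) \<in> borel_measurable borel"
  proof -
    have [measurable]: "(\<lambda>y. if y \<in> W2 then area_element \<phi>2 y else 0) \<in> borel_measurable borel"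
      using continuous_on_area_element[OF lp2] D2(1) by (intro borel_measurable_continuous_on_if) auto
    have "(\<lambda>z. indicator ?A2 z * ennreal (if z \<in> W2 then area_element \<phi>2 z else 0)) \<in> borel_measurable borel"
      by measurable
    also have "(\<lambda>z. indicator ?A2 z * ennreal (if z \<in> W2 then area_element \<phi>2 z else 0))
       = (\<lambda>z. indicator (\<tau> ` ?A1) z * ennreal (area_element \<phi>2 z))"
      unfolding img by (auto simp: fun_eq_iff split: split_indicator)
    finally show ?thesis .
  qed
  from nn_integral_change_of_variables[OF A1 gA ct Jm dist Fm]
  have "(\<integral>\<^sup>+y. indicator ?A2 y * ennreal (area_element \<phi>2 y) \<partial>lborel) =
     (\<integral>\<^sup>+x. ennreal (indicator ?A1 x * \<bar>det (matrix (T x))\<bar>) * ennreal (area_element \<phi>2 (\<tau> x)) \<partial>lborel)"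
    unfolding img .
  also have "\<dots> = (\<integral>\<^sup>+y. ennreal (area_element \<phi>1 y) * indicator ?A1 y \<partial>lborel)"
    using pos2 by (intro nn_integral_cong) (auto simp: ar ennreal_mult'[symmetric] less_imp_le split: split_indicator)
  finally show ?thesis by (simp add: mult.commute)
qed

section \<open>Surface measure\<close>

text \<open>The area carried by one chart, as a measure on all of \<open>quat\<close>. In this form
  pieces from different charts can be added, and the sum inherits additivity.\<close>

definition chart_measure :: "(real^3) set \<Rightarrow> (real^3 \<Rightarrow> quat) \<Rightarrow> quat measure" where
  "chart_measure W \<phi> = distr (density (restrict_space lborel W) (\<lambda>y. ennreal (area_element \<phi> y))) borel \<phi>"

lemma sets_chart_measure [simp, measurable_cong]: "sets (chart_measure W \<phi>) = sets borel"
  by (simp add: chart_measure_def)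

lemma chart_measurable:
  assumes lp: "local_parametrization S W \<phi>"
  shows "\<phi> \<in> borel_measurable (restrict_space lborel W)"
    and "area_element \<phi> \<in> borel_measurable (restrict_space lborel W)"
    and "W \<in> sets borel"
proof -
  have *: "sets (restrict_space lborel W) = sets (restrict_space (borel::(real^3) measure) W)"
    by (rule sets_restrict_space_cong) simp
  show "\<phi> \<in> borel_measurable (restrict_space lborel W)"
    "area_element \<phi> \<in> borel_measurable (restrict_space lborel W)"
    unfolding measurable_cong_sets[OF * refl]
    using chartD(3)[OF lp] continuous_on_area_element[OF lp]
    by (auto intro: borel_measurable_continuous_on_restrict)
  show "W \<in> sets borel" using chartD(1)[OF lp] by simp
qed

lemma emeasure_chart_measure:
  assumes lp: "local_parametrization S W \<phi>" and A: "A \<in> sets borel"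
  shows "emeasure (chart_measure W \<phi>) A = area_integral W \<phi> A"
proof -
  note m[measurable] = chart_measurable[OF lp]
  let ?M = "restrict_space lborel W"
  have sp: "space ?M = W" by (simp add: space_restrict_space)
  have "emeasure (chart_measure W \<phi>) A = emeasure (density ?M (\<lambda>y. ennreal (area_element \<phi> y))) (\<phi> -` A \<inter> W)"
    unfolding chart_measure_def using A by (subst emeasure_distr) (auto simp: sp)
  also have "\<dots> = (\<integral>\<^sup>+y. ennreal (area_element \<phi> y) * indicator (\<phi> -` A \<inter> W) y \<partial>?M)"
    using measurable_sets[OF m(1) A] by (subst emeasure_density) (auto simp: sp)
  also have "\<dots> = (\<integral>\<^sup>+y. ennreal (area_element \<phi> y) * indicator (\<phi> -` A \<inter> W) y * indicator W y \<partial>lborel)"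
    by (subst nn_integral_restrict_space) auto
  also have "\<dots> = area_integral W \<phi> A"
    by (intro nn_integral_cong) (auto split: split_indicator)
  finally show ?thesis .
qed

text \<open>The predicate under the definite description in \<open>surface_measure\<close>.\<close>

definition surface_measure_spec :: "quat set \<Rightarrow> quat measure \<Rightarrow> bool" where
  "surface_measure_spec S \<sigma> \<longleftrightarrow> sets \<sigma> = sets (restrict_space borel S) \<and>
     (\<forall>W \<phi> A. local_parametrization S W \<phi> \<and> A \<in> sets borel \<and> A \<subseteq> \<phi> ` W \<longrightarrow>
        emeasure \<sigma> A = area_integral W \<phi> A)"

lemma smooth_surface_finite_atlas:
  assumes "compact S" "smooth_surface S"
  shows "\<exists>(m::nat) W \<phi>. (\<forall>i<m. local_parametrization S (W i) (\<phi> i)) \<and> S = (\<Union>i<m. \<phi> i ` W i)"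
proof -
  have "\<forall>p\<in>S. \<exists>x. local_parametrization S (fst x) (snd x) \<and> p \<in> snd x ` fst x"
  proof
    fix p assume "p \<in> S"
    then obtain W \<phi> where "local_parametrization S W \<phi>" "p \<in> \<phi> ` W"
      using assms(2) unfolding smooth_surface_def by blast
    then show "\<exists>x. local_parametrization S (fst x) (snd x) \<and> p \<in> snd x ` fst x"
      by (intro exI[of _ "(W, \<phi>)"]) simp
  qed
  from bchoice[OF this] obtain c where
    c: "\<forall>p\<in>S. local_parametrization S (fst (c p)) (snd (c p)) \<and> p \<in> snd (c p) ` fst (c p)" by (elim exE)
  have "\<forall>p\<in>S. \<exists>Q. open Q \<and> snd (c p) ` fst (c p) = S \<inter> Q"
  proof
    fix p assume "p \<in> S"
    then show "\<exists>Q. open Q \<and> snd (c p) ` fst (c p) = S \<inter> Q"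
      by (intro chartD(10)) (rule conjunct1[OF bspec[OF c]])
  qed
  from bchoice[OF this] obtain Q where Q: "\<forall>p\<in>S. open (Q p) \<and> snd (c p) ` fst (c p) = S \<inter> Q p" by (elim exE)
  have pQ: "p \<in> Q p" if "p \<in> S" for p
    using bspec[OF Q that] bspec[OF c that] by blast
  have oQ: "open (Q p)" if "p \<in> S" for p using bspec[OF Q that] by (rule conjunct1)
  have cov: "S \<subseteq> (\<Union>p\<in>S. Q p)" using pQ by blast
  obtain C' where C': "C' \<subseteq> S" "finite C'" "S \<subseteq> (\<Union>p\<in>C'. Q p)"
    by (rule compactE_image[OF assms(1) oQ cov])
  obtain h where h: "bij_betw h {0..<card C'} C'" using C'(2) ex_bij_betw_nat_finite by blast
  have hS: "h i \<in> S" if "i < card C'" for i using h that C'(1) by (auto simp: bij_betw_def)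
  have im: "h ` {..<card C'} = C'" using h by (simp add: bij_betw_def atLeast0LessThan)
  show ?thesis
  proof (intro exI[of _ "card C'"] exI[of _ "\<lambda>i. fst (c (h i))"] exI[of _ "\<lambda>i. snd (c (h i))"] conjI allI impI)
    show "local_parametrization S (fst (c (h i))) (snd (c (h i)))" if "i < card C'" for i
      by (rule conjunct1[OF bspec[OF c hS[OF that]]])
    have "(\<Union>i<card C'. snd (c (h i)) ` fst (c (h i))) = (\<Union>p\<in>C'. snd (c p) ` fst (c p))"
      by (subst (2) im[symmetric]) auto
    also have "\<dots> = (\<Union>p\<in>C'. S \<inter> Q p)" by (rule SUP_cong[OF refl]) (rule conjunct2[OF bspec[OF Q]], use C'(1) in blast)
    also have "\<dots> = S" using C'(3) by blast
    finally show "S = (\<Union>i<card C'. snd (c (h i)) ` fst (c (h i)))" by simp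
  qed
qed

lemma chart_image_borel:
  assumes "closed S" "local_parametrization S W \<phi>" shows "\<phi> ` W \<in> sets borel"
proof -
  obtain Q where "open Q" "\<phi> ` W = S \<inter> Q" using chartD(10)[OF assms(2)] by (elim exE conjE)
  then show ?thesis using assms(1) by simp
qed

text \<open>Charts overlap, so the finite atlas is cut into disjoint Borel pieces, each inside one
  chart; sums over the pieces then count every point once.\<close>

lemma smooth_surface_partition:
  assumes "compact S" "smooth_surface S"
  shows "\<exists>(m::nat) W \<phi> D. (\<forall>i<m. local_parametrization S (W i) (\<phi> i) \<and> D i \<in> sets borel \<and> D i \<subseteq> \<phi> i ` W i)
    \<and> disjoint_family_on D {..<m} \<and> S = (\<Union>i<m. D i)"
proof -
  obtain m :: nat and W \<phi> where at0: "\<forall>i<m. local_parametrization S (W i) (\<phi> i)"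
    and at2: "S = (\<Union>i<m. \<phi> i ` W i)"
    using smooth_surface_finite_atlas[OF assms] by (elim exE conjE)
  have at1: "local_parametrization S (W i) (\<phi> i)" if "i < m" for i using at0 that by blast
  have b: "\<phi> i ` W i \<in> sets borel" if "i < m" for i
    using chart_image_borel[OF compact_imp_closed[OF assms(1)] at1[OF that]] .
  \<comment> \<open>Padding with empty sets turns the finite atlas into a sequence, the form that
    \<open>disjointed\<close> takes.\<close>
  define A where "A i = (if i < m then \<phi> i ` W i else {})" for i
  have Ab: "A i \<in> sets borel" for i using b by (simp add: A_def)
  show ?thesis
  proof (intro exI[of _ m] exI[of _ W] exI[of _ \<phi>] exI[of _ "disjointed A"] conjI allI impI)
    show "disjointed A i \<in> sets borel" for i
      using sets.range_disjointed_sets[of A borel] Ab by blast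
    show "disjointed A i \<subseteq> \<phi> i ` W i" if "i < m" for i
      using disjointed_subset[of A i] that by (simp add: A_def)
    show "disjoint_family_on (disjointed A) {..<m}"
      using disjoint_family_disjointed[of A] by (simp add: disjoint_family_on_def)
    have "disjointed A i = {}" if "\<not> i < m" for i using disjointed_subset[of A i] that by (auto simp: A_def)
    then have "(\<Union>i<m. disjointed A i) = (\<Union>i. disjointed A i)" by blast
    also have "\<dots> = (\<Union>i. A i)" by (rule UN_disjointed_eq)
    also have "\<dots> = S" by (subst at2) (auto simp: A_def split: if_splits)
    finally show "S = (\<Union>i<m. disjointed A i)" by simp
  qed (rule at1)
qed

text \<open>The specification fixes the measure of every Borel set inside a chart, and additivity
  over the disjoint pieces \<open>D i\<close> then fixes it everywhere.\<close>

lemma surface_measure_spec_unique: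
  assumes "compact S" "smooth_surface S" and s1: "surface_measure_spec S \<sigma>1" and s2: "surface_measure_spec S \<sigma>2"
  shows "\<sigma>1 = \<sigma>2"
proof -
  obtain m :: nat and W \<phi> D where
    D0: "\<forall>i<m. local_parametrization S (W i) (\<phi> i) \<and> D i \<in> sets borel \<and> D i \<subseteq> \<phi> i ` W i"
    and D4: "disjoint_family_on D {..<m}" and D5: "S = (\<Union>i<m. D i)"
    using smooth_surface_partition[OF assms(1,2)] by (elim exE conjE)
  have D: "local_parametrization S (W i) (\<phi> i)" "D i \<in> sets borel" "D i \<subseteq> \<phi> i ` W i" if "i < m" for i
    using D0 that by blast+
  have Sb: "S \<in> sets borel" using compact_imp_closed[OF assms(1)] by simp
  have sum: "emeasure \<sigma> A = (\<Sum>i<m. area_integral (W i) (\<phi> i) (A \<inter> D i))"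
    if s: "surface_measure_spec S \<sigma>" and A: "A \<in> sets (restrict_space borel S)" for \<sigma> A
  proof -
    have se: "sets \<sigma> = sets (restrict_space borel S)" using s by (simp add: surface_measure_spec_def)
    have Ab: "A \<in> sets borel" "A \<subseteq> S" using A Sb by (auto simp: sets_restrict_space_iff)
    have in_s: "A \<inter> D i \<in> sets \<sigma>" if "i < m" for i
      unfolding se using D(2)[OF that] Ab Sb by (auto simp: sets_restrict_space_iff)
    have "A = (\<Union>i<m. A \<inter> D i)" using Ab(2) D5 by blast
    then have "emeasure \<sigma> A = emeasure \<sigma> (\<Union>i\<in>{..<m}. A \<inter> D i)" by simp
    also have "\<dots> = (\<Sum>i<m. emeasure \<sigma> (A \<inter> D i))"
      using in_s D4 by (intro sum_emeasure[symmetric]) (auto simp: disjoint_family_on_def)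
    also have "\<dots> = (\<Sum>i<m. area_integral (W i) (\<phi> i) (A \<inter> D i))"
    proof (rule sum.cong[OF refl])
      fix i assume "i \<in> {..<m}"
      then have i: "i < m" by simp
      have "local_parametrization S (W i) (\<phi> i)" "A \<inter> D i \<in> sets borel" "A \<inter> D i \<subseteq> \<phi> i ` W i"
        using D(1)[OF i] D(2)[OF i] Ab(1) le_infI2[OF D(3)[OF i]] by auto
      then show "emeasure \<sigma> (A \<inter> D i) = area_integral (W i) (\<phi> i) (A \<inter> D i)"
        using s unfolding surface_measure_spec_def by blast
    qed
    finally show ?thesis .
  qed
  have e: "sets \<sigma>1 = sets (restrict_space borel S)" "sets \<sigma>2 = sets (restrict_space borel S)"
    using s1 s2 by (auto simp: surface_measure_spec_def)
  show ?thesis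
  proof (rule measure_eqI)
    show "sets \<sigma>1 = sets \<sigma>2" using e by simp
    fix A assume "A \<in> sets \<sigma>1"
    then have "A \<in> sets (restrict_space borel S)" using e by simp
    then show "emeasure \<sigma>1 A = emeasure \<sigma>2 A" using sum[OF s1] sum[OF s2] by simp
  qed
qed

text \<open>Measure each piece \<open>D i\<close> in its own chart and add. To verify the
  specification in an arbitrary chart, \<open>area_integral_chart_independent\<close> moves every
  summand into that chart, where additivity reassembles the set.\<close>

lemma surface_measure_spec_exists:
  assumes "compact S" "smooth_surface S" shows "\<exists>\<sigma>. surface_measure_spec S \<sigma>"
proof -
  obtain m :: nat and W \<phi> D where
    D0: "\<forall>i<m. local_parametrization S (W i) (\<phi> i) \<and> D i \<in> sets borel \<and> D i \<subseteq> \<phi> i ` W i"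
    and D4: "disjoint_family_on D {..<m}" and D5: "S = (\<Union>i<m. D i)"
    using smooth_surface_partition[OF assms] by (elim exE conjE)
  have D: "local_parametrization S (W i) (\<phi> i)" "D i \<in> sets borel" "D i \<subseteq> \<phi> i ` W i" if "i < m" for i
    using D0 that by blast+
  have Sb: "S \<in> sets borel" using compact_imp_closed[OF assms(1)] by simp
  define \<mu> where "\<mu> A = (\<Sum>i<m. emeasure (chart_measure (W i) (\<phi> i)) (A \<inter> D i))" for A
  define N where "N = measure_of (UNIV::quat set) (sets borel) \<mu>"
  have setsN: "sets N = sets borel" unfolding N_def
    by (metis sets.sets_measure_of_eq space_borel)
  have ca: "countably_additive (sets N) \<mu>"
  proof (rule countably_additiveI)
    fix A :: "nat \<Rightarrow> quat set" assume A: "range A \<subseteq> sets N" "disjoint_family A"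
    have "(\<Sum>n. \<mu> (A n)) = (\<Sum>i<m. \<Sum>n. emeasure (chart_measure (W i) (\<phi> i)) (A n \<inter> D i))"
      unfolding \<mu>_def by (rule suminf_sum) (rule summableI)
    also have "\<dots> = \<mu> (\<Union> (range A))" unfolding \<mu>_def
    proof (rule sum.cong[OF refl])
      fix i assume i: "i \<in> {..<m}"
      have "(\<Sum>n. emeasure (chart_measure (W i) (\<phi> i)) (A n \<inter> D i))
        = emeasure (chart_measure (W i) (\<phi> i)) (\<Union>n. A n \<inter> D i)"
        using A D(2)[of i] i setsN by (intro suminf_emeasure) (auto simp: disjoint_family_on_def)
      then show "(\<Sum>n. emeasure (chart_measure (W i) (\<phi> i)) (A n \<inter> D i))
        = emeasure (chart_measure (W i) (\<phi> i)) (\<Union> (range A) \<inter> D i)" by simp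
    qed
    finally show "(\<Sum>n. \<mu> (A n)) = \<mu> (\<Union> (range A))" .
  qed
  have pos: "positive (sets N) \<mu>" by (simp add: positive_def \<mu>_def)
  have emN: "emeasure N A = \<mu> A" if "A \<in> sets borel" for A
    by (rule emeasure_measure_of[OF N_def _ pos ca]) (use that setsN in auto)
  let ?\<sigma> = "restrict_space N S"
  have "surface_measure_spec S ?\<sigma>"
    unfolding surface_measure_spec_def
  proof (intro conjI allI impI; (elim conjE)?)
    show "sets ?\<sigma> = sets (restrict_space borel S)" by (rule sets_restrict_space_cong[OF setsN])
    fix W' \<phi>' A assume lp: "local_parametrization S W' \<phi>'" and A: "A \<in> sets borel" "A \<subseteq> \<phi>' ` W'"
    have AS: "A \<subseteq> S" using A(2) chartD(4)[OF lp] by blast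
    have "emeasure ?\<sigma> A = \<mu> A"
      using AS Sb by (subst emeasure_restrict_space) (auto simp: setsN emN A(1))
    also have "\<dots> = (\<Sum>i<m. emeasure (chart_measure W' \<phi>') (A \<inter> D i))"
      unfolding \<mu>_def
    proof (rule sum.cong[OF refl])
      fix i assume "i \<in> {..<m}"
      then have i: "i < m" by simp
      have b: "A \<inter> D i \<in> sets borel" using A(1) D(2)[OF i] by simp
      show "emeasure (chart_measure (W i) (\<phi> i)) (A \<inter> D i) = emeasure (chart_measure W' \<phi>') (A \<inter> D i)"
        unfolding emeasure_chart_measure[OF D(1)[OF i] b] emeasure_chart_measure[OF lp b]
        by (rule area_integral_chart_independent[OF D(1)[OF i] lp b]) (use A(2) D(3)[OF i] in auto)
    qed
    also have "\<dots> = emeasure (chart_measure W' \<phi>') (\<Union>i\<in>{..<m}. A \<inter> D i)"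
      using D(2) D4 A(1) by (intro sum_emeasure) (auto simp: disjoint_family_on_def)
    also have "(\<Union>i\<in>{..<m}. A \<inter> D i) = A" using AS D5 by blast
    finally show "emeasure ?\<sigma> A = area_integral W' \<phi>' A"
      using emeasure_chart_measure[OF lp A(1)] by simp
  qed
  then show ?thesis by blast
qed

lemma surface_measure_satisfies_spec:
  assumes "compact S" "smooth_surface S" shows "surface_measure_spec S (surface_measure S)"
proof -
  have "\<exists>!\<sigma>. surface_measure_spec S \<sigma>"
    using surface_measure_spec_exists[OF assms] surface_measure_spec_unique[OF assms] by blast
  from theI'[OF this] show ?thesis unfolding surface_measure_def surface_measure_spec_def .
qed

text \<open>On the image of the chart the surface measure is the pushforward of the measure with
  density \<open>area_element \<phi>\<close>; since \<open>F\<close> vanishes on the rest of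
  \<open>S\<close>, its integral becomes an integral over parameters.\<close>

lemma surface_integral_chart:
  fixes F :: "quat \<Rightarrow> 'b::{banach, second_countable_topology}"
  assumes S: "compact S" "smooth_surface S" and lp: "local_parametrization S W \<phi>"
    and F0: "\<And>q. q \<in> S - \<phi> ` W \<Longrightarrow> F q = 0"
    and meas: "(\<lambda>y. F (\<phi> y)) \<in> borel_measurable (restrict_space lborel W)"
    and int: "has_bochner_integral lborel (\<lambda>y. indicator W y *\<^sub>R area_element \<phi> y *\<^sub>R F (\<phi> y)) I"
  shows "has_bochner_integral (surface_measure S) F I"
proof -
  let ?\<sigma> = "surface_measure S" and ?M = "restrict_space lborel W"
  have spec: "surface_measure_spec S ?\<sigma>" by (rule surface_measure_satisfies_spec[OF S])
  then have sets\<sigma>: "sets ?\<sigma> = sets (restrict_space borel S)" by (simp add: surface_measure_spec_def)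
  have sp\<sigma>: "space ?\<sigma> = S" using sets_eq_imp_space_eq[OF sets\<sigma>] by (simp add: space_restrict_space)
  have Sb: "S \<in> sets borel" using compact_imp_closed[OF S(1)] by simp
  have img: "\<phi> ` W \<in> sets borel" using chart_image_borel[OF compact_imp_closed[OF S(1)] lp] .
  have imgs: "\<phi> ` W \<in> sets ?\<sigma>"
    unfolding sets\<sigma> using img Sb chartD(4)[OF lp] by (simp add: sets_restrict_space_iff)
  note m[measurable] = chart_measurable[OF lp]
  have spM: "space ?M = W" by (simp add: space_restrict_space)
  have phiS: "\<phi> \<in> ?M \<rightarrow>\<^sub>M ?\<sigma>"
    unfolding measurable_cong_sets[OF refl sets\<sigma>]
    using chartD(4)[OF lp] by (intro measurable_restrict_space2) (auto simp: spM)
  \<comment> \<open>Measurability is given for \<open>F \<circ> \<phi>\<close>. The inverse of the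
    chart is continuous on its image, and composing with it brings measurability back to the
    surface.\<close>
  have Fm: "F \<in> borel_measurable ?\<sigma>"
  proof -
    let ?inv = "inv_into W \<phi>"
    have 1: "?inv \<in> restrict_space borel (\<phi> ` W) \<rightarrow>\<^sub>M ?M"
    proof -
      have "sets ?M = sets (restrict_space (borel::(real^3) measure) W)" by (rule sets_restrict_space_cong) simp
      note * = measurable_cong_sets[OF refl this]
      show ?thesis unfolding *
        by (rule measurable_restrict_space2)
           (auto intro: inv_into_into simp: space_restrict_space intro!: borel_measurable_continuous_on_restrict chartD(9)[OF lp])
    qed
    have "(\<lambda>q. F (\<phi> (?inv q))) \<in> borel_measurable (restrict_space borel (\<phi> ` W))"
      by (rule measurable_compose[OF 1 meas])
    then have "(\<lambda>q. if q \<in> \<phi> ` W then F (\<phi> (?inv q)) else 0) \<in> borel_measurable borel"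
      using img by (subst measurable_If_restrict_space_iff) auto
    then have "(\<lambda>q. if q \<in> \<phi> ` W then F (\<phi> (?inv q)) else 0) \<in> borel_measurable (restrict_space borel S)"
      by (rule measurable_restrict_space1)
    also have "?this \<longleftrightarrow> F \<in> borel_measurable (restrict_space borel S)"
      by (rule measurable_cong) (use F0 in \<open>auto simp: space_restrict_space f_inv_into_f\<close>)
    finally show ?thesis unfolding measurable_cong_sets[OF sets\<sigma> refl] .
  qed
  have eq: "density ?\<sigma> (indicator (\<phi> ` W)) = distr (density ?M (\<lambda>y. ennreal (area_element \<phi> y))) ?\<sigma> \<phi>"
  proof (rule measure_eqI)
    fix A assume "A \<in> sets (density ?\<sigma> (indicator (\<phi> ` W)))"
    then have A: "A \<in> sets ?\<sigma>" by simp
    then have Ab: "A \<in> sets borel" "A \<subseteq> S" using Sb sets\<sigma> by (auto simp: sets_restrict_space_iff)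
    have b: "A \<inter> \<phi> ` W \<in> sets borel" using Ab img by simp
    have "emeasure (density ?\<sigma> (indicator (\<phi> ` W))) A = (\<integral>\<^sup>+q. indicator (A \<inter> \<phi> ` W) q \<partial>?\<sigma>)"
      using imgs A by (subst emeasure_density) (auto simp del: nn_integral_indicator intro!: nn_integral_cong split: split_indicator)
    also have "\<dots> = emeasure ?\<sigma> (A \<inter> \<phi> ` W)" using A imgs by simp
    also have "\<dots> = area_integral W \<phi> (A \<inter> \<phi> ` W)"
      using spec lp b unfolding surface_measure_spec_def by blast
    also have "\<dots> = emeasure (chart_measure W \<phi>) (A \<inter> \<phi> ` W)"
      using emeasure_chart_measure[OF lp b] by simp
    also have "\<dots> = emeasure (density ?M (\<lambda>y. ennreal (area_element \<phi> y))) (\<phi> -` (A \<inter> \<phi> ` W) \<inter> W)"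
      unfolding chart_measure_def using b by (subst emeasure_distr) (auto simp: spM)
    also have "\<phi> -` (A \<inter> \<phi> ` W) \<inter> W = \<phi> -` A \<inter> W" by auto
    also have "emeasure (density ?M (\<lambda>y. ennreal (area_element \<phi> y))) (\<phi> -` A \<inter> W)
       = emeasure (distr (density ?M (\<lambda>y. ennreal (area_element \<phi> y))) ?\<sigma> \<phi>) A"
      using A phiS by (subst emeasure_distr) (auto simp: spM)
    finally show "emeasure (density ?\<sigma> (indicator (\<phi> ` W))) A
      = emeasure (distr (density ?M (\<lambda>y. ennreal (area_element \<phi> y))) ?\<sigma> \<phi>) A" .
  qed simp
  have nn: "AE y in ?M. 0 \<le> area_element \<phi> y"
    by (rule AE_I2) (use area_element_pos[OF lp] in \<open>auto simp: spM less_imp_le\<close>)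
  have "has_bochner_integral ?M (\<lambda>y. area_element \<phi> y *\<^sub>R F (\<phi> y)) I"
    using int by (simp add: has_bochner_integral_iff integrable_restrict_space integral_restrict_space)
  then have "has_bochner_integral (density ?M (\<lambda>y. ennreal (area_element \<phi> y))) (\<lambda>y. F (\<phi> y)) I"
    using meas nn by (intro has_bochner_integral_density) auto
  then have "has_bochner_integral (distr (density ?M (\<lambda>y. ennreal (area_element \<phi> y))) ?\<sigma> \<phi>) F I"
    using Fm phiS by (intro has_bochner_integral_distr) auto
  then have 2: "has_bochner_integral (density ?\<sigma> (\<lambda>q. ennreal (indicator (\<phi> ` W) q))) F I"
    unfolding eq[symmetric] by (simp add: ennreal_indicator)
  have im: "(\<lambda>q. indicator (\<phi> ` W) q :: real) \<in> borel_measurable ?\<sigma>" using imgs by simp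
  have nn2: "AE q in ?\<sigma>. (0::real) \<le> indicator (\<phi> ` W) q" by simp
  have "has_bochner_integral ?\<sigma> (\<lambda>q. indicator (\<phi> ` W) q *\<^sub>R F q) I"
    using 2 unfolding has_bochner_integral_iff integrable_density[OF Fm im nn2] integral_density[OF Fm im nn2] .
  also have "?this \<longleftrightarrow> has_bochner_integral ?\<sigma> F I"
    by (rule has_bochner_integral_cong) (use F0 in \<open>auto simp: sp\<sigma> split: split_indicator\<close>)
  finally show ?thesis .
qed

section \<open>The two sides of the boundary and the outward normal\<close>

text \<open>A neighbourhood of a boundary point straightened by the flow: the boundary of
  \<open>G\<close> is the slice at flow time 0, and each open half lies entirely in \<open>G\<close>
  or entirely outside. The flags \<open>cm\<close> and \<open>cp\<close> tell whether the half with
  negative and the half with positive time belongs to \<open>G\<close>. Both are true when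
  \<open>G\<close> lies on both sides of its boundary; by \<open>side\<close> they are not both
  false.\<close>

locale flow_box =
  fixes G :: "quat set" and W :: "(real^3) set" and \<phi> :: "real^3 \<Rightarrow> quat" and v :: quat
    and \<epsilon> :: real and B :: "(real^3) set" and g :: "quat \<Rightarrow> quat" and cm cp :: bool
  assumes lp: "local_parametrization (frontier G) W \<phi>" and openG: "open G"
    and eps: "0 < \<epsilon>" and openB: "open B" and BW: "B \<subseteq> W"
    and openN: "open (flow \<phi> v ` ({-\<epsilon><..<\<epsilon>} \<times> B))"
    and homeo: "homeomorphism ({-\<epsilon><..<\<epsilon>} \<times> B) (flow \<phi> v ` ({-\<epsilon><..<\<epsilon>} \<times> B)) (flow \<phi> v) g"
    and gder: "\<And>x. x \<in> {-\<epsilon><..<\<epsilon>} \<times> B \<Longrightarrow> (g has_derivative inv (flowd \<phi> v x)) (at (flow \<phi> v x))"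
    and bij: "\<And>x. x \<in> {-\<epsilon><..<\<epsilon>} \<times> B \<Longrightarrow> bij (flowd \<phi> v x)"
    and front: "\<And>x. x \<in> {-\<epsilon><..<\<epsilon>} \<times> B \<Longrightarrow> flow \<phi> v x \<in> frontier G \<longleftrightarrow> fst x = 0"
    and side: "cm \<or> cp"
    and sidem: "\<And>x. x \<in> {-\<epsilon><..<0} \<times> B \<Longrightarrow> flow \<phi> v x \<in> G \<longleftrightarrow> cm"
    and sidep: "\<And>x. x \<in> {0<..<\<epsilon>} \<times> B \<Longrightarrow> flow \<phi> v x \<in> G \<longleftrightarrow> cp"

lemma continuous_on_flow:
  assumes "local_parametrization S W \<phi>" "A \<subseteq> UNIV \<times> W" shows "continuous_on A (flow \<phi> v)"
  using assms by (intro continuous_at_imp_continuous_on ballI has_derivative_continuous[OF flow_has_derivative]) auto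

lemma connected_frontier_disjoint:
  assumes "connected C" "C \<inter> frontier G = {}" shows "\<exists>c. \<forall>x\<in>C. x \<in> G \<longleftrightarrow> c"
proof (cases "C \<inter> G = {}")
  case True then show ?thesis by blast
next
  case False
  then have "C - G = {}" using connected_Int_frontier[OF assms(1) False] assms(2) by blast
  then show ?thesis by blast
qed

text \<open>The flow neighbourhood is shrunk until it meets the boundary of \<open>G\<close> only in
  the chart. Its two halves are then connected and miss the boundary, so each lies inside or outside
  \<open>G\<close>.\<close>

lemma flow_box_exists:
  assumes lp: "local_parametrization (frontier G) W \<phi>" and G: "open G" and y0: "y0 \<in> W"
    and n: "unit_normal \<phi> y0 n" and nv: "n \<bullet> v \<noteq> 0"
  shows "\<exists>\<epsilon> B g cm cp. y0 \<in> B \<and> flow_box G W \<phi> v \<epsilon> B g cm cp"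
proof -
  note D = chartD[OF lp]
  obtain U' V' g g' where *: "open U'" "U' \<subseteq> UNIV \<times> W" "(0,y0) \<in> U'" "open V'"
    "homeomorphism U' V' (flow \<phi> v) g"
    "\<And>q. q \<in> V' \<Longrightarrow> (g has_derivative g' q) (at q)"
    "\<And>q. q \<in> V' \<Longrightarrow> g' q = inv (flowd \<phi> v (g q))"
    "\<And>q. q \<in> V' \<Longrightarrow> bij (flowd \<phi> v (g q))"
    by (rule flow_chart[OF lp y0 n nv]; rule that; assumption)
  have gfl: "g (flow \<phi> v x) = x" "flow \<phi> v x \<in> V'" if "x \<in> U'" for x
    using *(5) that by (auto simp: homeomorphism_def)
  obtain Q where Q: "open Q" "\<phi> ` W = frontier G \<inter> Q" using D(10) by (elim exE conjE)
  let ?W2 = "W \<inter> {y. (0,y) \<in> U'}"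
  have oP: "open {z. (0,z) \<in> U'}" by (rule open_zero_slice[OF *(1)])
  \<comment> \<open>The chart image is relatively open in the boundary of \<open>G\<close>, and so
    is the image of the smaller parameter set, because the inverse chart is continuous.
    \<open>Q\<close> and \<open>Q2\<close> cut them out; within both, the boundary has no further
    points.\<close>
  have "openin (top_of_set (\<phi> ` W)) (\<phi> ` W \<inter> inv_into W \<phi> -` {z. (0,z) \<in> U'})"
    by (rule continuous_openin_preimage_gen[OF D(9) oP])
  moreover have "\<phi> ` W \<inter> inv_into W \<phi> -` {z. (0,z) \<in> U'} = \<phi> ` ?W2"
    using D(2) by (auto simp: image_iff)
  ultimately obtain Q2 where Q2: "open Q2" "\<phi> ` ?W2 = \<phi> ` W \<inter> Q2" by (auto simp: openin_open)
  have front2: "frontier G \<inter> (Q \<inter> Q2) = \<phi> ` ?W2" unfolding Q2(2) Q(2) by blast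
  have cf: "continuous_on U' (flow \<phi> v)" by (rule continuous_on_flow[OF lp *(2)])
  have oO: "open (U' \<inter> flow \<phi> v -` (Q \<inter> Q2))"
    by (rule continuous_open_preimage[OF cf *(1)]) (use Q(1) Q2(1) in blast)
  have "flow \<phi> v (0,y0) \<in> Q \<inter> Q2"
  proof -
    have "\<phi> y0 \<in> \<phi> ` ?W2" using y0 *(3) by blast
    then show ?thesis using front2 by (auto simp: flow_def)
  qed
  then have x0: "(0,y0) \<in> U' \<inter> flow \<phi> v -` (Q \<inter> Q2)" using *(3) by simp
  obtain A B' where AB: "open A" "open B'" "(0,y0) \<in> A \<times> B'" "A \<times> B' \<subseteq> U' \<inter> flow \<phi> v -` (Q \<inter> Q2)"
    using open_prod_elim[OF oO x0] by blast
  obtain \<epsilon> where e: "0 < \<epsilon>" "ball 0 \<epsilon> \<subseteq> A" using AB(1,3) openE by blast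
  obtain d where d: "0 < d" "ball y0 d \<subseteq> B'" using AB(2,3) openE by blast
  let ?B = "ball y0 d" let ?X = "{-\<epsilon><..<\<epsilon>} \<times> ?B"
  have XO: "?X \<subseteq> U' \<inter> flow \<phi> v -` (Q \<inter> Q2)"
  proof -
    have "{-\<epsilon><..<\<epsilon>} = ball 0 \<epsilon>" by (auto simp: dist_real_def)
    then show ?thesis using e(2) d(2) AB(4) by blast
  qed
  then have XU: "?X \<subseteq> U'" by blast
  have BW: "?B \<subseteq> W"
  proof
    fix y assume "y \<in> ?B" then have "(0,y) \<in> U'" using XU e(1) by auto
    then show "y \<in> W" using *(2) by auto
  qed
  have homX: "homeomorphism ?X (flow \<phi> v ` ?X) (flow \<phi> v) g"
    by (rule homeomorphism_of_subsets[OF *(5) XU]) (use XU *(5) in \<open>auto simp: homeomorphism_def\<close>)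
  have oX: "open ?X" by (simp add: open_Times)
  have oN: "open (flow \<phi> v ` ?X)"
    using homeomorphism_imp_open_map[OF *(5), of ?X] oX XU *(1,4)
    by (metis open_openin_trans openin_open_trans open_subset)
  have front: "flow \<phi> v x \<in> frontier G \<longleftrightarrow> fst x = 0" if x: "x \<in> ?X" for x
  proof
    assume "fst x = 0"
    then have "flow \<phi> v x = \<phi> (snd x)" by (simp add: flow_def)
    moreover have "snd x \<in> W" using x BW by (auto simp: mem_Times_iff)
    ultimately show "flow \<phi> v x \<in> frontier G" using D(4) by auto
  next
    assume "flow \<phi> v x \<in> frontier G"
    then have "flow \<phi> v x \<in> \<phi> ` ?W2" using XO x front2 by blast
    then obtain y where y: "y \<in> ?W2" "flow \<phi> v x = \<phi> y" by blast
    \<comment> \<open>The same boundary point is reached at time 0, and the flow is injective on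
      \<open>U'\<close>.\<close>
    have "flow \<phi> v (0,y) = flow \<phi> v x" using y(2) by (simp add: flow_def)
    moreover have "(0,y) \<in> U'" using y(1) by simp
    ultimately have "x = (0,y)" using gfl(1)[of x] gfl(1)[of "(0,y)"] x XU by force
    then show "fst x = 0" by simp
  qed
  have conn: "connected (flow \<phi> v ` (I \<times> ?B))" if "convex I" "I \<subseteq> {-\<epsilon><..<\<epsilon>}" for I
  proof (rule connected_continuous_image)
    show "continuous_on (I \<times> ?B) (flow \<phi> v)" by (rule continuous_on_flow[OF lp]) (use BW in blast)
    show "connected (I \<times> ?B)" using that(1) by (intro convex_connected convex_Times) auto
  qed
  have sides: "\<exists>c. \<forall>q\<in>flow \<phi> v ` (I \<times> ?B). q \<in> G \<longleftrightarrow> c" if I: "convex I" "I \<subseteq> {-\<epsilon><..<\<epsilon>}" "0 \<notin> I" for I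
  proof (rule connected_frontier_disjoint[OF conn[OF I(1,2)]])
    have "flow \<phi> v x \<notin> frontier G" if "x \<in> I \<times> ?B" for x
      using front[of x] that I(2,3) by (auto simp: mem_Times_iff)
    then show "flow \<phi> v ` (I \<times> ?B) \<inter> frontier G = {}" by blast
  qed
  have "\<exists>c. \<forall>q\<in>flow \<phi> v ` ({-\<epsilon><..<0} \<times> ?B). q \<in> G \<longleftrightarrow> c"
    by (rule sides) (use e(1) in auto)
  then obtain cm where cm: "\<forall>q\<in>flow \<phi> v ` ({-\<epsilon><..<0} \<times> ?B). q \<in> G \<longleftrightarrow> cm" by (elim exE)
  have "\<exists>c. \<forall>q\<in>flow \<phi> v ` ({0<..<\<epsilon>} \<times> ?B). q \<in> G \<longleftrightarrow> c"
    by (rule sides) (use e(1) in auto)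
  then obtain cp where cp: "\<forall>q\<in>flow \<phi> v ` ({0<..<\<epsilon>} \<times> ?B). q \<in> G \<longleftrightarrow> cp" by (elim exE)
  \<comment> \<open>Otherwise the open image of the flow would miss \<open>G\<close>, although it
    contains the boundary point \<open>\<phi> y0\<close>, which lies in the closure of
    \<open>G\<close>.\<close>
  have "cm \<or> cp"
  proof (rule ccontr)
    assume "\<not> (cm \<or> cp)"
    have noG: "flow \<phi> v x \<notin> G" if x: "x \<in> ?X" for x
    proof -
      consider "fst x < 0" | "fst x = 0" | "fst x > 0" by linarith
      then show ?thesis
      proof cases
        case 1
        then have "flow \<phi> v x \<in> flow \<phi> v ` ({-\<epsilon><..<0} \<times> ?B)" using x by auto
        then show ?thesis using cm \<open>\<not> (cm \<or> cp)\<close> by blast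
      next
        case 2 then show ?thesis using front[OF x] G by (auto simp: frontier_def interior_open)
      next
        case 3
        then have "flow \<phi> v x \<in> flow \<phi> v ` ({0<..<\<epsilon>} \<times> ?B)" using x by auto
        then show ?thesis using cp \<open>\<not> (cm \<or> cp)\<close> by blast
      qed
    qed
    have x0: "(0,y0) \<in> ?X" using e(1) d(1) by simp
    have "flow \<phi> v (0,y0) \<in> closure G" using front[OF x0] by (simp add: frontier_def)
    moreover have "flow \<phi> v (0,y0) \<in> flow \<phi> v ` ?X" using x0 by blast
    ultimately have "flow \<phi> v ` ?X \<inter> G \<noteq> {}" using oN by (metis disjoint_iff open_Int_closure_eq_empty)
    then show False using noG by blast
  qed
  have "flow_box G W \<phi> v \<epsilon> ?B g cm cp"
  proof
    show "(g has_derivative inv (flowd \<phi> v x)) (at (flow \<phi> v x))" "bij (flowd \<phi> v x)" if "x \<in> ?X" for x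
      using *(6,7,8)[OF gfl(2)] gfl(1) that XU by auto
    show "flow \<phi> v x \<in> G \<longleftrightarrow> cm" if "x \<in> {-\<epsilon><..<0} \<times> ?B" for x using cm that by blast
    show "flow \<phi> v x \<in> G \<longleftrightarrow> cp" if "x \<in> {0<..<\<epsilon>} \<times> ?B" for x using cp that by blast
  qed (fact lp G e(1) open_ball BW oN homX front \<open>cm \<or> cp\<close>)+
  moreover have "y0 \<in> ?B" using d(1) by simp
  ultimately show ?thesis by blast
qed

context flow_box
begin

abbreviation "X \<equiv> {-\<epsilon><..<\<epsilon>} \<times> B"
abbreviation "N \<equiv> flow \<phi> v ` X"

text \<open>The derivative of the flow is onto, so \<open>m\<close> is a tangent vector plus a
  multiple of \<open>v\<close>. Pairing with \<open>m\<close> gives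
  \<open>1 = fst c * (m \<bullet> v)\<close>, which yields both claims; the second is the speed of
  the flow time in direction \<open>m\<close>.\<close>

lemma normal_transversal:
  assumes y: "y \<in> B" and m: "unit_normal \<phi> y m"
  shows "m \<bullet> v \<noteq> 0" and "fst (inv (flowd \<phi> v (0,y)) m) = 1 / (m \<bullet> v)"
proof -
  have x: "(0,y) \<in> X" using y eps by simp
  obtain c where c: "flowd \<phi> v (0,y) c = m" using bij[OF x] by (metis bij_pointE)
  then have m': "m = Dphi \<phi> y (snd c) + fst c *\<^sub>R v" by (simp add: flowd_def)
  have "m \<bullet> m = fst c * (m \<bullet> v)"
    by (subst (2) m') (use m in \<open>simp add: inner_add_right unit_normal_def\<close>)
  moreover have "m \<bullet> m = 1" using m by (simp add: unit_normal_def norm_eq_1)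
  ultimately have 1: "fst c * (m \<bullet> v) = 1" by simp
  then show "m \<bullet> v \<noteq> 0" by auto
  have "inv (flowd \<phi> v (0,y)) m = c" using c bij[OF x] by (metis bij_inv_eq_iff)
  then show "fst (inv (flowd \<phi> v (0,y)) m) = 1 / (m \<bullet> v)" using 1 \<open>m \<bullet> v \<noteq> 0\<close> by (simp add: field_simps)
qed

text \<open>Let \<open>h r\<close> be the flow time of the point
  \<open>\<phi> y + r *\<^sub>R m\<close>. It vanishes at 0 with derivative
  \<open>1 / (m \<bullet> v)\<close>, so for small positive \<open>r\<close> its sign, and with it
  the half of the flow box, is decided by the sign of \<open>m \<bullet> v\<close>.\<close>

lemma normal_side:
  assumes y: "y \<in> B" and m: "unit_normal \<phi> y m"
  shows "\<exists>\<delta>>0. \<forall>r. 0 < r \<and> r < \<delta> \<longrightarrow>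
    (\<phi> y + r *\<^sub>R m \<in> G \<longleftrightarrow> (if m \<bullet> v > 0 then cp else cm))"
proof -
  let ?q = "\<phi> y"
  have x: "(0,y) \<in> X" using y eps by simp
  have fl: "flow \<phi> v (0,y) = ?q" by (simp add: flow_def)
  define h where "h r = fst (g (?q + r *\<^sub>R m))" for r
  have gq: "g ?q = (0,y)" using homeo x fl by (metis homeomorphism_apply1)
  have der0: "((\<lambda>r. ?q + r *\<^sub>R m) has_derivative (\<lambda>r. r *\<^sub>R m)) (at 0)"
    by (auto intro!: derivative_eq_intros)
  have gd: "(g has_derivative inv (flowd \<phi> v (0,y))) (at (?q + 0 *\<^sub>R m))"
    using gder[OF x] fl by simp
  have "(h has_derivative (\<lambda>r. fst (inv (flowd \<phi> v (0,y)) (r *\<^sub>R m)))) (at 0)"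
    unfolding h_def by (rule has_derivative_fst, rule has_derivative_compose[OF der0 gd])
  moreover have "(\<lambda>r. fst (inv (flowd \<phi> v (0,y)) (r *\<^sub>R m))) = (*) (1 / (m \<bullet> v))"
    using has_derivative_linear[OF gd] by (auto simp: linear_scale normal_transversal(2)[OF y m] fun_eq_iff)
  ultimately have hd: "(h has_real_derivative 1 / (m \<bullet> v)) (at 0)" by (simp add: has_field_derivative_def)
  have h0: "h 0 = 0" by (simp add: h_def gq)
  have "isCont (\<lambda>r. ?q + r *\<^sub>R m) 0" by (intro continuous_intros)
  moreover have "?q + 0 *\<^sub>R m \<in> N" using x fl by force
  ultimately have "\<forall>\<^sub>F r in at 0. ?q + r *\<^sub>R m \<in> N"
    using openN by (metis isCont_def topological_tendstoD)
  then obtain d1 where d1: "0 < d1" "\<And>r. r \<noteq> 0 \<Longrightarrow> \<bar>r\<bar> < d1 \<Longrightarrow> ?q + r *\<^sub>R m \<in> N"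
    unfolding eventually_at by (auto simp: dist_real_def)
  have hq: "?q + r *\<^sub>R m = flow \<phi> v (g (?q + r *\<^sub>R m))" "g (?q + r *\<^sub>R m) \<in> X" if "0 < r" "r < d1" for r
  proof -
    have "?q + r *\<^sub>R m \<in> N" using d1(2)[of r] that by simp
    then show "?q + r *\<^sub>R m = flow \<phi> v (g (?q + r *\<^sub>R m))" "g (?q + r *\<^sub>R m) \<in> X"
      using homeo unfolding homeomorphism_def by auto
  qed
  obtain d2 where d2: "0 < d2" "\<And>r. 0 < r \<Longrightarrow> r < d2 \<Longrightarrow> if m \<bullet> v > 0 then 0 < h r else h r < 0"
  proof (cases "m \<bullet> v > 0")
    case True
    then show ?thesis using that DERIV_pos_inc_right[OF hd] h0 by auto
  next
    case False
    then have "m \<bullet> v < 0" using normal_transversal(1)[OF y m] by simp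
    then show ?thesis using that DERIV_neg_dec_right[OF hd] h0 False by auto
  qed
  show ?thesis
  proof (intro exI[of _ "min d1 d2"] conjI allI impI)
    fix r assume "0 < r \<and> r < min d1 d2"
    then have r: "0 < r" "r < d1" "r < d2" by auto
    have "g (?q + r *\<^sub>R m) \<in> (if m \<bullet> v > 0 then {0<..<\<epsilon>} else {-\<epsilon><..<0}) \<times> B"
      using hq(2)[OF r(1,2)] d2(2)[OF r(1,3)] by (auto simp: h_def mem_Times_iff)
    then have "flow \<phi> v (g (?q + r *\<^sub>R m)) \<in> G \<longleftrightarrow> (if m \<bullet> v > 0 then cp else cm)"
      by (cases "m \<bullet> v > 0") (simp_all only: if_True if_False sidep sidem)
    then show "?q + r *\<^sub>R m \<in> G \<longleftrightarrow> (if m \<bullet> v > 0 then cp else cm)"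
      unfolding hq(1)[OF r(1,2), symmetric] .
  qed (use d1(1) d2(1) in auto)
qed

lemma unit_normal_minus: "unit_normal \<phi> y m \<Longrightarrow> unit_normal \<phi> y (- m)"
  by (simp add: unit_normal_def)

lemma unit_normal_unique:
  assumes y: "y \<in> B" and m: "unit_normal \<phi> y m" and k: "unit_normal \<phi> y k" and s: "0 < (m \<bullet> v) * (k \<bullet> v)"
  shows "m = k"
proof -
  have x: "(0,y) \<in> X" using y eps by simp
  have kv: "k \<bullet> v \<noteq> 0" using normal_transversal(1)[OF y k] .
  \<comment> \<open>Chosen so that \<open>m - c *\<^sub>R k\<close> is orthogonal to
    \<open>v\<close> as well as to the tangent vectors. The derivative of the flow is onto, so this
    difference is 0, and with \<open>c\<close> positive unit length forces
    \<open>c = 1\<close>.\<close>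
  define c where "c = (m \<bullet> v) / (k \<bullet> v)"
  have c0: "0 < c" using s by (simp add: c_def zero_less_mult_iff zero_less_divide_iff)
  let ?d = "m - c *\<^sub>R k"
  obtain z where z: "flowd \<phi> v (0,y) z = ?d" using bij[OF x] by (metis bij_pointE)
  have "?d \<bullet> Dphi \<phi> y (snd z) = 0" "?d \<bullet> v = 0"
    using m k kv by (auto simp: unit_normal_def inner_diff_left c_def)
  then have "?d \<bullet> flowd \<phi> v (0,y) z = 0" by (simp add: flowd_def inner_add_right)
  then have "?d \<bullet> ?d = 0" using z by simp
  then have mk: "m = c *\<^sub>R k" by simp
  then have "norm m = c * norm k" using c0 by simp
  then have "c = 1" using m k by (simp add: unit_normal_def)
  then show ?thesis using mk by simp
qed

text \<open>The condition over all parametrizations reduces to \<open>\<phi>\<close>, because by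
  \<open>transition_map\<close> the tangent vectors of any other chart at the point are tangent
  vectors of \<open>\<phi>\<close>. The conditions on the two sides are \<open>normal_side\<close>
  for \<open>n\<close> and for \<open>- n\<close>.\<close>

lemma is_outward_normal_iff:
  assumes y: "y \<in> B"
  shows "is_outward_normal G (\<phi> y) n \<longleftrightarrow> unit_normal \<phi> y n \<and> (if n \<bullet> v > 0 then cm \<and> \<not> cp else cp \<and> \<not> cm)"
    (is "_ \<longleftrightarrow> ?U \<and> ?s")
proof -
  let ?q = "\<phi> y"
  have yW: "y \<in> W" using y BW by blast
  have perp: "(\<forall>W' \<phi>' y' w. local_parametrization (frontier G) W' \<phi>' \<and> y' \<in> W' \<and> \<phi>' y' = ?q \<longrightarrow>
        n \<bullet> frechet_derivative \<phi>' (at y') w = 0) \<longleftrightarrow> (\<forall>w. n \<bullet> Dphi \<phi> y w = 0)"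
  proof
    assume *: "\<forall>w. n \<bullet> Dphi \<phi> y w = 0"
    show "\<forall>W' \<phi>' y' w. local_parametrization (frontier G) W' \<phi>' \<and> y' \<in> W' \<and> \<phi>' y' = ?q \<longrightarrow>
        n \<bullet> frechet_derivative \<phi>' (at y') w = 0"
    proof (intro allI impI, elim conjE)
      fix W' \<phi>' y' w assume lp': "local_parametrization (frontier G) W' \<phi>'" and y': "y' \<in> W'" "\<phi>' y' = ?q"
      have "\<phi>' y' \<in> \<phi> ` W" using y' yW by simp
      from transition_map[OF lp' lp y'(1) this] obtain \<tau>' where
        t: "\<forall>v. Dphi \<phi>' y' v = Dphi \<phi> (inv_into W \<phi> (\<phi>' y')) (\<tau>' v)" by blast
      have "inv_into W \<phi> (\<phi>' y') = y" unfolding y'(2) using inv_into_f_f[OF chartD(2)[OF lp] yW] .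
      then show "n \<bullet> frechet_derivative \<phi>' (at y') w = 0" using t * by simp
    qed
  next
    assume "\<forall>W' \<phi>' y' w. local_parametrization (frontier G) W' \<phi>' \<and> y' \<in> W' \<and> \<phi>' y' = ?q \<longrightarrow>
        n \<bullet> frechet_derivative \<phi>' (at y') w = 0"
    then show "\<forall>w. n \<bullet> Dphi \<phi> y w = 0" using lp yW by blast
  qed
  have sides: "(\<exists>\<delta>>0. \<forall>r. 0 < r \<and> r < \<delta> \<longrightarrow> ?q - r *\<^sub>R n \<in> G \<and> ?q + r *\<^sub>R n \<notin> G) \<longleftrightarrow> ?s" if U: ?U
  proof -
    obtain d1 where d1: "d1 > 0" "\<forall>r. 0 < r \<and> r < d1 \<longrightarrow> (?q + r *\<^sub>R n \<in> G \<longleftrightarrow> (if n \<bullet> v > 0 then cp else cm))"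
      using normal_side[OF y U] by blast
    obtain d2 where d2: "d2 > 0" "\<forall>r. 0 < r \<and> r < d2 \<longrightarrow> (?q + r *\<^sub>R (- n) \<in> G \<longleftrightarrow> (if - n \<bullet> v > 0 then cp else cm))"
      using normal_side[OF y unit_normal_minus[OF U]] by blast
    have nv: "n \<bullet> v \<noteq> 0" by (rule normal_transversal(1)[OF y U])
    have e: "(?q - r *\<^sub>R n \<in> G \<and> ?q + r *\<^sub>R n \<notin> G) = ?s" if "0 < r" "r < d1" "r < d2" for r
      using d1(2)[rule_format, of r] d2(2)[rule_format, of r] that nv by auto
    show ?thesis
    proof
      assume "\<exists>\<delta>>0. \<forall>r. 0 < r \<and> r < \<delta> \<longrightarrow> ?q - r *\<^sub>R n \<in> G \<and> ?q + r *\<^sub>R n \<notin> G"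
      then obtain d where d: "d > 0" "\<forall>r. 0 < r \<and> r < d \<longrightarrow> ?q - r *\<^sub>R n \<in> G \<and> ?q + r *\<^sub>R n \<notin> G" by blast
      let ?r = "min d (min d1 d2) / 2"
      have "0 < ?r" "?r < d" "?r < d1" "?r < d2" using d(1) d1(1) d2(1) by auto
      then show ?s using e[of ?r] d(2) by blast
    next
      assume ?s
      then show "\<exists>\<delta>>0. \<forall>r. 0 < r \<and> r < \<delta> \<longrightarrow> ?q - r *\<^sub>R n \<in> G \<and> ?q + r *\<^sub>R n \<notin> G"
        using e d1(1) d2(1) by (intro exI[of _ "min d1 d2"]) auto
    qed
  qed
  show ?thesis
  proof (cases ?U)
    case True
    then show ?thesis unfolding is_outward_normal_def perp sides[OF True] by (simp add: unit_normal_def)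
  next
    case False
    then show ?thesis unfolding is_outward_normal_def perp unit_normal_def by blast
  qed
qed

text \<open>This product is the form in which the normal enters the boundary integral. With a single
  flag the normal is the unit normal pointing out of the marked half; with both flags it has the
  default value 0, matching \<open>of_bool cm - of_bool cp\<close>.\<close>

lemma outward_normal_area:
  assumes y: "y \<in> B"
  shows "area_element \<phi> y * (outward_normal G (\<phi> y) \<bullet> v)
    = (of_bool cm - of_bool cp) * \<bar>det (flow_matrix \<phi> v (t, y))\<bar>"
proof -
  have yW: "y \<in> W" using y BW by blast
  note D = chartD[OF lp]
  obtain m0 where m0: "unit_normal \<phi> y m0" using unit_normal_exists D(8)[OF yW] by blast
  \<comment> \<open>Normalized to point towards positive flow time, hence out of the half marked by
    \<open>cm\<close>.\<close>
  define m where "m = (if m0 \<bullet> v > 0 then m0 else - m0)"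
  have m: "unit_normal \<phi> y m" using m0 unit_normal_minus by (simp add: m_def)
  have mv: "m \<bullet> v > 0" using normal_transversal(1)[OF y m0] by (auto simp: m_def)
  have det: "\<bar>det (flow_matrix \<phi> v (t,y))\<bar> = (m \<bullet> v) * area_element \<phi> y"
    using det_flow(3)[of \<phi> "(t,y)" m v] D(6,8)[OF yW] m mv by simp
  have iff: "is_outward_normal G (\<phi> y) n \<longleftrightarrow> (cm \<and> \<not> cp \<and> n = m) \<or> (cp \<and> \<not> cm \<and> n = - m)" for n
  proof
    assume "is_outward_normal G (\<phi> y) n"
    then have n: "unit_normal \<phi> y n" "if n \<bullet> v > 0 then cm \<and> \<not> cp else cp \<and> \<not> cm"
      using is_outward_normal_iff[OF y] by auto
    show "(cm \<and> \<not> cp \<and> n = m) \<or> (cp \<and> \<not> cm \<and> n = - m)"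
    proof (cases "n \<bullet> v > 0")
      case True
      then have "n = m" using mv by (intro unit_normal_unique[OF y n(1) m]) simp
      then show ?thesis using n(2) True by simp
    next
      case False
      then have "n \<bullet> v < 0" using normal_transversal(1)[OF y n(1)] by simp
      then have "0 < (n \<bullet> v) * (- m \<bullet> v)" using mv by (simp add: mult_neg_pos)
      then have "n = - m" by (rule unit_normal_unique[OF y n(1) unit_normal_minus[OF m]])
      then show ?thesis using n(2) False by simp
    qed
  next
    assume "(cm \<and> \<not> cp \<and> n = m) \<or> (cp \<and> \<not> cm \<and> n = - m)"
    then show "is_outward_normal G (\<phi> y) n"
      using is_outward_normal_iff[OF y] m unit_normal_minus[OF m] mv by auto
  qed
  consider "cm" "\<not> cp" | "cp" "\<not> cm" | "cm" "cp" using side by blast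
  then show ?thesis
  proof cases
    case 1
    then have "is_outward_normal G (\<phi> y) = (\<lambda>n. n = m)" using iff by (intro ext) blast
    then have "outward_normal G (\<phi> y) = m" by (simp add: outward_normal_def)
    then show ?thesis using det 1 by simp
  next
    case 2
    then have "is_outward_normal G (\<phi> y) = (\<lambda>n. n = - m)" using iff by (intro ext) blast
    then have "outward_normal G (\<phi> y) = - m" by (simp add: outward_normal_def)
    then show ?thesis using det 2 by simp
  next
    case 3
    then have "\<nexists>n. is_outward_normal G (\<phi> y) n" using iff by auto
    then have "outward_normal G (\<phi> y) = 0" by (simp add: outward_normal_def)
    then show ?thesis using 3 by simp
  qed
qed

end

section \<open>The divergence theorem near a boundary point\<close>

text \<open>The regularity class of the divergence theorem: at the boundary it asks for continuity
  of \<open>u\<close> alone, inside for a continuous derivative that is bounded in every fixed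
  direction. The derivative is an explicit argument so that product, quotient and chain rules
  compute it along the way.\<close>

definition C1_bounded :: "quat set \<Rightarrow> (quat \<Rightarrow> 'b::euclidean_space) \<Rightarrow> (quat \<Rightarrow> quat \<Rightarrow> 'b) \<Rightarrow> bool" where
  "C1_bounded G u u' \<longleftrightarrow> continuous_on (closure G) u \<and> (\<forall>x\<in>G. (u has_derivative u' x) (at x)) \<and>
     (\<forall>w. continuous_on G (\<lambda>x. u' x w)) \<and> (\<forall>w. bounded ((\<lambda>x. u' x w) ` G))"

lemma C1_boundedD:
  assumes "C1_bounded G u u'"
  shows "continuous_on (closure G) u" "\<And>x. x \<in> G \<Longrightarrow> (u has_derivative u' x) (at x)"
    "continuous_on G (\<lambda>x. u' x w)" "bounded ((\<lambda>x. u' x w) ` G)"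
  using assms by (simp_all only: C1_bounded_def split_paired_All[symmetric])

lemma derivative_zero_off_support:
  assumes openG: "open G" and u: "C1_bounded G u u'" and K: "compact K" and u0: "\<And>x. x \<in> closure G - K \<Longrightarrow> u x = 0"
    and x: "x \<in> G - K"
  shows "u' x w = 0"
proof -
  have op: "open (G - K)" using openG compact_imp_closed[OF K] by (rule open_Diff)
  have z: "u z = 0" if "z \<in> G - K" for z by (rule u0) (use that closure_subset[of G] in blast)
  have xG: "x \<in> G" using x by blast
  have "((\<lambda>_. 0) has_derivative u' x) (at x)"
    by (rule has_derivative_transform_within_open[OF C1_boundedD(2)[OF u xG] op x z])
  then have "u' x = (\<lambda>_. 0)" by (rule has_derivative_unique[OF _ has_derivative_const])
  then show ?thesis by simp
qed

lemma integrable_continuous_bounded: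
  fixes h :: "'a::euclidean_space \<Rightarrow> 'b::euclidean_space"
  assumes "open A" "bounded A" "continuous_on A h" "bounded (h ` A)"
  shows "integrable lborel (\<lambda>x. indicator A x *\<^sub>R h x)"
proof -
  obtain C where C: "\<And>x. x \<in> A \<Longrightarrow> norm (h x) \<le> C" using assms(4) by (auto simp: bounded_iff)
  have m: "(\<lambda>x. indicator A x *\<^sub>R h x) \<in> borel_measurable lborel"
    using borel_measurable_continuous_on_indicator[OF _ assms(3)] assms(1) by simp
  have "emeasure lborel A < \<infinity>" using assms(2) by (rule emeasure_bounded_finite)
  then show ?thesis using assms(1) C m
    by (intro integrableI_bounded_set[of A lborel _ C]) (auto split: split_indicator)
qed

text \<open>The fundamental theorem is applied on \<open>{c..d}\<close> with \<open>k\<close> merely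
  continuous at the two ends; one of them will correspond to a boundary point of \<open>G\<close>,
  where no derivative is available. On the rest of \<open>{a<..<b}\<close> the integrand is
  0.\<close>

lemma integral_derivative_interval:
  fixes k :: "real \<Rightarrow> 'b::euclidean_space"
  assumes ab: "a \<le> c" "c \<le> d" "d \<le> b" and cont: "continuous_on {c..d} k"
    and der: "\<And>t. t \<in> {c<..<d} \<Longrightarrow> (k has_vector_derivative k' t) (at t)"
    and cont': "continuous_on {a<..<b} k'" and bd: "bounded (k' ` {a<..<b})"
    and zero: "\<And>t. t \<in> {a<..<b} \<Longrightarrow> t \<notin> {c..d} \<Longrightarrow> k' t = 0"
  shows "(LINT t|lborel. indicator {a<..<b} t *\<^sub>R k' t) = k d - k c"
proof -
  let ?f = "\<lambda>t. indicator {a<..<b} t *\<^sub>R k' t"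
  have "(k' has_integral (k d - k c)) {c..d}"
    by (rule fundamental_theorem_of_calculus_interior[OF ab(2) cont der])
  then have "(?f has_integral (k d - k c)) {c..d}"
    by (rule has_integral_spike_finite[rotated 2, of _ _ _ "{c,d}"]) (use ab in \<open>auto simp: indicator_def\<close>)
  then have 1: "(?f has_integral (k d - k c)) UNIV"
    by (rule has_integral_on_superset) (use zero in \<open>auto simp: indicator_def\<close>)
  have "integrable lborel ?f" by (rule integrable_continuous_bounded[OF _ _ cont' bd]) auto
  from has_integral_integral_lborel[OF this] 1 show ?thesis using has_integral_unique by blast
qed

context flow_box
begin

text \<open>The hypothesis \<open>inner\<close> evaluates the integral along one flow line, and
  \<open>s\<close> is the sign with which the value on the surface enters. It differs for the two
  halves of the flow box, so both are covered at once.\<close>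

lemma flow_chart_integral:
  assumes u: "C1_bounded G u u'" and bG: "bounded G"
    and I: "{lo<..<hi} \<subseteq> {-\<epsilon><..<\<epsilon>}" and sub: "flow \<phi> v ` ({lo<..<hi} \<times> B) \<subseteq> G"
    and inner: "\<And>y. y \<in> B \<Longrightarrow> (LINT t|lborel. indicator {lo<..<hi} t *\<^sub>R u' (flow \<phi> v (t,y)) v) = s *\<^sub>R u (\<phi> y)"
  shows "\<exists>I. has_bochner_integral lborel (\<lambda>x. indicator (flow \<phi> v ` ({lo<..<hi} \<times> B)) x *\<^sub>R u' x v) I
     \<and> has_bochner_integral lborel (\<lambda>y. s *\<^sub>R indicator B y *\<^sub>R \<bar>det (flow_matrix \<phi> v (0,y))\<bar> *\<^sub>R u (\<phi> y)) I"
proof -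
  let ?X = "{lo<..<hi} \<times> B" and ?J = "\<lambda>x. \<bar>det (flow_matrix \<phi> v x)\<bar>"
  let ?f = "flow \<phi> v"
  note D = chartD[OF lp]
  have XX: "?X \<subseteq> X" using I by auto
  have XW: "?X \<subseteq> UNIV \<times> W" using BW by auto
  have oX: "open ?X" using openB by (simp add: open_Times)
  have hX: "homeomorphism ?X (?f ` ?X) ?f g"
    by (rule homeomorphism_of_subsets[OF homeo XX]) (use XX homeo in \<open>auto simp: homeomorphism_def\<close>)
  have ofX: "open (?f ` ?X)"
    using homeomorphism_imp_open_map[OF homeo, of ?X] oX XX openN
    by (metis open_openin_trans openin_open_trans open_subset open_Times openB open_greaterThanLessThan)
  have inj: "inj_on ?f ?X"
    by (rule inj_on_inverseI[of _ g]) (rule homeomorphism_apply1[OF hX])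
  have cf: "continuous_on ?X ?f" by (rule continuous_on_flow[OF lp XW])
  have der: "(?f has_derivative flowd \<phi> v x) (at x)" if "x \<in> ?X" for x
    by (rule flow_has_derivative[OF lp]) (use that XW in auto)
  have cJ: "continuous_on ?X ?J"
    unfolding det_def flowd_def
    by (intro continuous_intros continuous_on_compose2[OF D(7)]) (use BW in auto)
  have Jm: "(\<lambda>x. indicator ?X x * ?J x) \<in> borel_measurable borel"
    using borel_measurable_continuous_on_indicator[OF _ cJ] oX by simp
  have dist: "distr (density lborel (\<lambda>x. ennreal (indicator ?X x * ?J x))) borel (\<lambda>x. if x \<in> ?X then ?f x else 0)
    = density lborel (indicator (?f ` ?X))"
    by (rule distr_change_of_variables_quat[OF _ _ der inj Jm]) (use oX ofX in auto)
  have cu: "continuous_on (?f ` ?X) (\<lambda>x. u' x v)" and bu: "bounded ((\<lambda>x. u' x v) ` (?f ` ?X))"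
    by (rule continuous_on_subset[OF C1_boundedD(3)[OF u] sub],
        rule bounded_subset[OF C1_boundedD(4)[OF u] image_mono[OF sub]])
  have bfX: "bounded (?f ` ?X)" using bG sub bounded_subset by blast
  have int1: "integrable lborel (\<lambda>x. indicator (?f ` ?X) x *\<^sub>R u' x v)"
    by (rule integrable_continuous_bounded[OF ofX bfX cu bu])
  define I where "I = (LINT x|lborel. indicator (?f ` ?X) x *\<^sub>R u' x v)"
  have hb1: "has_bochner_integral lborel (\<lambda>x. indicator (?f ` ?X) x *\<^sub>R u' x v) I"
    using int1 by (simp add: I_def has_bochner_integral_integrable)
  have "has_bochner_integral lborel (\<lambda>x. indicator ?X x *\<^sub>R ?J x *\<^sub>R u' (?f x) v) I"
    using has_bochner_integral_change_of_variables[OF _ _ cf Jm _ dist, of "\<lambda>x. u' x v" I] hb1 oX ofX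
      borel_measurable_integrable[OF int1] by simp
  then have hb2: "has_bochner_integral (lborel \<Otimes>\<^sub>M lborel) (\<lambda>(t,y). indicator ?X (t,y) *\<^sub>R ?J (t,y) *\<^sub>R u' (?f (t,y)) v) I"
    by (simp add: lborel_prod case_prod_unfold)
  then have i2: "integrable (lborel \<Otimes>\<^sub>M lborel) (\<lambda>(t,y). indicator ?X (t,y) *\<^sub>R ?J (t,y) *\<^sub>R u' (?f (t,y)) v)"
    and I2: "I = integral\<^sup>L (lborel \<Otimes>\<^sub>M lborel) (\<lambda>(t,y). indicator ?X (t,y) *\<^sub>R ?J (t,y) *\<^sub>R u' (?f (t,y)) v)"
    by (auto simp: has_bochner_integral_iff)
  have inn: "(LINT t|lborel. indicator ?X (t,y) *\<^sub>R ?J (t,y) *\<^sub>R u' (?f (t,y)) v)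
     = s *\<^sub>R indicator B y *\<^sub>R \<bar>det (flow_matrix \<phi> v (0,y))\<bar> *\<^sub>R u (\<phi> y)" for y
  proof (cases "y \<in> B")
    case True
    have J: "?J (t,y) = \<bar>det (flow_matrix \<phi> v (0,y))\<bar>" for t by (simp add: flowd_def)
    have "(LINT t|lborel. indicator ?X (t,y) *\<^sub>R ?J (t,y) *\<^sub>R u' (?f (t,y)) v)
      = (LINT t|lborel. \<bar>det (flow_matrix \<phi> v (0,y))\<bar> *\<^sub>R indicator {lo<..<hi} t *\<^sub>R u' (?f (t,y)) v)"
    proof (rule Bochner_Integration.integral_cong[OF refl])
      fix t
      show "indicator ?X (t,y) *\<^sub>R ?J (t,y) *\<^sub>R u' (?f (t,y)) v
        = \<bar>det (flow_matrix \<phi> v (0,y))\<bar> *\<^sub>R indicator {lo<..<hi} t *\<^sub>R u' (?f (t,y)) v"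
        unfolding J[of t] using True by (auto split: split_indicator)
    qed
    also have "\<dots> = \<bar>det (flow_matrix \<phi> v (0,y))\<bar> *\<^sub>R (s *\<^sub>R u (\<phi> y))"
      unfolding inner[OF True, symmetric] by (rule integral_scaleR_right)
    finally show ?thesis using True by (simp add: mult.commute)
  qed simp
  have "integrable lborel (\<lambda>y. s *\<^sub>R indicator B y *\<^sub>R \<bar>det (flow_matrix \<phi> v (0,y))\<bar> *\<^sub>R u (\<phi> y))"
    using lborel_pair.integrable_snd[OF i2] unfolding inn .
  moreover have "(LINT y|lborel. s *\<^sub>R indicator B y *\<^sub>R \<bar>det (flow_matrix \<phi> v (0,y))\<bar> *\<^sub>R u (\<phi> y)) = I"
    using lborel_pair.integral_snd[OF i2] unfolding inn I2 .
  ultimately show ?thesis using hb1 by (auto simp: has_bochner_integral_iff)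
qed


text \<open>Keeps the support away from the two far ends of the flow box, so that \<open>u\<close>
  vanishes at flow times \<open>e\<close> and \<open>- e\<close> and only the surface
  contributes.\<close>

lemma support_bound:
  assumes K: "compact K" "K \<subseteq> N"
  shows "\<exists>e>0. e < \<epsilon> \<and> (\<forall>x\<in>X. flow \<phi> v x \<in> K \<longrightarrow> \<bar>fst x\<bar> < e)"
proof (cases "K = {}")
  case True then show ?thesis using eps by (intro exI[of _ "\<epsilon>/2"]) auto
next
  case False
  have cg: "continuous_on K (\<lambda>q. \<bar>fst (g q)\<bar>)"
    using homeo K(2) by (intro continuous_intros) (auto simp: homeomorphism_def intro: continuous_on_subset)
  from continuous_attains_sup[OF K(1) False cg] obtain q where
    q: "q \<in> K" "\<And>q'. q' \<in> K \<Longrightarrow> \<bar>fst (g q')\<bar> \<le> \<bar>fst (g q)\<bar>" by blast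
  have "g q \<in> g ` N" using q(1) K(2) by blast
  then have "g q \<in> X" unfolding homeomorphism_image2[OF homeo] .
  then have m: "\<bar>fst (g q)\<bar> < \<epsilon>" by (auto simp: mem_Times_iff)
  \<comment> \<open>The largest modulus of the flow time on the compact set \<open>K\<close> is
    attained and smaller than \<open>\<epsilon>\<close>; the midpoint of the two lies strictly
    between them.\<close>
  have "\<bar>fst x\<bar> < (\<bar>fst (g q)\<bar> + \<epsilon>) / 2" if "x \<in> X" "flow \<phi> v x \<in> K" for x
  proof -
    have "g (flow \<phi> v x) = x" using homeomorphism_apply1[OF homeo that(1)] .
    then show ?thesis using q(2)[OF that(2)] m by auto
  qed
  then show ?thesis using m by (intro exI[of _ "(\<bar>fst (g q)\<bar> + \<epsilon>) / 2"]) auto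
qed

lemma inner_integral:
  assumes u: "C1_bounded G u u'" and K: "compact K" and u0: "\<And>x. x \<in> closure G - K \<Longrightarrow> u x = 0"
    and lohi: "-\<epsilon> \<le> lo" "hi \<le> \<epsilon>" "lo \<le> c" "c \<le> d" "d \<le> hi"
    and sub: "flow \<phi> v ` ({lo<..<hi} \<times> B) \<subseteq> G" and y: "y \<in> B"
    and cl: "\<And>t. t \<in> {c..d} \<Longrightarrow> flow \<phi> v (t,y) \<in> closure G" "-\<epsilon> < c" "d < \<epsilon>"
    and supp: "\<And>t. t \<in> {lo<..<hi} \<Longrightarrow> t \<notin> {c..d} \<Longrightarrow> flow \<phi> v (t,y) \<notin> K"
  shows "(LINT t|lborel. indicator {lo<..<hi} t *\<^sub>R u' (flow \<phi> v (t,y)) v) = u (flow \<phi> v (d,y)) - u (flow \<phi> v (c,y))"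
proof (rule integral_derivative_interval[OF lohi(3-5)])
  have yW: "y \<in> W" using y BW by blast
  have inG: "flow \<phi> v (t,y) \<in> G" if "t \<in> {lo<..<hi}" for t using sub that y by blast
  have cfl: "continuous_on A (\<lambda>t. flow \<phi> v (t,y))" for A
    unfolding flow_def by (auto intro!: continuous_intros)
  show "continuous_on {c..d} (\<lambda>t. u (flow \<phi> v (t,y)))"
    by (rule continuous_on_compose2[OF C1_boundedD(1)[OF u] cfl]) (use cl(1) in blast)
  show "continuous_on {lo<..<hi} (\<lambda>t. u' (flow \<phi> v (t,y)) v)"
    by (rule continuous_on_compose2[OF C1_boundedD(3)[OF u] cfl]) (use inG in blast)
  show "bounded ((\<lambda>t. u' (flow \<phi> v (t,y)) v) ` {lo<..<hi})"
    by (rule bounded_subset[OF C1_boundedD(4)[OF u, of v]]) (use inG in blast)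
  show "u' (flow \<phi> v (t,y)) v = 0" if "t \<in> {lo<..<hi}" "t \<notin> {c..d}" for t
    by (rule derivative_zero_off_support[OF openG u K u0]) (use inG supp that in blast)+
  fix t assume t: "t \<in> {c<..<d}"
  then have "t \<in> {lo<..<hi}" using lohi by auto
  then have 2: "(u has_derivative u' (flow \<phi> v (t,y))) (at (flow \<phi> v (t,y)))" using C1_boundedD(2)[OF u] inG by blast
  have 1: "((\<lambda>t. flow \<phi> v (t,y)) has_derivative (\<lambda>h. h *\<^sub>R v)) (at t)"
    unfolding flow_def by (auto intro!: derivative_eq_intros)
  have "((\<lambda>t. u (flow \<phi> v (t,y))) has_derivative (\<lambda>h. u' (flow \<phi> v (t,y)) (h *\<^sub>R v))) (at t)"
    by (rule has_derivative_compose[OF 1 2])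
  then show "((\<lambda>t. u (flow \<phi> v (t,y))) has_vector_derivative u' (flow \<phi> v (t,y)) v) (at t)"
    unfolding has_vector_derivative_def using has_derivative_linear[OF 2] by (simp add: linear_scale)
qed

end

text \<open>The divergence theorem in one constant direction \<open>w\<close>. The common value
  \<open>I\<close> asserts both the integrability and the equality of the two integrals.\<close>

definition gauss_along :: "quat set \<Rightarrow> quat \<Rightarrow> (quat \<Rightarrow> 'b::euclidean_space) \<Rightarrow> (quat \<Rightarrow> quat \<Rightarrow> 'b) \<Rightarrow> bool" where
  "gauss_along G w u u' \<longleftrightarrow> (\<exists>I. has_bochner_integral lborel (\<lambda>x. indicator G x *\<^sub>R u' x w) I \<and>
     has_bochner_integral (surface_measure (frontier G)) (\<lambda>q. (outward_normal G q \<bullet> w) *\<^sub>R u q) I)"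

context flow_box
begin

lemma gauss_along_transversal:
  assumes S: "compact (frontier G)" "smooth_surface (frontier G)" and bG: "bounded G"
    and u: "C1_bounded G u u'" and K: "compact K" "K \<subseteq> N" and u0: "\<And>x. x \<in> closure G - K \<Longrightarrow> u x = 0"
  shows "gauss_along G v u u'"
proof -
  let ?f = "flow \<phi> v" and ?J = "\<lambda>y. \<bar>det (flow_matrix \<phi> v (0,y))\<bar>"
  let ?Nm = "?f ` ({-\<epsilon><..<0} \<times> B)" and ?Np = "?f ` ({0<..<\<epsilon>} \<times> B)"
  let ?L = "\<lambda>y. indicator B y *\<^sub>R ?J y *\<^sub>R u (\<phi> y)"
  obtain e where e12: "0 < e" "e < \<epsilon>" and e0: "\<forall>x\<in>X. ?f x \<in> K \<longrightarrow> \<bar>fst x\<bar> < e"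
    using support_bound[OF K] by (elim exE conjE)
  have e3: "\<bar>fst x\<bar> < e" if "x \<in> X" "?f x \<in> K" for x
    using e0 that by blast
  note e = e12 e3
  have f0: "?f (0,y) = \<phi> y" for y by (simp add: flow_def)
  have frt: "\<phi> y \<in> frontier G" if "y \<in> B" for y using front[of "(0,y)"] that eps f0 by simp
  have offe: "?f (t,y) \<notin> K" if "y \<in> B" "\<bar>t\<bar> < \<epsilon>" "e \<le> \<bar>t\<bar>" for t y
  proof
    assume k: "?f (t,y) \<in> K"
    have "(t,y) \<in> X" using that(1,2) by (simp add: abs_less_iff)
    from e(3)[OF this k] that(3) show False by simp
  qed
  \<comment> \<open>One end of the segment is the surface, the other lies at flow time
    \<open>- e\<close> or \<open>e\<close>, where \<open>u\<close> vanishes. What remains is the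
    value on the surface, with sign 1 for the negative half and -1 for the positive one.\<close>
  have half: "\<exists>I. has_bochner_integral lborel (\<lambda>x. indicator (?f ` ({lo<..<hi} \<times> B)) x *\<^sub>R u' x v) I \<and>
       has_bochner_integral lborel (\<lambda>y. s *\<^sub>R ?L y) I"
    if sub: "?f ` ({lo<..<hi} \<times> B) \<subseteq> G"
      and ends: "lo = -\<epsilon> \<and> hi = 0 \<and> c = -e \<and> d = 0 \<and> s = 1 \<or> lo = 0 \<and> hi = \<epsilon> \<and> c = 0 \<and> d = e \<and> s = -1"
    for lo hi c d s :: real
  proof (rule flow_chart_integral[OF u bG _ sub])
    show "{lo<..<hi} \<subseteq> {-\<epsilon><..<\<epsilon>}" using ends eps by auto
    fix y assume y: "y \<in> B"
    have cl: "?f (t,y) \<in> closure G" if "t \<in> {c..d}" for t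
    proof (cases "t = 0")
      case True then show ?thesis using frt[OF y] by (simp add: f0 frontier_def)
    next
      case False
      then have "(t,y) \<in> {lo<..<hi} \<times> B" using that ends e y by auto
      then show ?thesis using sub closure_subset by blast
    qed
    have z: "u (?f (r,y)) = 0" if "r \<in> {c..d}" "\<bar>r\<bar> = e" for r
      by (rule u0) (use cl[OF that(1)] offe[OF y, of r] that(2) e in auto)
    have "(LINT t|lborel. indicator {lo<..<hi} t *\<^sub>R u' (?f (t,y)) v) = u (?f (d,y)) - u (?f (c,y))"
      by (rule inner_integral[OF u K(1) u0 _ _ _ _ _ sub y cl]) (use ends e eps offe[OF y] in auto)
    then show "(LINT t|lborel. indicator {lo<..<hi} t *\<^sub>R u' (?f (t,y)) v) = s *\<^sub>R u (\<phi> y)"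
      using ends z[of c] z[of d] e by (auto simp: f0)
  qed
  have minus: "\<exists>I. has_bochner_integral lborel (\<lambda>x. indicator ?Nm x *\<^sub>R u' x v) I \<and>
       has_bochner_integral lborel (\<lambda>y. 1 *\<^sub>R ?L y) I" if cm
    by (rule half[where c = "-e" and d = 0]) (use sidem that in blast, simp)
  have plus: "\<exists>I. has_bochner_integral lborel (\<lambda>x. indicator ?Np x *\<^sub>R u' x v) I \<and>
       has_bochner_integral lborel (\<lambda>y. (-1) *\<^sub>R ?L y) I" if cp
    by (rule half[where c = 0 and d = e]) (use sidep that in blast, simp)
  \<comment> \<open>Integrability over the parameters is read off from whichever half belongs to
    \<open>G\<close>; \<open>side\<close> guarantees one.\<close>
  have intL: "integrable lborel ?L"
  proof (cases cm)
    case True then show ?thesis using minus by (auto simp: has_bochner_integral_iff)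
  next
    case False
    then have cp using side by blast
    then have "integrable lborel (\<lambda>y. - ?L y)" using plus by (auto simp: has_bochner_integral_iff)
    then show ?thesis by simp
  qed
  define I where "I = (LINT y|lborel. ?L y)"
  have hL: "has_bochner_integral lborel ?L I" using intL by (simp add: I_def has_bochner_integral_integrable)
  let ?c = "of_bool cm - of_bool cp :: real"
  have hm: "has_bochner_integral lborel (\<lambda>x. (of_bool cm :: real) *\<^sub>R indicator ?Nm x *\<^sub>R u' x v) ((of_bool cm :: real) *\<^sub>R I)"
  proof (cases cm)
    case True
    then obtain J where J: "has_bochner_integral lborel (\<lambda>x. indicator ?Nm x *\<^sub>R u' x v) J"
       "has_bochner_integral lborel (\<lambda>y. 1 *\<^sub>R ?L y) J" using minus by blast
    have "J = I" using has_bochner_integral_eq[OF hL, of J] J(2) by simp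
    then show ?thesis using J(1) True by simp
  qed (simp add: has_bochner_integral_zero)
  have hp: "has_bochner_integral lborel (\<lambda>x. (of_bool cp :: real) *\<^sub>R indicator ?Np x *\<^sub>R u' x v) ((of_bool cp :: real) *\<^sub>R (- I))"
  proof (cases cp)
    case True
    then obtain J where J: "has_bochner_integral lborel (\<lambda>x. indicator ?Np x *\<^sub>R u' x v) J"
       "has_bochner_integral lborel (\<lambda>y. (-1) *\<^sub>R ?L y) J" using plus by blast
    have "has_bochner_integral lborel (\<lambda>y. - ?L y) (- I)" by (rule has_bochner_integral_minus[OF hL])
    then have "J = - I" using has_bochner_integral_eq[of lborel "\<lambda>y. - ?L y" "- I" J] J(2) by simp
    then show ?thesis using J(1) True by simp
  qed (simp add: has_bochner_integral_zero)
  \<comment> \<open>Up to points where the integrand vanishes, \<open>G\<close> consists of the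
    halves selected by the flags: the middle slice is boundary, hence outside the open set
    \<open>G\<close>.\<close>
  have dec: "indicator G x *\<^sub>R u' x v = (of_bool cm :: real) *\<^sub>R indicator ?Nm x *\<^sub>R u' x v
     + (of_bool cp :: real) *\<^sub>R indicator ?Np x *\<^sub>R u' x v" for x
  proof (cases "x \<in> N")
    case False
    have "x \<notin> ?Nm" "x \<notin> ?Np" using False eps by force+
    moreover have "indicator G x *\<^sub>R u' x v = 0"
      using derivative_zero_off_support[OF openG u K(1) u0, of x v] False K(2) by (auto split: split_indicator)
    ultimately show ?thesis by simp
  next
    case True
    then obtain z where z: "z \<in> X" "x = ?f z" by blast
    have injf: "z = z'" if "z' \<in> X" "?f z = ?f z'" for z'
    proof -
      have "z = g (?f z)" by (rule homeomorphism_apply1[OF homeo z(1), symmetric])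
      also have "\<dots> = g (?f z')" by (rule arg_cong[OF that(2)])
      also have "\<dots> = z'" by (rule homeomorphism_apply1[OF homeo that(1)])
      finally show ?thesis .
    qed
    have im: "x \<in> ?f ` (I \<times> B) \<longleftrightarrow> fst z \<in> I" if I: "I \<subseteq> {-\<epsilon><..<\<epsilon>}" for I
    proof
      assume "x \<in> ?f ` (I \<times> B)"
      then obtain z' where z': "z' \<in> I \<times> B" "x = ?f z'" by blast
      have "z' \<in> X" using z'(1) I by auto
      moreover have "?f z = ?f z'" by (rule trans[OF z(2)[symmetric] z'(2)])
      ultimately have "z = z'" by (rule injf)
      then show "fst z \<in> I" using z'(1) by auto
    next
      assume "fst z \<in> I"
      then show "x \<in> ?f ` (I \<times> B)" unfolding z(2) using z(1) by (intro imageI) (auto simp: mem_Times_iff)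
    qed
    have m: "x \<in> ?Nm \<longleftrightarrow> fst z < 0" and p: "x \<in> ?Np \<longleftrightarrow> fst z > 0"
    proof -
      have I: "{-\<epsilon><..<0} \<subseteq> {-\<epsilon><..<\<epsilon>}" "{0<..<\<epsilon>} \<subseteq> {-\<epsilon><..<\<epsilon>}" using eps by auto
      show "x \<in> ?Nm \<longleftrightarrow> fst z < 0" "x \<in> ?Np \<longleftrightarrow> fst z > 0"
        unfolding im[OF I(1)] im[OF I(2)] using z(1) by (auto simp: mem_Times_iff)
    qed
    consider "fst z < 0" | "fst z = 0" | "fst z > 0" by linarith
    then show ?thesis
    proof cases
      case 1
      then have "z \<in> {-\<epsilon><..<0} \<times> B" using z(1) by (auto simp: mem_Times_iff)
      then have "x \<in> G \<longleftrightarrow> cm" unfolding z(2) by (rule sidem)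
      then show ?thesis using 1 m p by (simp add: indicator_def)
    next
      case 2
      then have "x \<in> frontier G" unfolding z(2) using front[OF z(1)] by simp
      then have "x \<notin> G" using openG by (simp add: frontier_def interior_open)
      then show ?thesis using 2 m p by (simp add: indicator_def)
    next
      case 3
      then have "z \<in> {0<..<\<epsilon>} \<times> B" using z(1) by (auto simp: mem_Times_iff)
      then have "x \<in> G \<longleftrightarrow> cp" unfolding z(2) by (rule sidep)
      then show ?thesis using 3 m p by (simp add: indicator_def)
    qed
  qed
  have vol: "has_bochner_integral lborel (\<lambda>x. indicator G x *\<^sub>R u' x v) (?c *\<^sub>R I)"
    using has_bochner_integral_add[OF hm hp] unfolding dec by (simp add: algebra_simps)
  let ?F = "\<lambda>q. (outward_normal G q \<bullet> v) *\<^sub>R u q"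
  have uB: "u q = 0" if "q \<in> frontier G" "q \<notin> \<phi> ` B" for q
  proof -
    have "q \<notin> K"
    proof
      assume "q \<in> K"
      then obtain z where z: "z \<in> X" "q = ?f z" using K(2) by blast
      then have "fst z = 0" using front[OF z(1)] that(1) by simp
      then have "q = \<phi> (snd z)" using z(2) by (simp add: flow_def)
      then show False using that(2) z(1) by auto
    qed
    then show ?thesis using u0 that(1) by (simp add: frontier_def)
  qed
  \<comment> \<open>The normal is given by a description, so its measurability is not visible
    directly. Its component along \<open>v\<close>, multiplied by \<open>u\<close>, has this
    formula, continuous on \<open>B\<close> and 0 elsewhere in \<open>W\<close>.\<close>
  have FW: "?F (\<phi> y) = (if y \<in> B then (?c * ?J y / area_element \<phi> y) *\<^sub>R u (\<phi> y) else 0)" if y: "y \<in> W" for y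
  proof (cases "y \<in> B")
    case True
    have "area_element \<phi> y \<noteq> 0" using area_element_pos[OF lp y] by simp
    then have "outward_normal G (\<phi> y) \<bullet> v = ?c * ?J y / area_element \<phi> y"
      using outward_normal_area[OF True, of 0] by (simp add: field_simps)
    then show ?thesis using True by simp
  next
    case False
    have "\<phi> y \<notin> \<phi> ` B" using False y BW inj_onD[OF chartD(2)[OF lp]] by blast
    moreover have "\<phi> y \<in> frontier G" using chartD(4)[OF lp] y by blast
    ultimately show ?thesis using uB False by simp
  qed
  have cB: "continuous_on B (\<lambda>y. (?c * ?J y / area_element \<phi> y) *\<^sub>R u (\<phi> y))"
  proof (intro continuous_intros)
    show "continuous_on B (area_element \<phi>)" by (rule continuous_on_subset[OF continuous_on_area_element[OF lp] BW])
    show "\<forall>y\<in>B. area_element \<phi> y \<noteq> 0" using area_element_pos[OF lp] BW by force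
    show "continuous_on B (\<lambda>y. u (\<phi> y))"
      by (rule continuous_on_compose2[OF C1_boundedD(1)[OF u] continuous_on_subset[OF chartD(3)[OF lp] BW]])
         (use frt in \<open>auto simp: frontier_def\<close>)
    show "continuous_on B (\<lambda>y. det (flow_matrix \<phi> v (0,y)))"
      unfolding det_def flowd_def
      by (intro continuous_intros) (simp add: continuous_on_subset[OF chartD(7)[OF lp] BW])
  qed
  have meas: "(\<lambda>y. ?F (\<phi> y)) \<in> borel_measurable (restrict_space lborel W)"
  proof -
    have "(\<lambda>y. if y \<in> B then (?c * ?J y / area_element \<phi> y) *\<^sub>R u (\<phi> y) else 0) \<in> borel_measurable borel"
      using cB openB by (intro borel_measurable_continuous_on_if) auto
    then have "(\<lambda>y. if y \<in> B then (?c * ?J y / area_element \<phi> y) *\<^sub>R u (\<phi> y) else 0) \<in> borel_measurable (restrict_space lborel W)"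
      by (intro measurable_restrict_space1) simp
    also have "?this \<longleftrightarrow> ?thesis"
      by (rule measurable_cong) (simp add: FW space_restrict_space)
    finally show ?thesis .
  qed
  have "has_bochner_integral (surface_measure (frontier G)) ?F (?c *\<^sub>R I)"
  proof (rule surface_integral_chart[OF S lp _ meas])
    show "?F q = 0" if "q \<in> frontier G - \<phi> ` W" for q using uB[of q] that BW by auto
    have "has_bochner_integral lborel (\<lambda>y. ?c *\<^sub>R ?L y) (?c *\<^sub>R I)"
      by (rule has_bochner_integral_scaleR_right) (use hL in simp)
    moreover have "(\<lambda>y. ?c *\<^sub>R ?L y) = (\<lambda>y. indicator W y *\<^sub>R area_element \<phi> y *\<^sub>R ?F (\<phi> y))"
    proof
      fix y show "?c *\<^sub>R ?L y = indicator W y *\<^sub>R area_element \<phi> y *\<^sub>R ?F (\<phi> y)"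
      proof (cases "y \<in> W")
        case True
        have "area_element \<phi> y \<noteq> 0" using area_element_pos[OF lp True] by simp
        then show ?thesis unfolding FW[OF True] using True by (simp split: split_indicator)
      qed (use BW in \<open>auto split: split_indicator\<close>)
    qed
    ultimately show "has_bochner_integral lborel (\<lambda>y. indicator W y *\<^sub>R area_element \<phi> y *\<^sub>R ?F (\<phi> y)) (?c *\<^sub>R I)" by simp
  qed
  then show ?thesis using vol unfolding gauss_along_def by blast
qed

end

lemma gauss_along_diff:
  assumes "gauss_along G v u u'" "gauss_along G w u u'" and der: "\<And>x. x \<in> G \<Longrightarrow> (u has_derivative u' x) (at x)"
  shows "gauss_along G (v - w) u u'"
proof -
  obtain I J where I: "has_bochner_integral lborel (\<lambda>x. indicator G x *\<^sub>R u' x v) I"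
     "has_bochner_integral (surface_measure (frontier G)) (\<lambda>q. (outward_normal G q \<bullet> v) *\<^sub>R u q) I"
    and J: "has_bochner_integral lborel (\<lambda>x. indicator G x *\<^sub>R u' x w) J"
     "has_bochner_integral (surface_measure (frontier G)) (\<lambda>q. (outward_normal G q \<bullet> w) *\<^sub>R u q) J"
    using assms(1,2) unfolding gauss_along_def by (elim exE conjE)
  have lin: "u' x (v - w) = u' x v - u' x w" if "x \<in> G" for x
    using has_derivative_linear[OF der[OF that]] by (simp add: linear_diff)
  have "(\<lambda>x. indicator G x *\<^sub>R u' x v - indicator G x *\<^sub>R u' x w) = (\<lambda>x. indicator G x *\<^sub>R u' x (v - w))"
    using lin by (auto simp: fun_eq_iff split: split_indicator)
  then have "has_bochner_integral lborel (\<lambda>x. indicator G x *\<^sub>R u' x (v - w)) (I - J)"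
    using has_bochner_integral_diff[OF I(1) J(1)] by simp
  moreover have "has_bochner_integral (surface_measure (frontier G)) (\<lambda>q. (outward_normal G q \<bullet> (v - w)) *\<^sub>R u q) (I - J)"
    using has_bochner_integral_diff[OF I(2) J(2)] by (simp add: inner_diff_right scaleR_diff_left)
  ultimately show ?thesis unfolding gauss_along_def by blast
qed

text \<open>The direction \<open>w\<close> is the difference of \<open>w + c *\<^sub>R n\<close> and
  \<open>c *\<^sub>R n\<close>, both transversal. The neighbourhood is fixed before
  \<open>u\<close>, as the partition of unity requires.\<close>

lemma gauss_along_boundary:
  fixes w :: quat
  assumes G: "open G" "bounded G" and S: "compact (frontier G)" "smooth_surface (frontier G)" and p: "p \<in> frontier G"
  shows "\<exists>N. open N \<and> p \<in> N \<and> (\<forall>u u' K. C1_bounded G u u' \<and> compact K \<and> K \<subseteq> N \<and>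
     (\<forall>x \<in> closure G - K. u x = 0) \<longrightarrow> gauss_along G w (u :: quat \<Rightarrow> 'b::euclidean_space) u')"
proof -
  obtain W \<phi> where lp: "local_parametrization (frontier G) W \<phi>" and pW: "p \<in> \<phi> ` W"
    using bspec[OF S(2)[unfolded smooth_surface_def] p] by (elim exE conjE)
  obtain y where y: "y \<in> W" "p = \<phi> y" using pW by blast
  obtain n where n: "unit_normal \<phi> y n" using unit_normal_exists chartD(8)[OF lp y(1)] by blast
  have nn: "n \<bullet> n = 1" using n by (simp add: unit_normal_def norm_eq_1)
  \<comment> \<open>The products of \<open>n\<close> with the two directions are
    \<open>n \<bullet> w + c\<close> and \<open>c\<close>; this choice makes both at least
    1.\<close>
  define c where "c = 1 + \<bar>n \<bullet> w\<bar>"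
  have "n \<bullet> (w + c *\<^sub>R n) \<noteq> 0" "n \<bullet> (c *\<^sub>R n) \<noteq> 0" by (auto simp: inner_add_right nn c_def)
  from flow_box_exists[OF lp G(1) y(1) n this(1)] flow_box_exists[OF lp G(1) y(1) n this(2)]
  obtain \<epsilon>1 B1 g1 cm1 cp1 \<epsilon>2 B2 g2 cm2 cp2 where
    b1: "y \<in> B1" "flow_box G W \<phi> (w + c *\<^sub>R n) \<epsilon>1 B1 g1 cm1 cp1" and
    b2: "y \<in> B2" "flow_box G W \<phi> (c *\<^sub>R n) \<epsilon>2 B2 g2 cm2 cp2" by (elim exE conjE)
  interpret f1: flow_box G W \<phi> "w + c *\<^sub>R n" \<epsilon>1 B1 g1 cm1 cp1 by (rule b1(2))
  interpret f2: flow_box G W \<phi> "c *\<^sub>R n" \<epsilon>2 B2 g2 cm2 cp2 by (rule b2(2))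
  have pN: "p \<in> f1.N" "p \<in> f2.N"
    by (rule image_eqI[of _ _ "(0,y)"]; use f1.eps f2.eps b1(1) b2(1) y(2) in \<open>simp add: flow_def\<close>)+
  show ?thesis
  proof (intro exI[of _ "f1.N \<inter> f2.N"] conjI allI impI; (elim conjE)?)
    show "open (f1.N \<inter> f2.N)" using f1.openN f2.openN by blast
    show "p \<in> f1.N \<inter> f2.N" using pN by blast
    fix u :: "quat \<Rightarrow> 'b" and u' K
    assume u: "C1_bounded G u u'" and K: "compact K" "K \<subseteq> f1.N \<inter> f2.N" and u0: "\<forall>x \<in> closure G - K. u x = 0"
    have "gauss_along G (w + c *\<^sub>R n) u u'"
      by (rule f1.gauss_along_transversal[OF S G(2) u K(1)]) (use K(2) u0 in blast)+
    moreover have "gauss_along G (c *\<^sub>R n) u u'"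
      by (rule f2.gauss_along_transversal[OF S G(2) u K(1)]) (use K(2) u0 in blast)+
    ultimately show "gauss_along G w u u'"
      using gauss_along_diff[of G "w + c *\<^sub>R n" u u' "c *\<^sub>R n"] C1_boundedD(2)[OF u] by simp
  qed
qed

section \<open>The divergence theorem\<close>

lemma integral_translate:
  fixes f :: "'a::euclidean_space \<Rightarrow> 'b::{banach, second_countable_topology}"
  assumes "f \<in> borel_measurable borel"
  shows "(LINT x|lborel. f (x + c)) = (LINT x|lborel. f x)"
proof -
  have "(LINT x|lborel. f x) = (LINT x|distr lborel borel ((+) c). f x)" by (simp only: lborel_distr_plus)
  also have "\<dots> = (LINT x|lborel. f (c + x))" using assms by (subst integral_distr) auto
  finally show ?thesis by (simp add: add.commute)
qed

text \<open>Integrate the derivative at \<open>x + s *\<^sub>R w\<close> over \<open>s\<close> in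
  \<open>{0..1}\<close> and over all \<open>x\<close>. For fixed \<open>s\<close> translation
  invariance gives the wanted integral; for fixed \<open>x\<close> the result is
  \<open>u (x + w) - u x\<close>, whose integral over \<open>x\<close> is 0.\<close>

lemma has_bochner_integral_derivative_compact_support:
  fixes u :: "'a::euclidean_space \<Rightarrow> 'b::euclidean_space"
  assumes der: "\<And>x. (u has_derivative u' x) (at x)" and cont: "continuous_on UNIV (\<lambda>x. u' x w)"
    and K: "compact K" and u0: "\<And>x. x \<notin> K \<Longrightarrow> u x = 0" and u'0: "\<And>x. x \<notin> K \<Longrightarrow> u' x w = 0"
  shows "has_bochner_integral lborel (\<lambda>x. u' x w) 0"
proof -
  let ?f = "\<lambda>x. u' x w"
  have cu: "continuous_on UNIV u" using der has_derivative_continuous continuous_at_imp_continuous_on by blast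
  have int_cs: "integrable lborel h" if "continuous_on UNIV h" "\<And>x. x \<notin> K \<Longrightarrow> h x = 0" for h :: "'a \<Rightarrow> 'b"
  proof -
    have "integrable lborel (\<lambda>x. indicator K x *\<^sub>R h x)"
      by (rule borel_integrable_compact[OF K continuous_on_subset[OF that(1)]]) simp
    also have "(\<lambda>x. indicator K x *\<^sub>R h x) = h" using that(2) by (auto simp: fun_eq_iff split: split_indicator)
    finally show ?thesis .
  qed
  have intf: "integrable lborel ?f" by (rule int_cs[OF cont u'0])
  have intu: "integrable lborel u" by (rule int_cs[OF cu u0])
  obtain R where R: "\<And>x. x \<in> K \<Longrightarrow> norm x \<le> R" using compact_imp_bounded[OF K] unfolding bounded_iff by blast
  \<comment> \<open>Large enough to contain every pair \<open>(s, x)\<close> with \<open>s\<close>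
    in \<open>{0..1}\<close> and \<open>x + s *\<^sub>R w\<close> in \<open>K\<close>, since then
    \<open>x\<close> has norm at most \<open>R + norm w\<close>.\<close>
  let ?C = "{0..1::real} \<times> cball (0::'a) (R + norm w)"
  let ?h = "\<lambda>z::real \<times> 'a. ?f (snd z + fst z *\<^sub>R w)"
  have ch: "continuous_on ?C ?h"
    by (rule continuous_on_compose2[OF cont]) (auto intro!: continuous_intros)
  have cC: "compact ?C" by (intro compact_Times) auto
  have "integrable lborel (\<lambda>z. indicator ?C z *\<^sub>R ?h z)" by (rule borel_integrable_compact[OF cC ch])
  also have "(\<lambda>z. indicator ?C z *\<^sub>R ?h z) = (\<lambda>(s,x). indicator {0..1} s *\<^sub>R ?f (x + s *\<^sub>R w))"
  proof (rule ext)
    fix z :: "real \<times> 'a"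
    obtain s x where z: "z = (s,x)" by (cases z)
    show "indicator ?C z *\<^sub>R ?h z = (case z of (s,x) \<Rightarrow> indicator {0..1} s *\<^sub>R ?f (x + s *\<^sub>R w))"
    proof (cases "s \<in> {0..1} \<and> x + s *\<^sub>R w \<in> K")
      case True
      have "norm x \<le> norm (x + s *\<^sub>R w) + norm (s *\<^sub>R w)" using norm_triangle_ineq4[of "x + s *\<^sub>R w" "s *\<^sub>R w"] by simp
      also have "\<dots> \<le> R + norm w" using R[of "x + s *\<^sub>R w"] True by (intro add_mono) (auto simp: mult_left_le_one_le)
      finally show ?thesis using True z by (simp add: indicator_def)
    next
      case False
      then show ?thesis using z u'0 by (auto simp: indicator_def)
    qed
  qed
  finally have I: "integrable (lborel \<Otimes>\<^sub>M lborel) (\<lambda>(s,x). indicator {0..1} s *\<^sub>R ?f (x + s *\<^sub>R w))"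
    by (simp add: lborel_prod)
  have inner1: "(LINT x|lborel. indicator {0..1::real} s *\<^sub>R ?f (x + s *\<^sub>R w)) = indicator {0..1} s *\<^sub>R (LINT x|lborel. ?f x)" for s
    using integral_translate[of ?f "s *\<^sub>R w"] borel_measurable_integrable[OF intf] by simp
  have inner2: "(LINT s|lborel. indicator {0..1::real} s *\<^sub>R ?f (x + s *\<^sub>R w)) = u (x + w) - u x" for x
  proof -
    have "(LINT s|lborel. indicator {0..1} s *\<^sub>R ?f (x + s *\<^sub>R w)) = u (x + 1 *\<^sub>R w) - u (x + 0 *\<^sub>R w)"
    proof (rule integral_FTC_Icc)
      show "continuous_on {0..1} (\<lambda>s. ?f (x + s *\<^sub>R w))"
        by (rule continuous_on_compose2[OF cont]) (auto intro!: continuous_intros)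
      fix s :: real
      have 1: "((\<lambda>s. x + s *\<^sub>R w) has_derivative (\<lambda>h. h *\<^sub>R w)) (at s within {0..1})"
        by (auto intro!: derivative_eq_intros)
      have "((\<lambda>s. u (x + s *\<^sub>R w)) has_derivative (\<lambda>h. u' (x + s *\<^sub>R w) (h *\<^sub>R w))) (at s within {0..1})"
        by (rule has_derivative_compose[OF 1 der])
      then show "((\<lambda>s. u (x + s *\<^sub>R w)) has_vector_derivative ?f (x + s *\<^sub>R w)) (at s within {0..1})"
        unfolding has_vector_derivative_def using has_derivative_linear[OF der] by (simp add: linear_scale)
    qed simp
    then show ?thesis by simp
  qed
  have "(LINT s|lborel. indicator {0..1::real} s *\<^sub>R (LINT x|lborel. ?f x)) = (LINT x|lborel. u (x + w) - u x)"
    using lborel_pair.Fubini_integral[OF I] unfolding inner1 inner2 by simp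
  also have "(LINT s|lborel. indicator {0..1::real} s *\<^sub>R (LINT x|lborel. ?f x)) = (LINT x|lborel. ?f x)" by simp
  also have "(LINT x|lborel. u (x + w) - u x) = 0"
  proof -
    have "integrable lborel (\<lambda>x. u (x + w))"
    proof -
      have "integrable (distr lborel borel ((+) w)) u" using intu by (simp only: lborel_distr_plus)
      then have "integrable lborel (\<lambda>x. u (w + x))"
        using borel_measurable_integrable[OF intu] by (subst (asm) integrable_distr_eq) auto
      then show ?thesis by (simp add: add.commute)
    qed
    then show ?thesis using intu integral_translate[of u w] borel_measurable_integrable[OF intu]
      by (simp add: Bochner_Integration.integral_diff)
  qed
  finally show ?thesis using intf by (simp add: has_bochner_integral_iff)
qed

lemma space_surface_measure:
  assumes "compact S" "smooth_surface S" shows "space (surface_measure S) = S"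
  using sets_eq_imp_space_eq[of "surface_measure S" "restrict_space borel S"] surface_measure_satisfies_spec[OF assms]
  by (simp add: surface_measure_spec_def space_restrict_space)

text \<open>Extended by 0, \<open>u\<close> is differentiable with continuous derivative along
  \<open>w\<close> on the whole space, because \<open>G\<close> and the complement of
  \<open>K\<close> are open and cover it. So the volume integral is 0, and so is the boundary
  integral, as \<open>u\<close> is 0 on the boundary.\<close>

lemma gauss_along_interior:
  assumes openG: "open G" and S: "compact (frontier G)" "smooth_surface (frontier G)"
    and u: "C1_bounded G u u'" and K: "compact K" "K \<subseteq> G" and u0: "\<And>x. x \<in> closure G - K \<Longrightarrow> u x = 0"
  shows "gauss_along G w u u'"
proof -
  let ?u = "\<lambda>x. if x \<in> G then u x else 0" and ?u' = "\<lambda>x h. if x \<in> G then u' x h else 0"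
  have oK: "open (- K)" using compact_imp_closed[OF K(1)] by (simp add: open_Compl)
  have uK: "?u x = 0" if "x \<notin> K" for x
    using u0[of x] that closure_subset[of G] by (cases "x \<in> G") (simp_all add: subsetD)
  have u'K: "?u' x h = 0" if "x \<notin> K" for x h
    using derivative_zero_off_support[OF openG u K(1) u0, of x h] that by simp
  have der: "(?u has_derivative ?u' x) (at x)" for x
  proof (cases "x \<in> G")
    case True
    have "(?u has_derivative u' x) (at x)"
      by (rule has_derivative_transform_within_open[OF C1_boundedD(2)[OF u True] openG True]) simp
    then show ?thesis using True by simp
  next
    case False
    then have x: "x \<in> - K" using K(2) by blast
    have "(?u has_derivative (\<lambda>_. 0)) (at x)"
    proof (rule has_derivative_transform_within_open[OF has_derivative_const oK x])
      show "0 = ?u z" if "z \<in> - K" for z using uK[of z] that by (metis ComplD)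
    qed
    then show ?thesis using False by simp
  qed
  have "continuous_on (G \<union> - K) (\<lambda>x. ?u' x w)"
  proof (rule continuous_on_open_Un[OF openG oK])
    show "continuous_on G (\<lambda>x. ?u' x w)"
      by (rule continuous_on_eq[OF C1_boundedD(3)[OF u, of w]]) simp
    show "continuous_on (- K) (\<lambda>x. ?u' x w)"
      by (rule continuous_on_eq[OF continuous_on_const[of _ 0]]) (metis ComplD u'K)
  qed
  moreover have "G \<union> - K = UNIV" using K(2) by blast
  ultimately have cont: "continuous_on UNIV (\<lambda>x. ?u' x w)" by simp
  have "has_bochner_integral lborel (\<lambda>x. ?u' x w) 0"
    by (rule has_bochner_integral_derivative_compact_support[OF der cont K(1) uK u'K])
  also have "(\<lambda>x. ?u' x w) = (\<lambda>x. indicator G x *\<^sub>R u' x w)" by (intro ext) simp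
  finally have vol: "has_bochner_integral lborel (\<lambda>x. indicator G x *\<^sub>R u' x w) 0" .
  have "has_bochner_integral (surface_measure (frontier G)) (\<lambda>q. (outward_normal G q \<bullet> w) *\<^sub>R u q) 0
    \<longleftrightarrow> has_bochner_integral (surface_measure (frontier G)) (\<lambda>q. 0) (0::'a)"
  proof (rule has_bochner_integral_cong[OF refl _ refl])
    fix q assume "q \<in> space (surface_measure (frontier G))"
    then have "q \<in> frontier G" by (simp only: space_surface_measure[OF S])
    then have "q \<in> closure G" "q \<notin> G" using openG by (simp_all add: frontier_def interior_open)
    then have "q \<in> closure G - K" using K(2) by blast
    then show "(outward_normal G q \<bullet> w) *\<^sub>R u q = 0" using u0 by simp
  qed
  then show ?thesis using vol has_bochner_integral_zero unfolding gauss_along_def by blast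
qed

section \<open>Calculus rules for functions with bounded derivatives\<close>

lemma bounded_bilinear_image:
  fixes bil :: "'a::real_normed_vector \<Rightarrow> 'b::real_normed_vector \<Rightarrow> 'c::real_normed_vector"
  assumes bb: "bounded_bilinear bil" and "bounded (f ` G)" "bounded (k ` G)"
  shows "bounded ((\<lambda>x. bil (f x) (k x)) ` G)"
proof -
  obtain A B where A: "\<And>x. x \<in> G \<Longrightarrow> norm (f x) \<le> A" and B: "\<And>x. x \<in> G \<Longrightarrow> norm (k x) \<le> B"
    using assms(2,3) unfolding bounded_iff by fastforce
  obtain C where C: "0 < C" "\<And>a b. norm (bil a b) \<le> norm a * norm b * C"
    using bounded_bilinear.pos_bounded[OF bb] by blast
  have "norm (bil (f x) (k x)) \<le> A * B * C" if x: "x \<in> G" for x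
  proof -
    have "norm (f x) * norm (k x) \<le> A * B"
      by (rule mult_mono[OF A[OF x] B[OF x] order_trans[OF norm_ge_zero A[OF x]] norm_ge_zero])
    then have "norm (f x) * norm (k x) * C \<le> A * B * C" using C(1) by simp
    then show ?thesis by (rule order_trans[OF C(2)])
  qed
  then show ?thesis unfolding bounded_iff by blast
qed

lemma bounded_sum_image:
  fixes f :: "'i \<Rightarrow> 'a \<Rightarrow> 'b::real_normed_vector"
  assumes "\<And>i. i \<in> I \<Longrightarrow> bounded (f i ` G)"
  shows "bounded ((\<lambda>x. \<Sum>i\<in>I. f i x) ` G)"
  using assms
proof (induction I rule: infinite_finite_induct)
  case (insert i I)
  have "bounded ((\<lambda>x. f i x + (\<Sum>i\<in>I. f i x)) ` G)"
    by (rule bounded_plus_comp) (use insert in auto)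
  then show ?case using insert by simp
qed (cases "G = {}"; simp add: image_constant_conv)+

text \<open>One product rule serves scalar, inner and quaternionic products; the factors are bounded
  because they are continuous on the compact closure.\<close>

lemma C1_bounded_bilinear:
  fixes prod :: "'a::euclidean_space \<Rightarrow> 'b::euclidean_space \<Rightarrow> 'c::euclidean_space"
  assumes bb: "bounded_bilinear prod" and bG: "bounded G" and h: "C1_bounded G \<eta> \<eta>'" and u: "C1_bounded G u u'"
  shows "C1_bounded G (\<lambda>x. prod (\<eta> x) (u x)) (\<lambda>x w. prod (\<eta> x) (u' x w) + prod (\<eta>' x w) (u x))"
proof -
  note H = C1_boundedD[OF h] and U = C1_boundedD[OF u] and cont = bounded_bilinear.continuous_on[OF bb]
  have cG: "compact (closure G)" using bG by simp
  have bd: "bounded (f ` G)" if "continuous_on (closure G) f" for f :: "quat \<Rightarrow> 'd::euclidean_space"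
    using compact_imp_bounded[OF compact_continuous_image[OF that cG]] closure_subset[of G]
    by (meson bounded_subset image_mono)
  note prod = bounded_bilinear_image[OF bb]
  have cu: "continuous_on G u" "continuous_on G \<eta>" using U(1) H(1) closure_subset continuous_on_subset by blast+
  show ?thesis unfolding C1_bounded_def
  proof (intro conjI allI ballI)
    show "continuous_on (closure G) (\<lambda>x. prod (\<eta> x) (u x))" by (rule cont[OF H(1) U(1)])
    show "((\<lambda>x. prod (\<eta> x) (u x)) has_derivative (\<lambda>w. prod (\<eta> x) (u' x w) + prod (\<eta>' x w) (u x))) (at x)" if "x \<in> G" for x
      by (rule bounded_bilinear.FDERIV[OF bb H(2)[OF that] U(2)[OF that]])
    fix w
    show "continuous_on G (\<lambda>x. prod (\<eta> x) (u' x w) + prod (\<eta>' x w) (u x))"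
      by (rule continuous_on_add[OF cont[OF cu(2) U(3)] cont[OF H(3) cu(1)]])
    have "bounded ((\<lambda>x. prod (\<eta> x) (u' x w)) ` G)" "bounded ((\<lambda>x. prod (\<eta>' x w) (u x)) ` G)"
      by (intro prod bd H(1) U(4), intro prod bd H(4) U(1))
    then show "bounded ((\<lambda>x. prod (\<eta> x) (u' x w) + prod (\<eta>' x w) (u x)) ` G)" by (rule bounded_plus_comp)
  qed
qed

lemmas C1_bounded_scaleR = C1_bounded_bilinear[OF bounded_bilinear_scaleR]

lemma C1_bounded_inverse:
  fixes s :: "quat \<Rightarrow> real"
  assumes bG: "bounded G" and s: "C1_bounded G s s'" and pos: "\<And>x. x \<in> closure G \<Longrightarrow> 0 < s x"
  shows "C1_bounded G (\<lambda>x. inverse (s x)) (\<lambda>x w. (- (inverse (s x) * inverse (s x))) * s' x w)"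
proof -
  note D = C1_boundedD[OF s]
  have nz: "s x \<noteq> 0" if "x \<in> closure G" for x using pos[OF that] by simp
  have nzG: "s x \<noteq> 0" if "x \<in> G" for x using nz that closure_subset[of G] by blast
  have cG: "compact (closure G)" using bG by simp
  have ci: "continuous_on (closure G) (\<lambda>x. inverse (s x))" by (intro continuous_intros D(1) ballI nz)
  have ci2: "continuous_on (closure G) (\<lambda>x. - (inverse (s x) * inverse (s x)))" by (intro continuous_intros ci)
  have bi: "bounded ((\<lambda>x. - (inverse (s x) * inverse (s x))) ` G)"
    by (rule bounded_subset[OF compact_imp_bounded[OF compact_continuous_image[OF ci2 cG]] image_mono[OF closure_subset]])
  show ?thesis unfolding C1_bounded_def
  proof (intro conjI allI ballI)
    show "continuous_on (closure G) (\<lambda>x. inverse (s x))" by (rule ci)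
    show "((\<lambda>x. inverse (s x)) has_derivative (\<lambda>w. (- (inverse (s x) * inverse (s x))) * s' x w)) (at x)" if "x \<in> G" for x
      by (rule has_derivative_eq_rhs[OF Deriv.has_derivative_inverse[OF nzG[OF that] D(2)[OF that]]]) (simp add: fun_eq_iff)
    fix w
    show "continuous_on G (\<lambda>x. - (inverse (s x) * inverse (s x)) * s' x w)"
      by (rule continuous_on_mult[OF continuous_on_subset[OF ci2 closure_subset] D(3)])
    show "bounded ((\<lambda>x. - (inverse (s x) * inverse (s x)) * s' x w) ` G)"
      by (rule bounded_bilinear_image[OF bounded_bilinear_mult bi D(4)])
  qed
qed

lemma C1_bounded_sum:
  assumes "\<And>i. i \<in> I \<Longrightarrow> C1_bounded G (u i) (u' i)"
  shows "C1_bounded G (\<lambda>x. \<Sum>i\<in>I. u i x) (\<lambda>x w. \<Sum>i\<in>I. u' i x w)"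
proof -
  note D = C1_boundedD[OF assms]
  show ?thesis unfolding C1_bounded_def
    by (intro conjI allI ballI) (auto intro!: continuous_intros has_derivative_sum bounded_sum_image D)
qed

section \<open>Partition of unity and the global theorem\<close>

text \<open>Squaring removes the corner of \<open>max 0 t\<close> at 0, since there the difference
  quotient has modulus at most \<open>\<bar>h\<bar>\<close>.\<close>

lemma has_real_derivative_max0_squared: "((\<lambda>t::real. (max 0 t)\<^sup>2) has_real_derivative 2 * max 0 t) (at t)"
proof -
  consider "t < 0" | "t = 0" | "t > 0" by linarith
  then show ?thesis
  proof cases
    case 1
    have "((\<lambda>t::real. 0) has_real_derivative 2 * max 0 t) (at t)" using 1 by (simp add: max_def)
    then show ?thesis
      by (rule has_field_derivative_transform_within_open[where S="{..<0}"]) (use 1 in auto)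
  next
    case 3
    have "((\<lambda>t::real. t\<^sup>2) has_real_derivative 2 * max 0 t) (at t)" using 3 by (auto intro!: derivative_eq_intros)
    then show ?thesis
      by (rule has_field_derivative_transform_within_open[where S="{0<..}"]) (use 3 in auto)
  next
    case 2
    have "((\<lambda>h::real. ((max 0 (0 + h))\<^sup>2 - (max 0 0)\<^sup>2) / h) \<longlongrightarrow> 0) (at 0)"
    proof (rule Lim_null_comparison)
      show "\<forall>\<^sub>F h::real in at 0. norm (((max 0 (0 + h))\<^sup>2 - (max 0 0)\<^sup>2) / h) \<le> \<bar>h\<bar>"
        by (rule always_eventually) (auto simp: max_def power2_eq_square)
      show "((\<lambda>h::real. \<bar>h\<bar>) \<longlongrightarrow> 0) (at 0)" by (intro tendsto_eq_intros) auto
    qed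
    then show ?thesis using 2 by (simp add: DERIV_def)
  qed
qed

text \<open>A C^1 hump over the ball of radius \<open>r\<close> around \<open>p\<close>: positive
  inside, 0 outside, with an explicit derivative. It is not normalized; the division by a finite sum
  of humps comes in \<open>gauss_along_C1\<close>.\<close>

definition bump :: "real \<Rightarrow> quat \<Rightarrow> quat \<Rightarrow> real" where
  "bump r p x = (max 0 (r\<^sup>2 - (x - p) \<bullet> (x - p)))\<^sup>2"

definition bump' :: "real \<Rightarrow> quat \<Rightarrow> quat \<Rightarrow> quat \<Rightarrow> real" where
  "bump' r p x h = 2 * max 0 (r\<^sup>2 - (x - p) \<bullet> (x - p)) * (- 2 * ((x - p) \<bullet> h))"

lemma bump_nonneg: "0 \<le> bump r p x" by (simp add: bump_def)

lemma bump_pos: "0 < r \<Longrightarrow> x \<in> ball p r \<Longrightarrow> 0 < bump r p x"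
  by (simp add: bump_def dist_norm norm_minus_commute power2_norm_eq_inner[symmetric] power_strict_mono)

lemma bump_zero: "0 < r \<Longrightarrow> x \<notin> cball p r \<Longrightarrow> bump r p x = 0"
  by (simp add: bump_def dist_norm norm_minus_commute power2_norm_eq_inner[symmetric] power_mono)

lemma C1_bounded_bump:
  assumes bG: "bounded G" shows "C1_bounded G (bump r p) (bump' r p)"
proof -
  have c: "continuous_on A (bump r p)" for A unfolding bump_def by (intro continuous_intros)
  have c': "continuous_on A (\<lambda>x. bump' r p x w)" for A w unfolding bump'_def by (intro continuous_intros)
  have der: "(bump r p has_derivative bump' r p x) (at x)" for x
  proof -
    have 1: "((\<lambda>x. r\<^sup>2 - (x - p) \<bullet> (x - p)) has_derivative (\<lambda>h. - 2 * ((x - p) \<bullet> h))) (at x)"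
      by (auto intro!: derivative_eq_intros simp: inner_commute)
    have 2: "((\<lambda>t::real. (max 0 t)\<^sup>2) has_derivative (*) (2 * max 0 (r\<^sup>2 - (x - p) \<bullet> (x - p)))) (at (r\<^sup>2 - (x - p) \<bullet> (x - p)))"
      using has_real_derivative_max0_squared by (simp add: has_field_derivative_def)
    have "((\<lambda>x. (max 0 (r\<^sup>2 - (x - p) \<bullet> (x - p)))\<^sup>2) has_derivative
       (\<lambda>h. 2 * max 0 (r\<^sup>2 - (x - p) \<bullet> (x - p)) * (- 2 * ((x - p) \<bullet> h)))) (at x)"
      by (rule has_derivative_compose[OF 1 2])
    then show ?thesis unfolding bump_def[abs_def] bump'_def[abs_def] .
  qed
  have "bounded ((\<lambda>x. bump' r p x w) ` G)" for w
    using compact_imp_bounded[OF compact_continuous_image[OF c'[of "closure G" w]]] bG closure_subset[of G]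
    by (meson bounded_subset image_mono compact_closure)
  then show ?thesis unfolding C1_bounded_def using c c' der by (intro conjI allI ballI)
qed

lemma gauss_along_sum:
  fixes u :: "'i \<Rightarrow> quat \<Rightarrow> 'b::euclidean_space"
  assumes "\<And>i. i \<in> I \<Longrightarrow> gauss_along G w (u i) (u' i)"
  shows "gauss_along G w (\<lambda>x. \<Sum>i\<in>I. u i x) (\<lambda>x h. \<Sum>i\<in>I. u' i x h)"
proof -
  from assms have "\<forall>i\<in>I. \<exists>J. has_bochner_integral lborel (\<lambda>x. indicator G x *\<^sub>R u' i x w) J \<and>
     has_bochner_integral (surface_measure (frontier G)) (\<lambda>q. (outward_normal G q \<bullet> w) *\<^sub>R u i q) J"
    unfolding gauss_along_def by blast
  from bchoice[OF this] obtain J where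
    J: "\<forall>i\<in>I. has_bochner_integral lborel (\<lambda>x. indicator G x *\<^sub>R u' i x w) (J i) \<and>
     has_bochner_integral (surface_measure (frontier G)) (\<lambda>q. (outward_normal G q \<bullet> w) *\<^sub>R u i q) (J i)"
    by (elim exE)
  have "has_bochner_integral lborel (\<lambda>x. \<Sum>i\<in>I. indicator G x *\<^sub>R u' i x w) (\<Sum>i\<in>I. J i)"
    by (rule has_bochner_integral_sum) (use J in blast)
  moreover have "has_bochner_integral (surface_measure (frontier G)) (\<lambda>q. \<Sum>i\<in>I. (outward_normal G q \<bullet> w) *\<^sub>R u i q) (\<Sum>i\<in>I. J i)"
    by (rule has_bochner_integral_sum) (use J in blast)
  ultimately show ?thesis unfolding gauss_along_def scaleR_sum_right by blast
qed

lemma gauss_along_cong: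
  assumes S: "compact (frontier G)" "smooth_surface (frontier G)"
    and g: "gauss_along G w v v'" and uv: "\<And>x. x \<in> closure G \<Longrightarrow> u x = v x" and uv': "\<And>x. x \<in> G \<Longrightarrow> u' x w = v' x w"
  shows "gauss_along G w u u'"
proof -
  obtain I where I: "has_bochner_integral lborel (\<lambda>x. indicator G x *\<^sub>R v' x w) I"
     "has_bochner_integral (surface_measure (frontier G)) (\<lambda>q. (outward_normal G q \<bullet> w) *\<^sub>R v q) I"
    using g unfolding gauss_along_def by (elim exE conjE)
  have 1: "(\<lambda>x. indicator G x *\<^sub>R v' x w) = (\<lambda>x. indicator G x *\<^sub>R u' x w)"
  proof
    fix x show "indicator G x *\<^sub>R v' x w = indicator G x *\<^sub>R u' x w"
      by (cases "x \<in> G") (simp_all add: uv')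
  qed
  have "has_bochner_integral (surface_measure (frontier G)) (\<lambda>q. (outward_normal G q \<bullet> w) *\<^sub>R u q) I
    \<longleftrightarrow> has_bochner_integral (surface_measure (frontier G)) (\<lambda>q. (outward_normal G q \<bullet> w) *\<^sub>R v q) I"
  proof (rule has_bochner_integral_cong[OF refl _ refl])
    fix q assume "q \<in> space (surface_measure (frontier G))"
    then have "q \<in> frontier G" by (simp only: space_surface_measure[OF S])
    then have "u q = v q" by (intro uv) (simp add: frontier_def)
    then show "(outward_normal G q \<bullet> w) *\<^sub>R u q = (outward_normal G q \<bullet> w) *\<^sub>R v q" by simp
  qed
  then show ?thesis using I unfolding 1 gauss_along_def by blast
qed

theorem gauss_along_C1:
  fixes u :: "quat \<Rightarrow> 'b::euclidean_space"
  assumes G: "open G" "bounded G" and S: "compact (frontier G)" "smooth_surface (frontier G)" and u: "C1_bounded G u u'"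
  shows "gauss_along G w u u'"
proof -
  \<comment> \<open>Locality is phrased for all functions supported in \<open>N\<close> at once, so
    that it applies to each product with a bump function.\<close>
  define P where "P N \<longleftrightarrow> (\<forall>u u' K. C1_bounded G u u' \<and> compact K \<and> K \<subseteq> N \<and>
     (\<forall>x \<in> closure G - K. u x = 0) \<longrightarrow> gauss_along G w (u :: quat \<Rightarrow> 'b) u')" for N
  have PD: "gauss_along G w k k'" if "P N" "C1_bounded G k k'" "compact K" "K \<subseteq> N" "\<And>x. x \<in> closure G - K \<Longrightarrow> k x = 0"
    for N K and k :: "quat \<Rightarrow> 'b" and k' using that unfolding P_def by blast
  have "\<forall>p\<in>closure G. \<exists>r>0. \<exists>N. cball p r \<subseteq> N \<and> P N"
  proof
    fix p assume p: "p \<in> closure G"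
    have "\<exists>N. open N \<and> p \<in> N \<and> P N"
    proof (cases "p \<in> G")
      case True
      have "P G" unfolding P_def
      proof (intro allI impI; elim conjE)
        fix k :: "quat \<Rightarrow> 'b" and k' K
        assume *: "C1_bounded G k k'" "compact K" "K \<subseteq> G" "\<forall>x\<in>closure G - K. k x = 0"
        show "gauss_along G w k k'" by (rule gauss_along_interior[OF G(1) S *(1,2,3)]) (rule bspec[OF *(4)])
      qed
      then show ?thesis using G(1) True by blast
    next
      case False
      then have "p \<in> frontier G" using p by (simp add: frontier_def interior_open[OF G(1)])
      from gauss_along_boundary[OF G S this, of w] show ?thesis unfolding P_def .
    qed
    then obtain N where N: "open N" "p \<in> N" "P N" by (elim exE conjE)
    from N(1,2) obtain r where "0 < r" "cball p r \<subseteq> N" using open_contains_cball by blast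
    then show "\<exists>r>0. \<exists>N. cball p r \<subseteq> N \<and> P N" using N(3) by blast
  qed
  from bchoice[OF this] obtain r where r: "\<forall>p\<in>closure G. 0 < r p \<and> (\<exists>N. cball p (r p) \<subseteq> N \<and> P N)" by (elim exE)
  have rpos: "0 < r p" if "p \<in> closure G" for p using bspec[OF r that] by (rule conjunct1)
  have cG: "compact (closure G)" using G(2) by simp
  have cover: "closure G \<subseteq> (\<Union>p\<in>closure G. ball p (r p))" using rpos by force
  obtain C where C: "C \<subseteq> closure G" "finite C" "closure G \<subseteq> (\<Union>p\<in>C. ball p (r p))"
    by (rule compactE_image[OF cG _ cover]) auto
  \<comment> \<open>On the closure of \<open>G\<close> this sum is positive because the balls cover
    it. The pieces are the bump functions times \<open>u\<close> divided by \<open>s\<close>, and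
    there they add up to \<open>u\<close>.\<close>
  define s where "s x = (\<Sum>p\<in>C. bump (r p) p x)" for x
  define s' where "s' x h = (\<Sum>p\<in>C. bump' (r p) p x h)" for x h
  have s: "C1_bounded G s s'" unfolding s_def[abs_def] s'_def[abs_def]
    by (rule C1_bounded_sum[OF C1_bounded_bump[OF G(2)]])
  have spos: "0 < s x" if x: "x \<in> closure G" for x
  proof -
    obtain p where p: "p \<in> C" "x \<in> ball p (r p)" using C(3) x by blast
    have rp: "0 < r p" using rpos p(1) C(1) by blast
    show ?thesis unfolding s_def
      by (rule sum_pos2[OF C(2) p(1)]) (simp_all add: bump_pos[OF rp p(2)] bump_nonneg)
  qed
  note q = C1_bounded_scaleR[OF G(2) C1_bounded_inverse[OF G(2) s spos] u]
  obtain k' where k': "C1_bounded G (\<lambda>x. inverse (s x) *\<^sub>R u x) k'" using q by blast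
  let ?k = "\<lambda>x. inverse (s x) *\<^sub>R u x"
  let ?v = "\<lambda>p x. bump (r p) p x *\<^sub>R ?k x"
  let ?v' = "\<lambda>p x h. bump (r p) p x *\<^sub>R k' x h + bump' (r p) p x h *\<^sub>R ?k x"
  have v: "C1_bounded G (?v p) (?v' p)" for p by (rule C1_bounded_scaleR[OF G(2) C1_bounded_bump[OF G(2)] k'])
  have gv: "gauss_along G w (?v p) (?v' p)" if "p \<in> C" for p
  proof -
    have pc: "p \<in> closure G" using that C(1) by blast
    obtain N where N: "cball p (r p) \<subseteq> N" "P N" using bspec[OF r pc] by (elim conjE exE)
    show ?thesis
      by (rule PD[OF N(2) v _ N(1)]) (simp_all add: bump_zero[OF rpos[OF pc]])
  qed
  let ?V = "\<lambda>x. \<Sum>p\<in>C. ?v p x" and ?V' = "\<lambda>x h. \<Sum>p\<in>C. ?v' p x h"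
  have gV: "gauss_along G w ?V ?V'" by (rule gauss_along_sum[OF gv])
  have V: "C1_bounded G ?V ?V'" by (rule C1_bounded_sum[OF v])
  have uV: "u x = ?V x" if "x \<in> closure G" for x
  proof -
    have "?V x = s x *\<^sub>R ?k x" unfolding s_def[of x] by (rule scaleR_sum_left[symmetric])
    then show ?thesis using spos[OF that] by simp
  qed
  \<comment> \<open>The sum carries the derivative computed by the product rules. On the open set
    \<open>G\<close> it agrees with the given \<open>u'\<close> because derivatives are
    unique.\<close>
  have uV': "u' x w = ?V' x w" if x: "x \<in> G" for x
  proof -
    have eq: "u z = ?V z" if "z \<in> G" for z by (rule uV) (use that closure_subset in blast)
    have "(?V has_derivative u' x) (at x)"
      by (rule has_derivative_transform_within_open[OF C1_boundedD(2)[OF u x] G(1) x eq])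
    then have "u' x = ?V' x" by (rule has_derivative_unique[OF _ C1_boundedD(2)[OF V x]])
    then show ?thesis by (rule fun_cong)
  qed
  show ?thesis by (rule gauss_along_cong[where v = ?V and v' = ?V', OF S gV]) (rule uV uV'; assumption)+
qed

section \<open>The form \<open>\<nu>\<close>\<close>

lemma C1_bounded_linear:
  assumes "bounded_linear L" "bounded G" shows "C1_bounded G L (\<lambda>x h. L h)"
  unfolding C1_bounded_def
  by (intro conjI allI ballI)
     (auto intro: linear_continuous_on assms bounded_linear_imp_has_derivative simp: bounded_iff)

lemma C1_bounded_const: "C1_bounded G (\<lambda>x. c) (\<lambda>x h. 0)"
  unfolding C1_bounded_def by (intro conjI allI ballI) (auto simp: bounded_iff)

text \<open>The coefficient of the k-th 3-form in \<nu>. The quotient is written with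
  \<open>inverse\<close> so that the rules for \<open>C1_bounded\<close> apply to it.\<close>

definition nu_component :: "3 option \<Rightarrow> quat \<Rightarrow> quat" where
  "nu_component k y = (case k of None \<Rightarrow> (2, 0)
     | Some i \<Rightarrow> (2 * (snd y $ i * inverse (snd y \<bullet> snd y))) *\<^sub>R imq (snd y))"

definition nu_component' :: "3 option \<Rightarrow> quat \<Rightarrow> quat \<Rightarrow> quat" where
  "nu_component' k y h = (case k of None \<Rightarrow> 0
     | Some i \<Rightarrow> (2 * (snd y $ i * inverse (snd y \<bullet> snd y))) *\<^sub>R imq (snd h)
        + (2 * (snd h $ i * inverse (snd y \<bullet> snd y)
             - snd y $ i * (inverse (snd y \<bullet> snd y) * inverse (snd y \<bullet> snd y)) * (2 * (snd y \<bullet> snd h)))) *\<^sub>R imq (snd y))"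

lemma nu_density_eq: "nu_density G y = (\<Sum>k\<in>UNIV. (outward_normal G y \<bullet> qunit k) *\<^sub>R nu_component k y)"
proof -
  define n where "n = outward_normal G y"
  have "(\<Sum>i\<in>UNIV. (n \<bullet> qunit (Some i)) *\<^sub>R nu_component (Some i) y)
     = (\<Sum>i\<in>UNIV. (2 * (snd y $ i * snd n $ i) / (norm (snd y))\<^sup>2) *\<^sub>R imq (snd y))"
    by (rule sum.cong[OF refl]) (simp add: nu_component_def inner_qunit power2_norm_eq_inner divide_inverse mult_ac)
  also have "\<dots> = (2 * (\<Sum>i\<in>UNIV. snd y $ i * snd n $ i) / (norm (snd y))\<^sup>2) *\<^sub>R imq (snd y)"
    by (simp add: scaleR_sum_left[symmetric] sum_divide_distrib[symmetric] sum_distrib_left)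
  finally show ?thesis
    unfolding nu_density_def n_def[symmetric] sum_option_3 Let_def
    by (simp add: nu_component_def inner_qunit mult.commute)
qed

lemma bounded_linear_imq: "bounded_linear imq"
  by (rule bounded_linear_intro[of _ 1]) (simp_all add: imq_def norm_prod_def)

lemma C1_bounded_nu_component:
  assumes bG: "bounded G" and nz: "closure G \<inter> {x. snd x = 0} = {}"
  shows "C1_bounded G (nu_component k) (nu_component' k)"
proof (cases k)
  case None
  then show ?thesis using C1_bounded_const[of G "(2,0)"] by (simp add: nu_component_def[abs_def] nu_component'_def[abs_def])
next
  case (Some i)
  have 1: "C1_bounded G (\<lambda>y::quat. snd y $ i) (\<lambda>y h. snd h $ i)"
    by (rule C1_bounded_linear[OF _ bG]) (intro bounded_linear_compose[OF bounded_linear_vec_nth bounded_linear_snd])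
  have 2: "C1_bounded G (\<lambda>y::quat. snd y) (\<lambda>y h. snd h)"
    by (rule C1_bounded_linear[OF bounded_linear_snd bG])
  have 3: "C1_bounded G (\<lambda>y::quat. snd y \<bullet> snd y) (\<lambda>y h. snd y \<bullet> snd h + snd h \<bullet> snd y)"
    by (rule C1_bounded_bilinear[OF bounded_bilinear_inner bG 2 2])
  have pos: "0 < snd y \<bullet> snd y" if "y \<in> closure G" for y using nz that by auto
  note 4 = C1_bounded_inverse[OF bG 3 pos]
  note 5 = C1_bounded_bilinear[OF bounded_bilinear_mult bG 1 4]
  note 6 = C1_bounded_bilinear[OF bounded_bilinear_mult bG C1_bounded_const[of G "2::real"] 5]
  have 7: "C1_bounded G (\<lambda>y::quat. imq (snd y)) (\<lambda>y h. imq (snd h))"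
    by (rule C1_bounded_linear[OF _ bG]) (rule bounded_linear_compose[OF bounded_linear_imq bounded_linear_snd])
  note 8 = C1_bounded_scaleR[OF bG 6 7]
  have "nu_component k = (\<lambda>y. (2 * (snd y $ i * inverse (snd y \<bullet> snd y))) *\<^sub>R imq (snd y))"
    by (simp add: Some nu_component_def fun_eq_iff)
  moreover have "nu_component' k = (\<lambda>y h. (2 * (snd y $ i * inverse (snd y \<bullet> snd y))) *\<^sub>R imq (snd h)
    + (2 * (snd y $ i * (- (inverse (snd y \<bullet> snd y) * inverse (snd y \<bullet> snd y)) * (snd y \<bullet> snd h + snd h \<bullet> snd y))
       + snd h $ i * inverse (snd y \<bullet> snd y)) + 0 * (snd y $ i * inverse (snd y \<bullet> snd y))) *\<^sub>R imq (snd y))"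
    by (simp add: Some nu_component'_def fun_eq_iff inner_commute algebra_simps)
  ultimately show ?thesis using 8 by simp
qed

lemma sum_nu_component_derivative:
  assumes "snd y \<noteq> 0"
  shows "(\<Sum>k\<in>UNIV. nu_component' k y (qunit k)) = (4 / (norm (snd y))\<^sup>2) *\<^sub>R imq (snd y)"
proof -
  define v where "v = snd y"
  define c where "c = inverse (v \<bullet> v)"
  have vv: "v \<bullet> v \<noteq> 0" using assms by (simp add: v_def)
  have "(\<Sum>k\<in>UNIV. nu_component' k y (qunit k)) = (\<Sum>i\<in>UNIV. (2 * (v $ i * c)) *\<^sub>R imq (axis i 1)
      + (2 * (c - v $ i * (c * c) * (2 * v $ i))) *\<^sub>R imq v)"
    unfolding sum_option_3 by (simp add: nu_component'_def qunit_simps inner_axis v_def c_def)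
  also have "\<dots> = (2 * c) *\<^sub>R imq (\<Sum>i\<in>UNIV. v $ i *\<^sub>R axis i 1) + (\<Sum>i\<in>UNIV. 2 * (c - v $ i * (c * c) * (2 * v $ i))) *\<^sub>R imq v"
    using bounded_linear.linear[OF bounded_linear_imq]
    by (simp add: sum.distrib linear_sum linear_scale scaleR_sum_right scaleR_sum_left mult_ac)
  also have "(\<Sum>i\<in>UNIV. v $ i *\<^sub>R axis i 1) = v" by (simp add: basis_expansion scalar_mult_eq_scaleR[symmetric])
  \<comment> \<open>Here 6 is twice the dimension 3, and 4 comes from differentiating the inverse
    square of the norm. Differentiating the factor \<open>imq v\<close> has already given
    \<open>2 * c\<close>, so the total is \<open>4 * c\<close>.\<close>
  also have "(\<Sum>i\<in>UNIV. 2 * (c - v $ i * (c * c) * (2 * v $ i))) = 6 * c - 4 * ((c * c) * (v \<bullet> v))"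
    by (simp add: sum_3 inner_vec_def algebra_simps)
  also have "6 * c - 4 * ((c * c) * (v \<bullet> v)) = 2 * c" using vv by (simp add: c_def)
  also have "(2 * c) *\<^sub>R imq v + (2 * c) *\<^sub>R imq v = (4 / (norm (snd y))\<^sup>2) *\<^sub>R imq (snd y)"
    by (simp add: v_def c_def power2_norm_eq_inner divide_inverse scaleR_add_left[symmetric])
  finally show ?thesis .
qed

text \<open>\<open>F2\<close> is the bracket of the theorem for the identity map: there u_i is the
  coordinate y_i, and the sum of y_i times the i-th partial derivative is the derivative in
  direction \<open>(0, snd y)\<close>.\<close>

lemma has_bochner_integral_qmult_gauss:
  fixes \<phi> \<psi> :: "quat \<Rightarrow> quat"
  assumes G: "open G" "bounded G" and S: "compact (frontier G)" "smooth_surface (frontier G)"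
    and nz: "closure G \<inter> {x. snd x = 0} = {}"
    and p: "C1_bounded G \<phi> \<phi>'" and q: "C1_bounded G \<psi> \<psi>'"
  defines "F1 \<equiv> \<lambda>y. \<phi> y *\<^sub>H ((1 / (norm (snd y))\<^sup>2) *\<^sub>R imq (snd y)) *\<^sub>H \<psi> y"
    and "F2 \<equiv> \<lambda>y. (1 / (norm (snd y))\<^sup>2) *\<^sub>R
        ((\<phi>' y (1,0) *\<^sub>H imq (snd y) - \<phi>' y (0, snd y)) *\<^sub>H imq (snd y) *\<^sub>H \<psi> y
         + \<phi> y *\<^sub>H imq (snd y) *\<^sub>H (imq (snd y) *\<^sub>H \<psi>' y (1,0) - \<psi>' y (0, snd y)))"
  shows "\<exists>J1 J2. has_bochner_integral lborel (\<lambda>y. indicator G y *\<^sub>R F1 y) J1 \<and>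
     has_bochner_integral lborel (\<lambda>y. indicator G y *\<^sub>R F2 y) J2 \<and>
     nu_integral G \<phi> \<psi> = 4 *\<^sub>R J1 - 2 *\<^sub>R J2"
proof -
  let ?u = "\<lambda>k y. \<phi> y *\<^sub>H nu_component k y *\<^sub>H \<psi> y"
  let ?u' = "\<lambda>k y h. \<phi> y *\<^sub>H nu_component k y *\<^sub>H \<psi>' y h
     + (\<phi> y *\<^sub>H nu_component' k y h + \<phi>' y h *\<^sub>H nu_component k y) *\<^sub>H \<psi> y"
  have bb: "bounded_bilinear (*\<^sub>H)" by (rule qmult.bounded_bilinear_axioms)
  have C: "C1_bounded G (?u k) (?u' k)" for k
    by (rule C1_bounded_bilinear[OF bb G(2) C1_bounded_bilinear[OF bb G(2) p C1_bounded_nu_component[OF G(2) nz]] q])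
  have "\<forall>k. \<exists>I. has_bochner_integral lborel (\<lambda>y. indicator G y *\<^sub>R ?u' k y (qunit k)) I \<and>
     has_bochner_integral (surface_measure (frontier G)) (\<lambda>y. (outward_normal G y \<bullet> qunit k) *\<^sub>R ?u k y) I"
    using gauss_along_C1[OF G S C] unfolding gauss_along_def by blast
  from choice[OF this] obtain I where I:
    "\<forall>k. has_bochner_integral lborel (\<lambda>y. indicator G y *\<^sub>R ?u' k y (qunit k)) (I k) \<and>
     has_bochner_integral (surface_measure (frontier G)) (\<lambda>y. (outward_normal G y \<bullet> qunit k) *\<^sub>R ?u k y) (I k)"
    by (elim exE)
  let ?I = "\<Sum>k\<in>UNIV. I k"
  have hb1: "has_bochner_integral lborel (\<lambda>y. \<Sum>k\<in>UNIV. indicator G y *\<^sub>R ?u' k y (qunit k)) ?I"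
    by (rule has_bochner_integral_sum) (rule conjunct1[OF spec[OF I]])
  have hb2: "has_bochner_integral (surface_measure (frontier G)) (\<lambda>y. \<Sum>k\<in>UNIV. (outward_normal G y \<bullet> qunit k) *\<^sub>R ?u k y) ?I"
    by (rule has_bochner_integral_sum) (rule conjunct2[OF spec[OF I]])
  have "(\<Sum>k\<in>UNIV. (outward_normal G y \<bullet> qunit k) *\<^sub>R ?u k y) = \<phi> y *\<^sub>H nu_density G y *\<^sub>H \<psi> y" for y
    unfolding nu_density_eq by (simp add: qmult.sum_right qmult.sum_left qmult.scaleR_left qmult.scaleR_right)
  then have nu: "nu_integral G \<phi> \<psi> = ?I"
    using has_bochner_integral_integral_eq[OF hb2] unfolding nu_integral_def by simp
  have div: "(\<Sum>k\<in>UNIV. indicator G y *\<^sub>R ?u' k y (qunit k)) = indicator G y *\<^sub>R (4 *\<^sub>R F1 y - 2 *\<^sub>R F2 y)" for y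
  proof (cases "y \<in> G")
    case True
    define v where "v = snd y"
    define c where "c = 1 / (norm v)\<^sup>2"
    define e where "e = imq v"
    have v0: "v \<noteq> 0" using nz True closure_subset[of G] by (auto simp: v_def)
    \<comment> \<open>The square of \<open>e\<close> is real and negative, so where \<open>e\<close>
      occurs twice in \<open>F2\<close> it cancels the division by the squared norm up to sign;
      these are the terms with the derivative along \<open>(1,0)\<close>.\<close>
    have ee: "e *\<^sub>H (e *\<^sub>H r) = - ((norm v)\<^sup>2 *\<^sub>R r)" for r
    proof -
      have "e *\<^sub>H (e *\<^sub>H r) = (- (norm v)\<^sup>2, 0) *\<^sub>H r" by (simp add: e_def qmult_assoc[symmetric] imq_mult_self)
      then show ?thesis by (cases r) (simp add: qmult_def)
    qed
    have cn: "c * (norm v)\<^sup>2 = 1" using v0 by (simp add: c_def)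
    have N: "nu_component (Some i) y = (2 * c * v $ i) *\<^sub>R e" for i
      by (simp add: nu_component_def v_def c_def e_def power2_norm_eq_inner divide_inverse mult_ac)
    have N0: "nu_component None y *\<^sub>H r = 2 *\<^sub>R r" "r *\<^sub>H nu_component None y = 2 *\<^sub>R r" for r
      by (cases r; simp add: nu_component_def qmult_def)+
    have lin: "linear (\<psi>' y)" "linear (\<phi>' y)"
      using C1_boundedD(2)[OF p True] C1_boundedD(2)[OF q True] has_derivative_linear by blast+
    have s0: "(0, v) = (\<Sum>i\<in>UNIV. v $ i *\<^sub>R qunit (Some i))"
      by (simp add: sum_3 qunit_simps vec_eq_iff forall_3 axis_def)
    have sv: "L (0, v) = (\<Sum>i\<in>UNIV. v $ i *\<^sub>R L (qunit (Some i)))" if "linear L" for L :: "quat \<Rightarrow> quat"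
      unfolding s0 by (simp only: linear_sum[OF that] linear_scale[OF that])
    have A: "(\<Sum>k\<in>UNIV. \<phi> y *\<^sub>H nu_component k y *\<^sub>H \<psi>' y (qunit k))
       = 2 *\<^sub>R (\<phi> y *\<^sub>H \<psi>' y (1,0)) + (2 * c) *\<^sub>R (\<phi> y *\<^sub>H e *\<^sub>H \<psi>' y (0, v))"
      unfolding sum_option_3 N N0 sv[OF lin(1)]
      by (simp add: qunit_simps(1) qmult.sum_right qmult.scaleR_left qmult.scaleR_right scaleR_sum_right mult_ac)
    have B: "(\<Sum>k\<in>UNIV. \<phi> y *\<^sub>H nu_component' k y (qunit k) *\<^sub>H \<psi> y) = (4 * c) *\<^sub>R (\<phi> y *\<^sub>H e *\<^sub>H \<psi> y)"
    proof -
      have "(\<Sum>k\<in>UNIV. \<phi> y *\<^sub>H nu_component' k y (qunit k) *\<^sub>H \<psi> y)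
        = \<phi> y *\<^sub>H (\<Sum>k\<in>UNIV. nu_component' k y (qunit k)) *\<^sub>H \<psi> y"
        by (simp add: qmult.sum_right qmult.sum_left)
      also have "(\<Sum>k\<in>UNIV. nu_component' k y (qunit k)) = (4 * c) *\<^sub>R e"
        using sum_nu_component_derivative[of y] v0 by (simp add: v_def c_def e_def)
      finally show ?thesis by (simp add: qmult.scaleR_left qmult.scaleR_right)
    qed
    have D: "(\<Sum>k\<in>UNIV. \<phi>' y (qunit k) *\<^sub>H nu_component k y *\<^sub>H \<psi> y)
       = 2 *\<^sub>R (\<phi>' y (1,0) *\<^sub>H \<psi> y) + (2 * c) *\<^sub>R (\<phi>' y (0, v) *\<^sub>H e *\<^sub>H \<psi> y)"
      unfolding sum_option_3 N N0 sv[OF lin(2)]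
      by (simp add: qunit_simps(1) qmult.sum_left qmult.scaleR_left qmult.scaleR_right scaleR_sum_right mult_ac)
    have "(\<Sum>k\<in>UNIV. ?u' k y (qunit k)) = (\<Sum>k\<in>UNIV. \<phi> y *\<^sub>H nu_component k y *\<^sub>H \<psi>' y (qunit k))
      + ((\<Sum>k\<in>UNIV. \<phi> y *\<^sub>H nu_component' k y (qunit k) *\<^sub>H \<psi> y)
      + (\<Sum>k\<in>UNIV. \<phi>' y (qunit k) *\<^sub>H nu_component k y *\<^sub>H \<psi> y))"
      by (simp only: sum.distrib qmult.add_left)
    also have "\<dots> = 4 *\<^sub>R F1 y - 2 *\<^sub>R F2 y"
    proof -
      have f1: "F1 y = c *\<^sub>R (\<phi> y *\<^sub>H e *\<^sub>H \<psi> y)"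
        unfolding F1_def v_def[symmetric] c_def[symmetric] e_def[symmetric]
        by (simp add: qmult.scaleR_left qmult.scaleR_right)
      have f2: "F2 y = - (\<phi>' y (1,0) *\<^sub>H \<psi> y) - c *\<^sub>R (\<phi>' y (0, v) *\<^sub>H e *\<^sub>H \<psi> y)
         + (- (\<phi> y *\<^sub>H \<psi>' y (1,0)) - c *\<^sub>R (\<phi> y *\<^sub>H e *\<^sub>H \<psi>' y (0, v)))"
        unfolding F2_def v_def[symmetric] c_def[symmetric] e_def[symmetric]
        by (simp add: qmult.diff_left qmult.diff_right qmult_assoc ee qmult.scaleR_right qmult.minus_right
            scaleR_diff_right scaleR_add_right scaleR_minus_right cn)
      show ?thesis unfolding A B D f1 f2 by (simp add: algebra_simps)
    qed
    finally have "(\<Sum>k\<in>UNIV. ?u' k y (qunit k)) = 4 *\<^sub>R F1 y - 2 *\<^sub>R F2 y" .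
    then show ?thesis using True by (simp add: scaleR_sum_right[symmetric])
  qed simp
  have hb3: "has_bochner_integral lborel (\<lambda>y. indicator G y *\<^sub>R (4 *\<^sub>R F1 y - 2 *\<^sub>R F2 y)) ?I"
    using hb1 unfolding div .
  have nn: "(norm (snd y))\<^sup>2 \<noteq> 0" if "y \<in> closure G" for y using nz that by auto
  have c1: "continuous_on (closure G) F1"
    unfolding F1_def
    by (intro qmult.continuous_on continuous_intros C1_boundedD(1)[OF p] C1_boundedD(1)[OF q] ballI nn
       bounded_linear.continuous_on[OF bounded_linear_imq])
  have int1: "integrable lborel (\<lambda>y. indicator G y *\<^sub>R F1 y)"
  proof (rule integrable_continuous_bounded[OF G])
    show "continuous_on G F1" by (rule continuous_on_subset[OF c1 closure_subset])
    have "bounded (F1 ` closure G)" using G(2) by (intro compact_imp_bounded compact_continuous_image c1) simp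
    then show "bounded (F1 ` G)" by (rule bounded_subset) (rule image_mono[OF closure_subset])
  qed
  define J1 where "J1 = (LINT y|lborel. indicator G y *\<^sub>R F1 y)"
  have h1: "has_bochner_integral lborel (\<lambda>y. indicator G y *\<^sub>R F1 y) J1"
    using int1 by (simp add: J1_def has_bochner_integral_integrable)
  \<comment> \<open>\<open>F1\<close> is continuous on the compact closure, hence integrable over
    \<open>G\<close>. Integrability of \<open>F2\<close> is then obtained by solving the divergence
    identity for it.\<close>
  have "has_bochner_integral lborel (\<lambda>y. (1/2) *\<^sub>R (4 *\<^sub>R (indicator G y *\<^sub>R F1 y) - indicator G y *\<^sub>R (4 *\<^sub>R F1 y - 2 *\<^sub>R F2 y)))
     ((1/2) *\<^sub>R (4 *\<^sub>R J1 - ?I))"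
    by (intro has_bochner_integral_scaleR_right has_bochner_integral_diff h1 hb3)
  also have "(\<lambda>y. (1/2) *\<^sub>R (4 *\<^sub>R (indicator G y *\<^sub>R F1 y) - indicator G y *\<^sub>R (4 *\<^sub>R F1 y - 2 *\<^sub>R F2 y)))
     = (\<lambda>y. indicator G y *\<^sub>R F2 y)" by (intro ext) (simp add: algebra_simps)
  finally have h2: "has_bochner_integral lborel (\<lambda>y. indicator G y *\<^sub>R F2 y) ((1/2) *\<^sub>R (4 *\<^sub>R J1 - ?I))" .
  have "nu_integral G \<phi> \<psi> = 4 *\<^sub>R J1 - 2 *\<^sub>R ((1/2) *\<^sub>R (4 *\<^sub>R J1 - ?I))" unfolding nu by simp
  then show ?thesis using h1 h2 by blast
qed

section \<open>Change of variables by a diffeomorphism\<close>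

text \<open>The partial derivatives extend continuously to a compact set, hence are bounded, and the
  derivative in any direction is a fixed linear combination of them.\<close>

lemma C1_closure_imp_C1_bounded:
  assumes "open \<Omega>" "bounded \<Omega>" and f: "C1_closure \<Omega> f"
  shows "C1_bounded \<Omega> f (\<lambda>x. frechet_derivative f (at x))"
proof -
  let ?f' = "\<lambda>x. frechet_derivative f (at x)"
  have cf: "continuous_on (closure \<Omega>) f" and df: "f differentiable_on \<Omega>"
    and ex: "\<forall>k. \<exists>h. continuous_on (closure \<Omega>) h \<and> (\<forall>x\<in>\<Omega>. h x = qpartial k f x)"
    using f unfolding C1_closure_def by blast+
  have der: "(f has_derivative ?f' x) (at x)" if "x \<in> \<Omega>" for x
    using df assms(1) that by (metis differentiable_on_eq_differentiable_at frechet_derivative_works)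
  have cC: "compact (closure \<Omega>)" using assms(2) by simp
  from choice[OF ex] obtain h where
    h: "\<forall>k. continuous_on (closure \<Omega>) (h k) \<and> (\<forall>x\<in>\<Omega>. h k x = qpartial k f x)" by (elim exE)
  have hc: "continuous_on (closure \<Omega>) (\<lambda>x. \<Sum>k\<in>UNIV. (w \<bullet> qunit k) *\<^sub>R h k x)" for w
    using h by (intro continuous_intros) blast
  have eq: "(\<Sum>k\<in>UNIV. (w \<bullet> qunit k) *\<^sub>R h k x) = ?f' x w" if x: "x \<in> \<Omega>" for x w
  proof -
    have lin: "linear (?f' x)" using has_derivative_linear[OF der[OF x]] .
    have w: "w = (\<Sum>k\<in>UNIV. (w \<bullet> qunit k) *\<^sub>R qunit k)"
      by (subst euclidean_representation[of w, symmetric]) (simp add: Basis_quat sum.reindex[OF inj_qunit])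
    have "?f' x w = (\<Sum>k\<in>UNIV. (w \<bullet> qunit k) *\<^sub>R ?f' x (qunit k))"
      by (subst w) (simp only: linear_sum[OF lin] linear_scale[OF lin])
    then show ?thesis using h x by (simp add: qpartial_def)
  qed
  show ?thesis unfolding C1_bounded_def
  proof (intro conjI allI ballI cf der)
    fix w
    show "continuous_on \<Omega> (\<lambda>x. ?f' x w)"
      by (rule continuous_on_eq[OF continuous_on_subset[OF hc closure_subset] eq])
    have "bounded ((\<lambda>x. \<Sum>k\<in>UNIV. (w \<bullet> qunit k) *\<^sub>R h k x) ` closure \<Omega>)"
      by (rule compact_imp_bounded[OF compact_continuous_image[OF hc cC]])
    then show "bounded ((\<lambda>x. ?f' x w) ` \<Omega>)"
      by (rule bounded_subset) (use eq[of _ w] closure_subset in \<open>force simp: image_iff\<close>)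
  qed
qed

lemma C1_bounded_compose:
  fixes f :: "quat \<Rightarrow> 'b::euclidean_space"
  assumes bG: "bounded G" and f: "C1_bounded \<Omega> f f'" and b: "C1_bounded G b b'"
    and sub: "b ` G \<subseteq> \<Omega>" and subc: "b ` closure G \<subseteq> closure \<Omega>"
  shows "C1_bounded G (\<lambda>y. f (b y)) (\<lambda>y h. f' (b y) (b' y h))"
proof -
  note F = C1_boundedD[OF f] and Bb = C1_boundedD[OF b]
  have cb: "continuous_on G b" by (rule continuous_on_subset[OF Bb(1) closure_subset])
  \<comment> \<open>\<open>C1_bounded\<close> controls the derivative of \<open>f\<close> in fixed
    directions, while \<open>b' y h\<close> moves with \<open>y\<close>; expanding it in the basis
    separates the two.\<close>
  have rep: "f' (b y) (b' y h) = (\<Sum>i\<in>Basis. (b' y h \<bullet> i) *\<^sub>R f' (b y) i)" if y: "y \<in> G" for y h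
  proof -
    have lin: "linear (f' (b y))" using has_derivative_linear[OF F(2)] sub y by blast
    show ?thesis
      by (subst euclidean_representation[of "b' y h", symmetric]) (simp only: linear_sum[OF lin] linear_scale[OF lin])
  qed
  have ci: "continuous_on G (\<lambda>y. f' (b y) i)" for i
    by (rule continuous_on_compose2[OF F(3) cb sub])
  have bi: "bounded ((\<lambda>y. f' (b y) i) ` G)" for i
    by (rule bounded_subset[OF F(4)[of i]]) (use sub in blast)
  have bin: "bounded ((\<lambda>y. b' y h \<bullet> i) ` G)" for h i
    using bounded_linear_image[OF Bb(4)[of h] bounded_linear_inner_left[of i]] by (simp add: image_image)
  have sums: "bounded ((\<lambda>y. \<Sum>i\<in>Basis. (b' y h \<bullet> i) *\<^sub>R f' (b y) i) ` G)" for h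
    by (rule bounded_sum_image[OF bounded_bilinear_image[OF bounded_bilinear_scaleR bin bi]])
  show ?thesis unfolding C1_bounded_def
  proof (intro conjI allI ballI)
    show "continuous_on (closure G) (\<lambda>y. f (b y))" by (rule continuous_on_compose2[OF F(1) Bb(1) subc])
    show "((\<lambda>y. f (b y)) has_derivative (\<lambda>h. f' (b y) (b' y h))) (at y)" if "y \<in> G" for y
      by (rule has_derivative_compose[OF Bb(2)[OF that] F(2)]) (use sub that in blast)
    fix h
    have "continuous_on G (\<lambda>y. \<Sum>i\<in>Basis. (b' y h \<bullet> i) *\<^sub>R f' (b y) i)"
      by (intro continuous_intros ci Bb(3))
    then show "continuous_on G (\<lambda>y. f' (b y) (b' y h))" by (rule continuous_on_eq) (rule rep[symmetric])
    have "(\<lambda>y. f' (b y) (b' y h)) ` G = (\<lambda>y. \<Sum>i\<in>Basis. (b' y h \<bullet> i) *\<^sub>R f' (b y) i) ` G"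
      by (rule image_cong[OF refl rep])
    then show "bounded ((\<lambda>y. f' (b y) (b' y h)) ` G)" using sums[of h] by simp
  qed
qed

lemma amap_has_derivative:
  assumes "(\<alpha> has_derivative \<alpha>') (at (snd x))"
  shows "(amap \<alpha> has_derivative (\<lambda>h. (fst h, \<alpha>' (snd h)))) (at x)"
proof -
  have "((\<lambda>x. \<alpha> (snd x)) has_derivative (\<lambda>h. \<alpha>' (snd h))) (at x)"
    by (rule has_derivative_compose[where f=snd, OF _ assms]) (auto intro!: derivative_eq_intros)
  then show ?thesis unfolding amap_def[abs_def]
    by (intro has_derivative_Pair) (auto intro!: derivative_eq_intros)
qed

text \<open>Outside a large ball there is no boundary point, and that exterior is connected, so it
  lies entirely in \<open>G\<close> or misses it. It contains real quaternions, which
  \<open>G\<close> does not.\<close>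

lemma bounded_of_compact_frontier:
  fixes G :: "quat set"
  assumes c: "compact (frontier G)" and nz: "G \<inter> {x. snd x = 0} = {}"
  shows "bounded G"
proof -
  obtain R where R: "\<And>x. x \<in> frontier G \<Longrightarrow> norm x \<le> R" using compact_imp_bounded[OF c] unfolding bounded_iff by blast
  have conn: "connected (- cball (0::quat) R)"
    by (rule connected_complement_bounded_convex) simp_all
  have "- cball 0 R \<inter> frontier G = {}"
  proof (rule equals0I)
    fix z assume "z \<in> - cball 0 R \<inter> frontier G"
    then show False using R[of z] by simp
  qed
  from connected_frontier_disjoint[OF conn this] obtain b where b: "\<forall>x\<in>- cball 0 R. x \<in> G \<longleftrightarrow> b" by (elim exE)
  have "(\<bar>R\<bar> + 1, 0) \<in> - cball (0::quat) R" by (simp add: norm_prod_def)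
  moreover have "(\<bar>R\<bar> + 1, 0) \<notin> G" using nz by force
  ultimately have "\<not> b" using b by blast
  then have "G \<subseteq> cball 0 R" using b by blast
  then show ?thesis using bounded_subset bounded_cball by blast
qed

theorem proposition3p24:
  fixes U V :: "(real^3) set" and s t :: ereal
    and \<alpha> :: "real^3 \<Rightarrow> real^3"
    and \<Omega> :: "quat set" and f g :: "quat \<Rightarrow> quat"
  assumes "region U" and "region V" and "s < t"
    and "C1_diffeo U V \<alpha>"
    and "region \<Omega>" and "\<Omega> \<subseteq> einterval s t \<times> U"
    and "closure (amap \<alpha> ` \<Omega>) \<subseteq> einterval s t \<times> V"
    and "compact (frontier \<Omega>)" and "smooth_surface (frontier \<Omega>)"
    and "compact (frontier (amap \<alpha> ` \<Omega>))" and "smooth_surface (frontier (amap \<alpha> ` \<Omega>))"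
    and "closure (amap \<alpha> ` \<Omega>) \<inter> {x. snd x = 0} = {}"
    and "C1_closure \<Omega> f" and "C1_closure \<Omega> g"
  shows "transported_nu_integral (einterval s t \<times> U) \<alpha> \<Omega> g f =
    4 *\<^sub>R (LINT x:\<Omega>|lborel. M_jac \<alpha> x *\<^sub>R
            (g x *\<^sub>H ((1 / (norm (\<alpha> (snd x)))\<^sup>2) *\<^sub>R imq (\<alpha> (snd x))) *\<^sub>H f x))
    - 2 *\<^sub>R (LINT x:\<Omega>|lborel. (M_jac \<alpha> x / (norm (\<alpha> (snd x)))\<^sup>2) *\<^sub>R
            (H_right U \<alpha> g x *\<^sub>H imq (\<alpha> (snd x)) *\<^sub>H f x
             + g x *\<^sub>H imq (\<alpha> (snd x)) *\<^sub>H H_left U \<alpha> f x))"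
proof -
  let ?E = "einterval s t"
  define G where "G = amap \<alpha> ` \<Omega>"
  define \<beta> where "\<beta> = inv_into U \<alpha>"
  define \<beta>' where "\<beta>' z = frechet_derivative \<beta> (at z)" for z
  define \<alpha>' where "\<alpha>' z = frechet_derivative \<alpha> (at z)" for z
  define b' where "b' y h = (fst h, \<beta>' (snd y) (snd h))" for y h :: quat
  define a' where "a' x h = (fst h, \<alpha>' (snd x) (snd h))" for x h :: quat
  have oU: "open U" and oV: "open V" and oO: "open \<Omega>"
    using assms(1,2,5) by (simp_all add: region_def)
  have bij: "bij_betw \<alpha> U V" and ca: "Ck_on 1 \<alpha> U" and cb: "Ck_on 1 \<beta> V"
    using assms(4) by (simp_all only: C1_diffeo_def \<beta>_def)
  note A = Ck_on_1D[OF oU ca, folded \<alpha>'_def] and Bt = Ck_on_1D[OF oV cb, folded \<beta>'_def]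
  have ba: "\<beta> (\<alpha> x) = x" "\<alpha> x \<in> V" if "x \<in> U" for x
    using bij that unfolding \<beta>_def bij_betw_def by auto
  have ab: "\<alpha> (\<beta> z) = z" "\<beta> z \<in> U" if "z \<in> V" for z
    using bij that unfolding \<beta>_def bij_betw_def by (auto simp: f_inv_into_f inv_into_into)
  have OU: "snd x \<in> U" "fst x \<in> ?E" if "x \<in> \<Omega>" for x
    using assms(6) that by (auto simp: mem_Times_iff)
  have GV: "snd y \<in> V" "fst y \<in> ?E" if "y \<in> closure G" for y
    using assms(7) that unfolding G_def by (auto simp: mem_Times_iff)
  have ba': "amap \<beta> (amap \<alpha> x) = x" if "x \<in> \<Omega>" for x
    using ba(1)[OF OU(1)[OF that]] by (simp add: amap_def)
  have ab': "amap \<alpha> (amap \<beta> y) = y" if "y \<in> closure G" for y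
    using ab(1)[OF GV(1)[OF that]] by (simp add: amap_def)
  have bder: "(amap \<beta> has_derivative b' y) (at y)" if "snd y \<in> V" for y
    unfolding b'_def[abs_def] by (rule amap_has_derivative[OF Bt(1)[OF that]])
  have ader: "(amap \<alpha> has_derivative a' x) (at x)" if "x \<in> \<Omega>" for x
    unfolding a'_def[abs_def] by (rule amap_has_derivative[OF A(1)[OF OU(1)[OF that]]])
  have cbV: "continuous_on (UNIV \<times> V) (amap \<beta>)"
    by (rule continuous_at_imp_continuous_on) (use bder has_derivative_continuous in force)
  \<comment> \<open>The image is the preimage of \<open>\<Omega>\<close> under the continuous
    inverse map, taken inside the open set \<open>?E \<times> V\<close>.\<close>
  have oG: "open G"
  proof -
    have "G = (?E \<times> V) \<inter> amap \<beta> -` \<Omega>"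
    proof (intro set_eqI iffI)
      fix y assume "y \<in> G"
      then obtain x where x: "x \<in> \<Omega>" "y = amap \<alpha> x" unfolding G_def by blast
      have "amap \<beta> y = x" unfolding x(2) by (rule ba'[OF x(1)])
      moreover have "y \<in> ?E \<times> V" unfolding x(2) amap_def using OU[OF x(1)] ba(2) by simp
      ultimately show "y \<in> (?E \<times> V) \<inter> amap \<beta> -` \<Omega>" using x(1) by simp
    next
      fix y assume y: "y \<in> (?E \<times> V) \<inter> amap \<beta> -` \<Omega>"
      then have "amap \<alpha> (amap \<beta> y) = y" using ab(1)[of "snd y"] by (auto simp: amap_def)
      moreover have "amap \<beta> y \<in> \<Omega>" using y by simp
      ultimately show "y \<in> G" unfolding G_def by (metis imageI)
    qed
    moreover have "open ((?E \<times> V) \<inter> amap \<beta> -` \<Omega>)"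
      by (rule continuous_open_preimage[OF continuous_on_subset[OF cbV] _ oO])
         (auto intro: open_Times open_einterval oV)
    ultimately show ?thesis by simp
  qed
  have nz: "closure G \<inter> {x. snd x = 0} = {}" using assms(12) by (simp only: G_def)
  have S: "compact (frontier G)" "smooth_surface (frontier G)" using assms(10,11) by (simp_all only: G_def)
  have bG: "bounded G" by (rule bounded_of_compact_frontier[OF S(1)]) (use nz closure_subset[of G] in blast)
  have cG: "compact (closure G)" using bG by simp
  \<comment> \<open>The compact closure of \<open>G\<close> lies in \<open>?E \<times> V\<close> by
    hypothesis, so regularity up to the boundary is drawn from the inverse map; boundedness of
    \<open>\<Omega>\<close> follows from it too.\<close>
  have cbG: "continuous_on (closure G) (amap \<beta>)"
    by (rule continuous_on_subset[OF cbV]) (use GV(1) in \<open>auto simp: mem_Times_iff\<close>)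
  have bGO: "amap \<beta> ` G \<subseteq> \<Omega>" unfolding G_def using ba' by auto
  have bGOc: "amap \<beta> ` closure G \<subseteq> closure \<Omega>"
    by (rule image_closure_subset[OF cbG closed_closure order_trans[OF bGO closure_subset]])
  have bO: "bounded \<Omega>"
  proof (rule bounded_subset[OF compact_imp_bounded[OF compact_continuous_image[OF cbG cG]]])
    show "\<Omega> \<subseteq> amap \<beta> ` closure G"
    proof
      fix x assume x: "x \<in> \<Omega>"
      have "amap \<alpha> x \<in> closure G" using x closure_subset[of G] unfolding G_def by blast
      then show "x \<in> amap \<beta> ` closure G" using ba'[OF x] by (metis imageI)
    qed
  qed
  have Cb: "C1_bounded G (amap \<beta>) b'"
    unfolding C1_bounded_def
  proof (intro conjI allI ballI cbG)
    show "(amap \<beta> has_derivative b' y) (at y)" if "y \<in> G" for y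
      by (rule bder) (use GV(1) that closure_subset in blast)
    fix h
    have c: "continuous_on (closure G) (\<lambda>y. b' y h)"
      unfolding b'_def
      by (intro continuous_intros continuous_on_compose2[OF Bt(2)[of "snd h"] continuous_on_snd[OF continuous_on_id]])
         (use GV(1) in blast)
    show "continuous_on G (\<lambda>y. b' y h)" by (rule continuous_on_subset[OF c closure_subset])
    show "bounded ((\<lambda>y. b' y h) ` G)"
      by (rule bounded_subset[OF compact_imp_bounded[OF compact_continuous_image[OF c cG]] image_mono[OF closure_subset]])
  qed
  let ?f' = "\<lambda>x. frechet_derivative f (at x)" and ?g' = "\<lambda>x. frechet_derivative g (at x)"
  note Cf = C1_bounded_compose[OF bG C1_closure_imp_C1_bounded[OF oO bO assms(13)] Cb bGO bGOc]
  note Cg = C1_bounded_compose[OF bG C1_closure_imp_C1_bounded[OF oO bO assms(14)] Cb bGO bGOc]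
  define F1 where "F1 y = g (amap \<beta> y) *\<^sub>H ((1 / (norm (snd y))\<^sup>2) *\<^sub>R imq (snd y)) *\<^sub>H f (amap \<beta> y)" for y
  define F2 where "F2 y = (1 / (norm (snd y))\<^sup>2) *\<^sub>R
        ((?g' (amap \<beta> y) (b' y (1,0)) *\<^sub>H imq (snd y) - ?g' (amap \<beta> y) (b' y (0, snd y))) *\<^sub>H imq (snd y) *\<^sub>H f (amap \<beta> y)
         + g (amap \<beta> y) *\<^sub>H imq (snd y) *\<^sub>H (imq (snd y) *\<^sub>H ?f' (amap \<beta> y) (b' y (1,0)) - ?f' (amap \<beta> y) (b' y (0, snd y))))" for y
  obtain J1 J2 where J: "has_bochner_integral lborel (\<lambda>y. indicator G y *\<^sub>R F1 y) J1"
    "has_bochner_integral lborel (\<lambda>y. indicator G y *\<^sub>R F2 y) J2"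
    "nu_integral G (\<lambda>y. g (amap \<beta> y)) (\<lambda>y. f (amap \<beta> y)) = 4 *\<^sub>R J1 - 2 *\<^sub>R J2"
    using has_bochner_integral_qmult_gauss[OF oG bG S nz Cg Cf, folded F1_def F2_def] by (elim exE conjE)
  \<comment> \<open>On the boundary of \<open>G\<close>, which carries the surface measure, the
    closure hypothesis puts \<open>y\<close> in \<open>?E \<times> V\<close>, and injectivity of
    \<open>amap \<alpha>\<close> then pins down the value of \<open>inv_into\<close>.\<close>
  have lhs: "transported_nu_integral (?E \<times> U) \<alpha> \<Omega> g f = nu_integral G (\<lambda>y. g (amap \<beta> y)) (\<lambda>y. f (amap \<beta> y))"
    unfolding transported_nu_integral_def G_def[symmetric] nu_integral_def
  proof (rule Bochner_Integration.integral_cong[OF refl])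
    fix y assume "y \<in> space (surface_measure (frontier G))"
    then have "y \<in> frontier G" by (simp only: space_surface_measure[OF S])
    then have y: "y \<in> closure G" by (simp add: frontier_def)
    have inv: "inv_into (?E \<times> U) (amap \<alpha>) y = amap \<beta> y"
    proof (rule inv_into_f_eq)
      show "amap \<alpha> (amap \<beta> y) = y" by (rule ab'[OF y])
      show "inj_on (amap \<alpha>) (?E \<times> U)"
        using bij_betw_imp_inj_on[OF bij] by (auto simp: inj_on_def amap_def)
      show "amap \<beta> y \<in> ?E \<times> U" using GV[OF y] ab(2) by (simp add: amap_def)
    qed
    show "(g \<circ> inv_into (?E \<times> U) (amap \<alpha>)) y *\<^sub>H nu_density G y *\<^sub>H (f \<circ> inv_into (?E \<times> U) (amap \<alpha>)) y
      = g (amap \<beta> y) *\<^sub>H nu_density G y *\<^sub>H f (amap \<beta> y)" by (simp only: o_apply inv)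
  qed
  have Mjac: "M_jac \<alpha> x = \<bar>qdet (a' x)\<bar>" if "x \<in> \<Omega>" for x
  proof -
    have "frechet_derivative (amap \<alpha>) (at x) = a' x" by (rule frechet_derivative_at[OF ader[OF that], symmetric])
    then show ?thesis by (simp add: M_jac_def jacobian_matrix_def qpartial_def)
  qed
  have cont: "continuous_on \<Omega> (amap \<alpha>)"
    using ader by (intro continuous_at_imp_continuous_on ballI has_derivative_continuous)
  have inj: "inj_on (amap \<alpha>) \<Omega>" by (rule inj_on_inverseI[of _ "amap \<beta>"]) (rule ba')
  let ?J = "\<lambda>x. \<bar>qdet (a' x)\<bar>"
  have cJ: "continuous_on \<Omega> ?J"
    unfolding det_def a'_def vec_lambda_beta
    by (intro continuous_intros continuous_on_compose2[OF A(2) continuous_on_snd[OF continuous_on_id]])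
       (use OU(1) in blast)
  have Jm: "(\<lambda>x. indicator \<Omega> x * ?J x) \<in> borel_measurable borel"
    using borel_measurable_continuous_on_indicator[OF _ cJ] oO by simp
  have Ob: "\<Omega> \<in> sets borel" and Gb: "amap \<alpha> ` \<Omega> \<in> sets borel" using oO oG unfolding G_def by simp_all
  have dist: "distr (density lborel (\<lambda>x. ennreal (indicator \<Omega> x * ?J x))) borel (\<lambda>x. if x \<in> \<Omega> then amap \<alpha> x else 0)
    = density lborel (indicator (amap \<alpha> ` \<Omega>))"
    by (rule distr_change_of_variables_quat[OF Ob Gb ader inj Jm])
  \<comment> \<open>Both volume integrals are transported by this rule; what remains for each is a
    pointwise identity at \<open>amap \<alpha> x\<close>.\<close>
  have pull: "(LINT x:\<Omega>|lborel. R x) = I"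
    if F: "has_bochner_integral lborel (\<lambda>y. indicator G y *\<^sub>R F y) I"
      and R: "\<And>x. x \<in> \<Omega> \<Longrightarrow> R x = M_jac \<alpha> x *\<^sub>R F (amap \<alpha> x)" for F R :: "quat \<Rightarrow> quat" and I
  proof -
    have Fm: "(\<lambda>y. indicator (amap \<alpha> ` \<Omega>) y *\<^sub>R F y) \<in> borel_measurable borel"
      using borel_measurable_has_bochner_integral[OF F] unfolding G_def by simp
    have "has_bochner_integral lborel (\<lambda>x. indicator \<Omega> x *\<^sub>R ?J x *\<^sub>R F (amap \<alpha> x)) I"
      using has_bochner_integral_change_of_variables[OF Ob Gb cont Jm _ dist Fm, of I] F unfolding G_def by simp
    also have "(\<lambda>x. indicator \<Omega> x *\<^sub>R ?J x *\<^sub>R F (amap \<alpha> x)) = (\<lambda>x. indicator \<Omega> x *\<^sub>R R x)"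
    proof
      fix x show "indicator \<Omega> x *\<^sub>R ?J x *\<^sub>R F (amap \<alpha> x) = indicator \<Omega> x *\<^sub>R R x"
        by (cases "x \<in> \<Omega>") (simp_all add: R Mjac)
    qed
    finally show ?thesis unfolding set_lebesgue_integral_def by (rule has_bochner_integral_integral_eq)
  qed
  have rhs1: "(LINT x:\<Omega>|lborel. M_jac \<alpha> x *\<^sub>R
      (g x *\<^sub>H ((1 / (norm (\<alpha> (snd x)))\<^sup>2) *\<^sub>R imq (\<alpha> (snd x))) *\<^sub>H f x)) = J1"
    by (rule pull[OF J(1)]) (simp add: F1_def ba', simp add: amap_def)
  \<comment> \<open>The coefficients u_i are the components of the derivative of the inverse map at
    \<open>\<alpha> (snd x)\<close>, applied to \<open>\<alpha> (snd x)\<close> itself.\<close>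
  have ucoeff: "u_coeff U \<alpha> i (snd x) = \<beta>' (\<alpha> (snd x)) (\<alpha> (snd x)) $ i" if x: "x \<in> \<Omega>" for x i
  proof -
    let ?z = "\<alpha> (snd x)"
    have zV: "?z \<in> V" by (rule ba(2)[OF OU(1)[OF x]])
    have "((\<lambda>y. \<beta> y $ i) has_derivative (\<lambda>h. \<beta>' ?z h $ i)) (at ?z)"
      using Bt(1)[OF zV] by (rule bounded_linear.has_derivative[OF bounded_linear_vec_nth])
    from frechet_derivative_at[OF this]
    have "frechet_derivative (\<lambda>y. \<beta> y $ i) (at ?z) = (\<lambda>h. \<beta>' ?z h $ i)" by (rule sym)
    then have "u_coeff U \<alpha> i (snd x) = (\<Sum>j\<in>UNIV. ?z $ j * \<beta>' ?z (axis j 1) $ i)"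
      by (simp add: u_coeff_def \<beta>_def[symmetric])
    also have "\<dots> = \<beta>' ?z ?z $ i"
      unfolding linear_axis_sum[OF has_derivative_linear[OF Bt(1)[OF zV]], of ?z] by simp
    finally show ?thesis .
  qed
  \<comment> \<open>Hence the sum in the operators is the derivative of \<open>k\<close> composed
    with \<open>amap \<beta>\<close> in direction \<open>(0, snd y)\<close> at
    \<open>y = amap \<alpha> x\<close>, the very term in \<open>F2\<close>.\<close>
  have Hsum: "(\<Sum>i\<in>UNIV. u_coeff U \<alpha> i (snd x) *\<^sub>R qpartial (Some i) k x) = frechet_derivative k (at x) (b' (amap \<alpha> x) (0, \<alpha> (snd x)))"
    if x: "x \<in> \<Omega>" and k: "C1_closure \<Omega> k" for x k
  proof -
    let ?w = "\<beta>' (\<alpha> (snd x)) (\<alpha> (snd x))"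
    have lin: "linear (frechet_derivative k (at x))"
      using C1_boundedD(2)[OF C1_closure_imp_C1_bounded[OF oO bO k] x] by (rule has_derivative_linear)
    have w: "(0, ?w) = (\<Sum>i\<in>UNIV. ?w $ i *\<^sub>R qunit (Some i))"
      by (simp add: sum_3 qunit_simps vec_eq_iff forall_3 axis_def)
    have "b' (amap \<alpha> x) (0, \<alpha> (snd x)) = (0, ?w)" by (simp add: b'_def amap_def)
    then show ?thesis
      by (simp only: w linear_sum[OF lin] linear_scale[OF lin] ucoeff[OF x] qpartial_def)
  qed
  have b10: "b' (amap \<alpha> x) (1,0) = qunit None" if x: "x \<in> \<Omega>" for x
    using linear_0[OF has_derivative_linear[OF Bt(1)[OF ba(2)[OF OU(1)[OF x]]]]]
    by (simp add: b'_def amap_def qunit_simps)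
  have rhs2: "(LINT x:\<Omega>|lborel. (M_jac \<alpha> x / (norm (\<alpha> (snd x)))\<^sup>2) *\<^sub>R
            (H_right U \<alpha> g x *\<^sub>H imq (\<alpha> (snd x)) *\<^sub>H f x
             + g x *\<^sub>H imq (\<alpha> (snd x)) *\<^sub>H H_left U \<alpha> f x)) = J2"
  proof (rule pull[OF J(2)])
    fix x assume x: "x \<in> \<Omega>"
    have sa: "snd (amap \<alpha> x) = \<alpha> (snd x)" by (simp add: amap_def)
    have "F2 (amap \<alpha> x) = (1 / (norm (\<alpha> (snd x)))\<^sup>2) *\<^sub>R
       (H_right U \<alpha> g x *\<^sub>H imq (\<alpha> (snd x)) *\<^sub>H f x + g x *\<^sub>H imq (\<alpha> (snd x)) *\<^sub>H H_left U \<alpha> f x)"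
      unfolding F2_def sa ba'[OF x] H_left_def H_right_def b10[OF x] Hsum[OF x assms(13)] Hsum[OF x assms(14)]
      by (simp only: qpartial_def)
    then show "(M_jac \<alpha> x / (norm (\<alpha> (snd x)))\<^sup>2) *\<^sub>R
            (H_right U \<alpha> g x *\<^sub>H imq (\<alpha> (snd x)) *\<^sub>H f x
             + g x *\<^sub>H imq (\<alpha> (snd x)) *\<^sub>H H_left U \<alpha> f x) = M_jac \<alpha> x *\<^sub>R F2 (amap \<alpha> x)" by simp
  qed
  show ?thesis unfolding lhs J(3) rhs1 rhs2 ..
qed

end
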